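(* Let $K$ be a unital commutative ring, $\Lambda$ a set, and $\mathfrak g=\mathrm F^{\mathrm{Lie}}_K[X_\lambda:\lambda\in\Lambda]$ the free Lie $K$-algebra on the generators $X_\lambda$. Then the Poincaré–Birkhoff–Witt theorem holds for $\mathfrak g$: for every $n\ge0$ the natural map $\boldsymbol m^{(n)}:\bigodot^n\mathfrak g\to\mathcal U^n\mathfrak g/\mathcal U^{n-1}\mathfrak g$ is an isomorphism of $K$-modules.
   Context: A Lie $K$-algebra is a $K$-module with a $K$-bilinear bracket satisfying $[x,x]=0$ and the Jacobi identity. All tensor products are over $K$. The universal enveloping algebra $\mathcal U\mathfrak g$ is the tensor algebra $\bigotimes\mathfrak g=\bigoplus_{n\ge0}\mathfrak g^{\otimes n}$ modulo the two-sided ideal generated by the elements $X\otimes Y-Y\otimes X-[X,Y]$ ($X,Y\in\mathfrak g$); $\boldsymbol m:\bigotimes\mathfrak g\to\mathcal U\mathfrak g$ is the quotient map. $\mathcal U^n\mathfrak g=\boldsymbol m\bigl(\bigoplus_{j\le n}\mathfrak g^{\otimes j}\bigr)$, with $\mathcal U^{-1}\mathfrak g=0$. $\bigodot^n\mathfrak g$ is the $n$-th symmetric power of $\mathfrak g$ over $K$ (quotient of $\mathfrak g^{\otimes n}$ by permutations). The surjection $\boldsymbol m^{(n)}$ sends $x_1\odot\cdots\odot x_n$ to the class of $\boldsymbol m(x_1\otimes\cdots\otimes x_n)$. *)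

theory Defs
  imports "HOL-Combinatorics.Permutations" "HOL-Algebra.Module" "HOL-Algebra.QuotRing"
begin

section \<open>Modules and algebras over a commutative ring\<close>

text \<open>
  Modules, nonassociative algebras, Lie algebras and associative algebras over a commutative ring
  are all records of type \<open>('k, 'a) module\<close>.  The field \<open>mult\<close> carries the product (for a Lie
  algebra, the bracket) and is irrelevant for a bare module; \<open>one\<close> is meaningful only for unital
  algebras.
\<close>

definition module_span :: "('k, 'r) ring_scheme \<Rightarrow> ('k, 'a, 'm) module_scheme \<Rightarrow> 'a set \<Rightarrow> 'a set"
  where "module_span R M S = \<Inter>{N. submodule N R M \<and> S \<subseteq> N}"

definition algebra_ideal ::
    "('k, 'r) ring_scheme \<Rightarrow> ('k, 'a, 'm) module_scheme \<Rightarrow> 'a set \<Rightarrow> bool"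
  where "algebra_ideal R A I \<longleftrightarrow>
    submodule I R A \<and>
    (\<forall>a\<in>carrier A. \<forall>x\<in>I. a \<otimes>\<^bsub>A\<^esub> x \<in> I \<and> x \<otimes>\<^bsub>A\<^esub> a \<in> I)"

definition gen_algebra_ideal ::
    "('k, 'r) ring_scheme \<Rightarrow> ('k, 'a, 'm) module_scheme \<Rightarrow> 'a set \<Rightarrow> 'a set"
  where "gen_algebra_ideal R A S = \<Inter>{I. algebra_ideal R A I \<and> S \<subseteq> I}"

text \<open>
  The quotient of a module by a submodule, or of an algebra by a two-sided ideal: \<^const>\<open>FactRing\<close>
  with the induced scalar multiplication.  Elements are cosets.
\<close>

definition quot :: "('k, 'a, 'm) module_scheme \<Rightarrow> 'a set \<Rightarrow> ('k, 'a set) module"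
  where "quot M N =
    \<lparr>carrier = carrier (M Quot N), mult = mult (M Quot N), one = one (M Quot N),
     zero = zero (M Quot N), add = add (M Quot N),
     smult = (\<lambda>a X. \<Union>x\<in>X. N +>\<^bsub>M\<^esub> (a \<odot>\<^bsub>M\<^esub> x))\<rparr>"

definition module_iso ::
    "('k, 'r) ring_scheme \<Rightarrow> ('k, 'a, 'm) module_scheme \<Rightarrow> ('k, 'b, 'n) module_scheme \<Rightarrow> ('a \<Rightarrow> 'b) set"
  where "module_iso R M N =
    {f \<in> iso (add_monoid M) (add_monoid N).
       \<forall>a\<in>carrier R. \<forall>x\<in>carrier M. f (a \<odot>\<^bsub>M\<^esub> x) = a \<odot>\<^bsub>N\<^esub> f x}"

locale nonassoc_algebra = module R A for R (structure) and A (structure) +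
  assumes prod_closed:
      "\<lbrakk>x \<in> carrier A; y \<in> carrier A\<rbrakk> \<Longrightarrow> x \<otimes>\<^bsub>A\<^esub> y \<in> carrier A"
    and prod_add_left:
      "\<lbrakk>x \<in> carrier A; y \<in> carrier A; z \<in> carrier A\<rbrakk> \<Longrightarrow>
       (x \<oplus>\<^bsub>A\<^esub> y) \<otimes>\<^bsub>A\<^esub> z = x \<otimes>\<^bsub>A\<^esub> z \<oplus>\<^bsub>A\<^esub> y \<otimes>\<^bsub>A\<^esub> z"
    and prod_add_right:
      "\<lbrakk>x \<in> carrier A; y \<in> carrier A; z \<in> carrier A\<rbrakk> \<Longrightarrow>
       x \<otimes>\<^bsub>A\<^esub> (y \<oplus>\<^bsub>A\<^esub> z) = x \<otimes>\<^bsub>A\<^esub> y \<oplus>\<^bsub>A\<^esub> x \<otimes>\<^bsub>A\<^esub> z"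
    and prod_smult_left:
      "\<lbrakk>a \<in> carrier R; x \<in> carrier A; y \<in> carrier A\<rbrakk> \<Longrightarrow>
       (a \<odot>\<^bsub>A\<^esub> x) \<otimes>\<^bsub>A\<^esub> y = a \<odot>\<^bsub>A\<^esub> (x \<otimes>\<^bsub>A\<^esub> y)"
    and prod_smult_right:
      "\<lbrakk>a \<in> carrier R; x \<in> carrier A; y \<in> carrier A\<rbrakk> \<Longrightarrow>
       x \<otimes>\<^bsub>A\<^esub> (a \<odot>\<^bsub>A\<^esub> y) = a \<odot>\<^bsub>A\<^esub> (x \<otimes>\<^bsub>A\<^esub> y)"

locale lie_algebra = nonassoc_algebra R L for R (structure) and L (structure) +
  assumes bracket_self: "x \<in> carrier L \<Longrightarrow> x \<otimes>\<^bsub>L\<^esub> x = \<zero>\<^bsub>L\<^esub>"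
    and jacobi:
      "\<lbrakk>x \<in> carrier L; y \<in> carrier L; z \<in> carrier L\<rbrakk> \<Longrightarrow>
       x \<otimes>\<^bsub>L\<^esub> (y \<otimes>\<^bsub>L\<^esub> z) \<oplus>\<^bsub>L\<^esub> y \<otimes>\<^bsub>L\<^esub> (z \<otimes>\<^bsub>L\<^esub> x) \<oplus>\<^bsub>L\<^esub> z \<otimes>\<^bsub>L\<^esub> (x \<otimes>\<^bsub>L\<^esub> y) = \<zero>\<^bsub>L\<^esub>"


section \<open>Free modules\<close>

definition free_module :: "('k, 'r) ring_scheme \<Rightarrow> 'x set \<Rightarrow> ('k, 'x \<Rightarrow> 'k) module"
  where "free_module R X =
    \<lparr>carrier = {f. (\<forall>x. f x \<in> carrier R) \<and> (\<forall>x. x \<notin> X \<longrightarrow> f x = \<zero>\<^bsub>R\<^esub>) \<and> finite {x. f x \<noteq> \<zero>\<^bsub>R\<^esub>}},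
     mult = undefined, one = undefined,
     zero = (\<lambda>x. \<zero>\<^bsub>R\<^esub>), add = (\<lambda>f g x. f x \<oplus>\<^bsub>R\<^esub> g x),
     smult = (\<lambda>a f x. a \<otimes>\<^bsub>R\<^esub> f x)\<rparr>"

definition unit_vec :: "('k, 'r) ring_scheme \<Rightarrow> 'x \<Rightarrow> 'x \<Rightarrow> 'k"
  where "unit_vec R x = (\<lambda>y. if y = x then \<one>\<^bsub>R\<^esub> else \<zero>\<^bsub>R\<^esub>)"


section \<open>The free Lie algebra\<close>

text \<open>
  Nonassociative words (binary trees with labelled leaves), i.e. the free magma.  The free module on
  them, with the product extended bilinearly from \<open>Node\<close>, is the free nonassociative algebra; the
  free Lie algebra is its quotient by the ideal generated by all \<open>x x\<close> and all Jacobi expressions.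
\<close>

datatype (gens: 'v) magma = Gen 'v | Node "'v magma" "'v magma"

definition free_nonassoc ::
    "('k, 'r) ring_scheme \<Rightarrow> 'v set \<Rightarrow> ('k, 'v magma \<Rightarrow> 'k) module"
  where "free_nonassoc R \<Lambda> = (free_module R {t. gens t \<subseteq> \<Lambda>})
    \<lparr>mult := (\<lambda>f g t. case t of Gen v \<Rightarrow> \<zero>\<^bsub>R\<^esub> | Node s u \<Rightarrow> f s \<otimes>\<^bsub>R\<^esub> g u)\<rparr>"

definition lie_relators :: "('k, 'a, 'm) module_scheme \<Rightarrow> 'a set"
  where "lie_relators A =
    {x \<otimes>\<^bsub>A\<^esub> x | x. x \<in> carrier A} \<union>
    {x \<otimes>\<^bsub>A\<^esub> (y \<otimes>\<^bsub>A\<^esub> z) \<oplus>\<^bsub>A\<^esub> y \<otimes>\<^bsub>A\<^esub> (z \<otimes>\<^bsub>A\<^esub> x) \<oplus>\<^bsub>A\<^esub> z \<otimes>\<^bsub>A\<^esub> (x \<otimes>\<^bsub>A\<^esub> y) | x y z.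
       x \<in> carrier A \<and> y \<in> carrier A \<and> z \<in> carrier A}"

definition free_lie ::
    "('k, 'r) ring_scheme \<Rightarrow> 'v set \<Rightarrow> ('k, ('v magma \<Rightarrow> 'k) set) module"
  where "free_lie R \<Lambda> =
    quot (free_nonassoc R \<Lambda>)
      (gen_algebra_ideal R (free_nonassoc R \<Lambda>) (lie_relators (free_nonassoc R \<Lambda>)))"


subsection \<open>It is a Lie algebra\<close>

lemma free_module_module:
  fixes R :: "('k, 'r) ring_scheme" and X :: "'x set"
  assumes "cring R" shows "module R (free_module R X)"
proof -
  interpret cring R by fact
  have fin2: "finite {x. f x \<oplus>\<^bsub>R\<^esub> g x \<noteq> \<zero>\<^bsub>R\<^esub>}"
    if "finite {x. f x \<noteq> \<zero>\<^bsub>R\<^esub>}" "finite {x. g x \<noteq> \<zero>\<^bsub>R\<^esub>}" for f g :: "'x \<Rightarrow> 'k"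
    by (rule finite_subset[of _ "{x. f x \<noteq> \<zero>\<^bsub>R\<^esub>} \<union> {x. g x \<noteq> \<zero>\<^bsub>R\<^esub>}"]) (use that in auto)
  have fins: "finite {x. a \<otimes>\<^bsub>R\<^esub> f x \<noteq> \<zero>\<^bsub>R\<^esub>}"
    if "finite {x. f x \<noteq> \<zero>\<^bsub>R\<^esub>}" "a \<in> carrier R" for f :: "'x \<Rightarrow> 'k" and a
    by (rule finite_subset[of _ "{x. f x \<noteq> \<zero>\<^bsub>R\<^esub>}"]) (use that in auto)
  have inv: "\<exists>g\<in>carrier (free_module R X). g \<oplus>\<^bsub>free_module R X\<^esub> f = \<zero>\<^bsub>free_module R X\<^esub>"
    if "f \<in> carrier (free_module R X)" for f
  proof (rule bexI[of _ "\<lambda>x. \<ominus>\<^bsub>R\<^esub> f x"])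
    have "finite {x. \<ominus>\<^bsub>R\<^esub> f x \<noteq> \<zero>\<^bsub>R\<^esub>}"
      by (rule finite_subset[of _ "{x. f x \<noteq> \<zero>\<^bsub>R\<^esub>}"]) (use that in \<open>auto simp: free_module_def\<close>)
    with that show "(\<lambda>x. \<ominus>\<^bsub>R\<^esub> f x) \<in> carrier (free_module R X)"
      by (auto simp: free_module_def)
  qed (use that in \<open>auto simp: free_module_def l_neg\<close>)
  show ?thesis
  proof (rule moduleI[OF \<open>cring R\<close>])
    show "abelian_group (free_module R X)"
    proof (rule abelian_groupI)
      fix f g assume "f \<in> carrier (free_module R X)" "g \<in> carrier (free_module R X)"
      then show "f \<oplus>\<^bsub>free_module R X\<^esub> g \<in> carrier (free_module R X)"
        using fin2[of f g] by (simp add: free_module_def)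
    next
      show "\<exists>g\<in>carrier (free_module R X). g \<oplus>\<^bsub>free_module R X\<^esub> f = \<zero>\<^bsub>free_module R X\<^esub>"
        if "f \<in> carrier (free_module R X)" for f by (rule inv[OF that])
    qed (simp_all add: free_module_def fun_eq_iff a_ac)
  next
    fix a f assume "a \<in> carrier R" "f \<in> carrier (free_module R X)"
    then show "a \<odot>\<^bsub>free_module R X\<^esub> f \<in> carrier (free_module R X)"
      using fins[of f a] by (simp add: free_module_def)
  qed (simp_all add: free_module_def l_distr r_distr m_assoc)
qed

lemma (in module) module_quot:
  assumes N: "submodule N R M"
  shows "module R (quot M N)"
    and "\<And>x y. \<lbrakk>x \<in> carrier M; y \<in> carrier M\<rbrakk> \<Longrightarrow>
           (N +>\<^bsub>M\<^esub> x) \<oplus>\<^bsub>quot M N\<^esub> (N +>\<^bsub>M\<^esub> y) = N +>\<^bsub>M\<^esub> (x \<oplus>\<^bsub>M\<^esub> y)"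
    and "\<And>a x. \<lbrakk>a \<in> carrier R; x \<in> carrier M\<rbrakk> \<Longrightarrow>
           a \<odot>\<^bsub>quot M N\<^esub> (N +>\<^bsub>M\<^esub> x) = N +>\<^bsub>M\<^esub> (a \<odot>\<^bsub>M\<^esub> x)"
proof -
  interpret N: subgroup N "add_monoid M"
    using N by (rule submodule.axioms)
  interpret ab: abelian_subgroup N M
    by (rule abelian_subgroupI3) (use N.subgroup_axioms in \<open>auto intro: additive_subgroupI M.abelian_group_axioms\<close>)
  have add: "(N +>\<^bsub>M\<^esub> x) \<oplus>\<^bsub>quot M N\<^esub> (N +>\<^bsub>M\<^esub> y) = N +>\<^bsub>M\<^esub> (x \<oplus>\<^bsub>M\<^esub> y)"
    if "x \<in> carrier M" "y \<in> carrier M" for x y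
    using that by (simp add: quot_def FactRing_def ab.a_rcos_sum)
  have smult: "a \<odot>\<^bsub>quot M N\<^esub> (N +>\<^bsub>M\<^esub> x) = N +>\<^bsub>M\<^esub> (a \<odot>\<^bsub>M\<^esub> x)"
    if a: "a \<in> carrier R" and x: "x \<in> carrier M" for a x
  proof -
    have "N +>\<^bsub>M\<^esub> (a \<odot>\<^bsub>M\<^esub> y) = N +>\<^bsub>M\<^esub> (a \<odot>\<^bsub>M\<^esub> x)" if yy: "y \<in> N +>\<^bsub>M\<^esub> x" for y
    proof -
      obtain h where h: "h \<in> N" "y = h \<oplus>\<^bsub>M\<^esub> x" using yy unfolding a_r_coset_def r_coset_def by auto
      have "h \<in> carrier M" using h N.subset by auto
      then have "a \<odot>\<^bsub>M\<^esub> y = a \<odot>\<^bsub>M\<^esub> h \<oplus>\<^bsub>M\<^esub> a \<odot>\<^bsub>M\<^esub> x"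
        using h a x by (simp add: smult_r_distr)
      moreover have "a \<odot>\<^bsub>M\<^esub> h \<in> N" using submodule.smult_closed[OF N a] h by auto
      ultimately have "a \<odot>\<^bsub>M\<^esub> y \<in> N +>\<^bsub>M\<^esub> (a \<odot>\<^bsub>M\<^esub> x)" unfolding a_r_coset_def r_coset_def by auto
      then show ?thesis using ab.a_repr_independence'[OF _ smult_closed[OF a x]] by simp
    qed
    moreover have "x \<in> N +>\<^bsub>M\<^esub> x" by (rule ab.a_rcos_self[OF x])
    ultimately have "(\<Union>y\<in>N +>\<^bsub>M\<^esub> x. N +>\<^bsub>M\<^esub> (a \<odot>\<^bsub>M\<^esub> y)) = N +>\<^bsub>M\<^esub> (a \<odot>\<^bsub>M\<^esub> x)" by blast
    then show ?thesis by (simp add: quot_def)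
  qed
  have carr: "carrier (quot M N) = (\<lambda>x. N +>\<^bsub>M\<^esub> x) ` carrier M"
    by (auto simp: quot_def FactRing_def A_RCOSETS_def')
  have zero: "\<zero>\<^bsub>quot M N\<^esub> = N +>\<^bsub>M\<^esub> \<zero>\<^bsub>M\<^esub>"
    using N.subset by (simp add: quot_def FactRing_def M.a_coset_add_zero)
  show "module R (quot M N)"
  proof (rule moduleI)
    show "abelian_group (quot M N)"
    proof (rule abelian_groupI)
      show "\<exists>y\<in>carrier (quot M N). y \<oplus>\<^bsub>quot M N\<^esub> x = \<zero>\<^bsub>quot M N\<^esub>" if xq: "x \<in> carrier (quot M N)" for x
      proof -
        obtain z where "z \<in> carrier M" "x = N +>\<^bsub>M\<^esub> z" using xq carr by auto
        then show ?thesis unfolding carr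
          by (intro bexI[of _ "N +>\<^bsub>M\<^esub> (\<ominus>\<^bsub>M\<^esub> z)"]) (auto simp: add zero M.l_neg)
      qed
    qed (unfold carr zero, ((elim imageE)?, simp add: add M.a_ac)+)
  qed (unfold carr, ((elim imageE)?, simp add: add smult smult_l_distr smult_r_distr
         smult_assoc1 R.is_cring)+)
  show "\<And>x y. \<lbrakk>x \<in> carrier M; y \<in> carrier M\<rbrakk> \<Longrightarrow>
           (N +>\<^bsub>M\<^esub> x) \<oplus>\<^bsub>quot M N\<^esub> (N +>\<^bsub>M\<^esub> y) = N +>\<^bsub>M\<^esub> (x \<oplus>\<^bsub>M\<^esub> y)" by (rule add)
  show "\<And>a x. \<lbrakk>a \<in> carrier R; x \<in> carrier M\<rbrakk> \<Longrightarrow>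
           a \<odot>\<^bsub>quot M N\<^esub> (N +>\<^bsub>M\<^esub> x) = N +>\<^bsub>M\<^esub> (a \<odot>\<^bsub>M\<^esub> x)" by (rule smult)
qed

lemma carrier_quot: "carrier (quot M N) = (\<lambda>x. N +>\<^bsub>M\<^esub> x) ` carrier M"
  by (auto simp: quot_def FactRing_def A_RCOSETS_def')

context nonassoc_algebra
begin

lemma quot_mult:
  assumes I: "algebra_ideal R A I" and x: "x \<in> carrier A" and y: "y \<in> carrier A"
  shows "(I +>\<^bsub>A\<^esub> x) \<otimes>\<^bsub>quot A I\<^esub> (I +>\<^bsub>A\<^esub> y) = I +>\<^bsub>A\<^esub> (x \<otimes>\<^bsub>A\<^esub> y)"
proof -
  have N: "submodule I R A" using I by (simp add: algebra_ideal_def)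
  interpret N: subgroup I "add_monoid A"
    using N by (rule submodule.axioms)
  interpret ab: abelian_subgroup I A
    by (rule abelian_subgroupI3) (use N.subgroup_axioms in \<open>auto intro: additive_subgroupI M.abelian_group_axioms\<close>)
  have "I +>\<^bsub>A\<^esub> (x' \<otimes>\<^bsub>A\<^esub> y') = I +>\<^bsub>A\<^esub> (x \<otimes>\<^bsub>A\<^esub> y)" if yy: "x' \<in> I +>\<^bsub>A\<^esub> x" "y' \<in> I +>\<^bsub>A\<^esub> y" for x' y'
  proof -
    obtain h k where h: "h \<in> I" "x' = h \<oplus>\<^bsub>A\<^esub> x" and k: "k \<in> I" "y' = k \<oplus>\<^bsub>A\<^esub> y"
      using yy unfolding a_r_coset_def r_coset_def by auto
    have hc: "h \<in> carrier A" "k \<in> carrier A" using h k N.subset by auto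
    have "x' \<otimes>\<^bsub>A\<^esub> y' = (h \<otimes>\<^bsub>A\<^esub> y' \<oplus>\<^bsub>A\<^esub> x \<otimes>\<^bsub>A\<^esub> k) \<oplus>\<^bsub>A\<^esub> x \<otimes>\<^bsub>A\<^esub> y"
      using hc h k x y by (simp add: prod_add_left prod_add_right prod_closed M.a_ac)
    moreover have "h \<otimes>\<^bsub>A\<^esub> y' \<in> I" "x \<otimes>\<^bsub>A\<^esub> k \<in> I"
      using I h k hc x y by (auto simp: algebra_ideal_def)
    then have "h \<otimes>\<^bsub>A\<^esub> y' \<oplus>\<^bsub>A\<^esub> x \<otimes>\<^bsub>A\<^esub> k \<in> I" using N.m_closed by auto
    ultimately have "x' \<otimes>\<^bsub>A\<^esub> y' \<in> I +>\<^bsub>A\<^esub> (x \<otimes>\<^bsub>A\<^esub> y)" unfolding a_r_coset_def r_coset_def by auto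
    then show ?thesis using ab.a_repr_independence'[OF _ prod_closed[OF x y]] by simp
  qed
  moreover have "x \<in> I +>\<^bsub>A\<^esub> x" "y \<in> I +>\<^bsub>A\<^esub> y" by (rule ab.a_rcos_self[OF x], rule ab.a_rcos_self[OF y])
  ultimately have "(\<Union>a\<in>I +>\<^bsub>A\<^esub> x. \<Union>b\<in>I +>\<^bsub>A\<^esub> y. I +>\<^bsub>A\<^esub> (a \<otimes>\<^bsub>A\<^esub> b)) = I +>\<^bsub>A\<^esub> (x \<otimes>\<^bsub>A\<^esub> y)"
    by blast
  then show ?thesis by (simp add: quot_def FactRing_def rcoset_mult_def)
qed

lemma gen_algebra_ideal:
  assumes "S \<subseteq> carrier A"
  shows "algebra_ideal R A (gen_algebra_ideal R A S)" "S \<subseteq> gen_algebra_ideal R A S"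
proof -
  have c: "algebra_ideal R A (carrier A)"
    by (auto simp: algebra_ideal_def carrier_is_submodule prod_closed)
  have z0: "\<zero>\<^bsub>A\<^esub> \<in> I" if "submodule I R A" for I
    using subgroup.one_closed[OF submodule.axioms(1)[OF that]] by simp
  have ne: "{I. algebra_ideal R A I \<and> S \<subseteq> I} \<noteq> {}" using c assms by auto
  have sub: "submodule (gen_algebra_ideal R A S) R A"
  proof (rule submoduleI)
    show "gen_algebra_ideal R A S \<subseteq> carrier A" using c assms by (auto simp: gen_algebra_ideal_def)
  next
    show "\<zero>\<^bsub>A\<^esub> \<in> gen_algebra_ideal R A S" using z0 by (simp add: gen_algebra_ideal_def algebra_ideal_def)
  next
    fix v assume "v \<in> gen_algebra_ideal R A S"
    then show "\<ominus>\<^bsub>A\<^esub> v \<in> gen_algebra_ideal R A S"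
      unfolding gen_algebra_ideal_def algebra_ideal_def by (auto dest: submoduleE(3))
  next
    fix v w assume "v \<in> gen_algebra_ideal R A S" "w \<in> gen_algebra_ideal R A S"
    then show "v \<oplus>\<^bsub>A\<^esub> w \<in> gen_algebra_ideal R A S"
      unfolding gen_algebra_ideal_def algebra_ideal_def by (auto dest: submoduleE(5))
  next
    fix a v assume "a \<in> carrier R" "v \<in> gen_algebra_ideal R A S"
    then show "a \<odot>\<^bsub>A\<^esub> v \<in> gen_algebra_ideal R A S"
      unfolding gen_algebra_ideal_def algebra_ideal_def by (auto dest: submoduleE(4))
  qed
  then show "algebra_ideal R A (gen_algebra_ideal R A S)"
    by (auto simp: algebra_ideal_def gen_algebra_ideal_def)
  show "S \<subseteq> gen_algebra_ideal R A S" by (auto simp: gen_algebra_ideal_def)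
qed

lemma lie_quot: "lie_algebra R (quot A (gen_algebra_ideal R A (lie_relators A)))"
proof -
  let ?I = "gen_algebra_ideal R A (lie_relators A)"
  have S: "lie_relators A \<subseteq> carrier A" by (auto simp: lie_relators_def prod_closed)
  note I = gen_algebra_ideal[OF S]
  have sm: "submodule ?I R A" using I by (auto simp: algebra_ideal_def)
  interpret N: subgroup ?I "add_monoid A"
    using sm by (rule submodule.axioms)
  note q = module_quot[OF sm]
  have z: "?I +>\<^bsub>A\<^esub> x = \<zero>\<^bsub>quot A ?I\<^esub>" if "x \<in> lie_relators A" for x
    using that I(2) N.subset S N.rcos_const[OF M.add.is_group, of x]
    by (auto simp: quot_def FactRing_def a_r_coset_def)
  interpret Q: module R "quot A ?I" by (rule q)
  show ?thesis
  proof
    fix x assume "x \<in> carrier (quot A ?I)"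
    then obtain u where u: "u \<in> carrier A" "x = ?I +>\<^bsub>A\<^esub> u" by (auto simp: carrier_quot)
    have "x \<otimes>\<^bsub>quot A ?I\<^esub> x = ?I +>\<^bsub>A\<^esub> (u \<otimes>\<^bsub>A\<^esub> u)" using u quot_mult[OF I(1)] by simp
    also have "\<dots> = \<zero>\<^bsub>quot A ?I\<^esub>" using u by (intro z) (auto simp: lie_relators_def)
    finally show "x \<otimes>\<^bsub>quot A ?I\<^esub> x = \<zero>\<^bsub>quot A ?I\<^esub>" .
  next
    fix x y z assume "x \<in> carrier (quot A ?I)" "y \<in> carrier (quot A ?I)" "z \<in> carrier (quot A ?I)"
    then obtain u v w where u: "u \<in> carrier A" "x = ?I +>\<^bsub>A\<^esub> u" "v \<in> carrier A" "y = ?I +>\<^bsub>A\<^esub> v"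
      "w \<in> carrier A" "z = ?I +>\<^bsub>A\<^esub> w" by (auto simp: carrier_quot)
    have "?I +>\<^bsub>A\<^esub> (u \<otimes>\<^bsub>A\<^esub> (v \<otimes>\<^bsub>A\<^esub> w) \<oplus>\<^bsub>A\<^esub> v \<otimes>\<^bsub>A\<^esub> (w \<otimes>\<^bsub>A\<^esub> u) \<oplus>\<^bsub>A\<^esub> w \<otimes>\<^bsub>A\<^esub> (u \<otimes>\<^bsub>A\<^esub> v)) = \<zero>\<^bsub>quot A ?I\<^esub>"
      by (rule z, use u in \<open>simp add: lie_relators_def, blast\<close>)
    then show "x \<otimes>\<^bsub>quot A ?I\<^esub> (y \<otimes>\<^bsub>quot A ?I\<^esub> z) \<oplus>\<^bsub>quot A ?I\<^esub> y \<otimes>\<^bsub>quot A ?I\<^esub> (z \<otimes>\<^bsub>quot A ?I\<^esub> x) \<oplus>\<^bsub>quot A ?I\<^esub> z \<otimes>\<^bsub>quot A ?I\<^esub> (x \<otimes>\<^bsub>quot A ?I\<^esub> y) = \<zero>\<^bsub>quot A ?I\<^esub>"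
      using u by (simp add: quot_mult[OF I(1)] prod_closed q(2))
  qed (unfold carrier_quot, (elim imageE, simp add: q(2,3) quot_mult[OF I(1)] prod_closed
         prod_add_left prod_add_right prod_smult_left prod_smult_right)+)
qed

end

lemma nonassoc_algebra_free_nonassoc:
  assumes "cring R"
  shows "nonassoc_algebra R (free_nonassoc R L)"
proof -
  interpret cring R by fact
  interpret F: module R "free_module R {t. gens t \<subseteq> L}" by (rule free_module_module) fact
  have simps: "carrier (free_nonassoc R L) = carrier (free_module R {t. gens t \<subseteq> L})"
    "add (free_nonassoc R L) = add (free_module R {t. gens t \<subseteq> L})"
    "zero (free_nonassoc R L) = zero (free_module R {t. gens t \<subseteq> L})"
    "smult (free_nonassoc R L) = smult (free_module R {t. gens t \<subseteq> L})"
    by (auto simp: free_nonassoc_def)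
  interpret F': module R "free_nonassoc R L"
    apply (rule moduleI)
           apply (rule \<open>cring R\<close>)
          apply (rule abelian_groupI)
          apply (simp_all add: simps F.M.a_ac F.smult_l_distr F.smult_r_distr F.smult_assoc1)
    done
  have closed: "f \<otimes>\<^bsub>free_nonassoc R L\<^esub> g \<in> carrier (free_nonassoc R L)"
    if "f \<in> carrier (free_nonassoc R L)" "g \<in> carrier (free_nonassoc R L)" for f g
  proof -
    have "finite {t. (case t of Gen v \<Rightarrow> \<zero>\<^bsub>R\<^esub> | Node s u \<Rightarrow> f s \<otimes>\<^bsub>R\<^esub> g u) \<noteq> \<zero>\<^bsub>R\<^esub>}"
    proof (rule finite_subset)
      show "{t. (case t of Gen v \<Rightarrow> \<zero>\<^bsub>R\<^esub> | Node s u \<Rightarrow> f s \<otimes>\<^bsub>R\<^esub> g u) \<noteq> \<zero>\<^bsub>R\<^esub>} \<subseteq>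
              (\<lambda>(s, u). Node s u) ` ({s. f s \<noteq> \<zero>\<^bsub>R\<^esub>} \<times> {u. g u \<noteq> \<zero>\<^bsub>R\<^esub>})"
      proof
        fix t assume t: "t \<in> {t. (case t of Gen v \<Rightarrow> \<zero>\<^bsub>R\<^esub> | Node s u \<Rightarrow> f s \<otimes>\<^bsub>R\<^esub> g u) \<noteq> \<zero>\<^bsub>R\<^esub>}"
        then obtain s u where "t = Node s u" by (cases t) auto
        moreover have "f s \<in> carrier R" "g u \<in> carrier R" for s u
          using that by (auto simp: simps free_module_def)
        ultimately show "t \<in> (\<lambda>(s, u). Node s u) ` ({s. f s \<noteq> \<zero>\<^bsub>R\<^esub>} \<times> {u. g u \<noteq> \<zero>\<^bsub>R\<^esub>})"
          using t by (auto intro!: image_eqI[of _ _ "(s, u)"])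
      qed
    qed (use that in \<open>auto simp: simps free_module_def\<close>)
    with that show ?thesis unfolding simps
      by (auto simp: free_nonassoc_def free_module_def split: magma.splits)
  qed
  show ?thesis
    apply unfold_locales
        apply (rule closed; assumption)
       apply (simp_all add: free_nonassoc_def free_module_def l_distr r_distr fun_eq_iff m_assoc m_lcomm
        split: magma.splits)
    done
qed

lemma lie_algebra_free_lie: "cring R \<Longrightarrow> lie_algebra R (free_lie R L)"
  unfolding free_lie_def by (intro nonassoc_algebra.lie_quot nonassoc_algebra_free_nonassoc)


section \<open>Tensor powers and symmetric powers\<close>

text \<open>
  The \<open>n\<close>-th tensor power of \<open>M\<close> is presented by the symbols \<open>x\<^sub>1 \<otimes> \<dots> \<otimes> x\<^sub>n\<close> (lists of length
  \<open>n\<close>) modulo additivity and homogeneity in each slot; for \<open>n = 0\<close> this is \<open>R\<close> itself.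
\<close>

definition tensor_words :: "('k, 'a, 'm) module_scheme \<Rightarrow> nat \<Rightarrow> 'a list set"
  where "tensor_words M n = {xs. length xs = n \<and> set xs \<subseteq> carrier M}"

definition multilinear_relators ::
    "('k, 'r) ring_scheme \<Rightarrow> ('k, 'a, 'm) module_scheme \<Rightarrow> nat \<Rightarrow> ('a list \<Rightarrow> 'k) set"
  where "multilinear_relators R M n =
    (let F = free_module R (tensor_words M n); e = unit_vec R in
      {e (us @ [x \<oplus>\<^bsub>M\<^esub> y] @ vs) \<ominus>\<^bsub>F\<^esub> (e (us @ [x] @ vs) \<oplus>\<^bsub>F\<^esub> e (us @ [y] @ vs)) | us vs x y.
         x \<in> carrier M \<and> y \<in> carrier M \<and> set us \<union> set vs \<subseteq> carrier M \<and>
         length us + 1 + length vs = n} \<union>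
      {e (us @ [a \<odot>\<^bsub>M\<^esub> x] @ vs) \<ominus>\<^bsub>F\<^esub> a \<odot>\<^bsub>F\<^esub> e (us @ [x] @ vs) | us vs a x.
         a \<in> carrier R \<and> x \<in> carrier M \<and> set us \<union> set vs \<subseteq> carrier M \<and>
         length us + 1 + length vs = n})"

definition multilinear_submodule ::
    "('k, 'r) ring_scheme \<Rightarrow> ('k, 'a, 'm) module_scheme \<Rightarrow> nat \<Rightarrow> ('a list \<Rightarrow> 'k) set"
  where "multilinear_submodule R M n =
    module_span R (free_module R (tensor_words M n)) (multilinear_relators R M n)"

definition tensor_power ::
    "('k, 'r) ring_scheme \<Rightarrow> ('k, 'a, 'm) module_scheme \<Rightarrow> nat \<Rightarrow> ('k, ('a list \<Rightarrow> 'k) set) module"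
  where "tensor_power R M n =
    quot (free_module R (tensor_words M n)) (multilinear_submodule R M n)"

definition pure_tensor ::
    "('k, 'r) ring_scheme \<Rightarrow> ('k, 'a, 'm) module_scheme \<Rightarrow> 'a list \<Rightarrow> ('a list \<Rightarrow> 'k) set"
  where "pure_tensor R M xs =
    multilinear_submodule R M (length xs)
      +>\<^bsub>free_module R (tensor_words M (length xs))\<^esub> unit_vec R xs"

definition sym_relators ::
    "('k, 'r) ring_scheme \<Rightarrow> ('k, 'a, 'm) module_scheme \<Rightarrow> nat \<Rightarrow> ('a list \<Rightarrow> 'k) set set"
  where "sym_relators R M n =
    {pure_tensor R M xs \<ominus>\<^bsub>tensor_power R M n\<^esub> pure_tensor R M (permute_list \<sigma> xs) | xs \<sigma>.
       xs \<in> tensor_words M n \<and> \<sigma> permutes {..<n}}"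

definition sym_power ::
    "('k, 'r) ring_scheme \<Rightarrow> ('k, 'a, 'm) module_scheme \<Rightarrow> nat \<Rightarrow> ('k, ('a list \<Rightarrow> 'k) set set) module"
  where "sym_power R M n =
    quot (tensor_power R M n) (module_span R (tensor_power R M n) (sym_relators R M n))"


section \<open>The tensor algebra\<close>

text \<open>
  The product of tensor powers induced by concatenation.  On representatives \<open>a\<close>, \<open>b\<close> supported on
  words of length \<open>i\<close> and \<open>j\<close>, the bilinear extension of concatenation is
  \<open>w \<mapsto> a (take i w) b (drop i w)\<close>.
\<close>

definition tensor_mult ::
    "('k, 'r) ring_scheme \<Rightarrow> ('k, 'a, 'm) module_scheme \<Rightarrow> nat \<Rightarrow> nat \<Rightarrow>
     ('a list \<Rightarrow> 'k) set \<Rightarrow> ('a list \<Rightarrow> 'k) set \<Rightarrow> ('a list \<Rightarrow> 'k) set"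
  where "tensor_mult R M i j A B =
    (\<Union>a\<in>A. \<Union>b\<in>B. multilinear_submodule R M (i + j)
       +>\<^bsub>free_module R (tensor_words M (i + j))\<^esub> (\<lambda>w. a (take i w) \<otimes>\<^bsub>R\<^esub> b (drop i w)))"

text \<open>
  The direct sum of all tensor powers; an element is the sequence of its homogeneous components.
\<close>

definition tensor_incl ::
    "('k, 'r) ring_scheme \<Rightarrow> ('k, 'a, 'm) module_scheme \<Rightarrow> nat \<Rightarrow>
     ('a list \<Rightarrow> 'k) set \<Rightarrow> nat \<Rightarrow> ('a list \<Rightarrow> 'k) set"
  where "tensor_incl R M n t = (\<lambda>i. if i = n then t else \<zero>\<^bsub>tensor_power R M i\<^esub>)"

definition tensor_algebra ::
    "('k, 'r) ring_scheme \<Rightarrow> ('k, 'a, 'm) module_scheme \<Rightarrow> ('k, nat \<Rightarrow> ('a list \<Rightarrow> 'k) set) module"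
  where "tensor_algebra R M =
    \<lparr>carrier = {f. (\<forall>i. f i \<in> carrier (tensor_power R M i)) \<and>
                   finite {i. f i \<noteq> \<zero>\<^bsub>tensor_power R M i\<^esub>}},
     mult = (\<lambda>f g n. \<Oplus>\<^bsub>tensor_power R M n\<^esub>i\<in>{..n}. tensor_mult R M i (n - i) (f i) (g (n - i))),
     one = tensor_incl R M 0 (pure_tensor R M []),
     zero = (\<lambda>i. \<zero>\<^bsub>tensor_power R M i\<^esub>),
     add = (\<lambda>f g i. f i \<oplus>\<^bsub>tensor_power R M i\<^esub> g i),
     smult = (\<lambda>a f i. a \<odot>\<^bsub>tensor_power R M i\<^esub> f i)\<rparr>"


section \<open>The universal enveloping algebra\<close>

definition uea_ideal ::
    "('k, 'r) ring_scheme \<Rightarrow> ('k, 'a, 'm) module_scheme \<Rightarrow> (nat \<Rightarrow> ('a list \<Rightarrow> 'k) set) set"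
  where "uea_ideal R L =
    (let T = tensor_algebra R L; \<iota> = (\<lambda>x. tensor_incl R L 1 (pure_tensor R L [x])) in
      gen_algebra_ideal R T
        {(\<iota> x \<otimes>\<^bsub>T\<^esub> \<iota> y \<ominus>\<^bsub>T\<^esub> \<iota> y \<otimes>\<^bsub>T\<^esub> \<iota> x) \<ominus>\<^bsub>T\<^esub> \<iota> (x \<otimes>\<^bsub>L\<^esub> y) | x y.
           x \<in> carrier L \<and> y \<in> carrier L})"

definition uea ::
    "('k, 'r) ring_scheme \<Rightarrow> ('k, 'a, 'm) module_scheme \<Rightarrow> ('k, (nat \<Rightarrow> ('a list \<Rightarrow> 'k) set) set) module"
  where "uea R L = quot (tensor_algebra R L) (uea_ideal R L)"

definition uea_proj ::
    "('k, 'r) ring_scheme \<Rightarrow> ('k, 'a, 'm) module_scheme \<Rightarrow>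
     (nat \<Rightarrow> ('a list \<Rightarrow> 'k) set) \<Rightarrow> (nat \<Rightarrow> ('a list \<Rightarrow> 'k) set) set"
  where "uea_proj R L t = uea_ideal R L +>\<^bsub>tensor_algebra R L\<^esub> t"

text \<open>
  The index is an integer so that the filtration starts with \<open>uea_filtration R L (- 1) = 0\<close>.
\<close>

definition uea_filtration ::
    "('k, 'r) ring_scheme \<Rightarrow> ('k, 'a, 'm) module_scheme \<Rightarrow> int \<Rightarrow>
     (nat \<Rightarrow> ('a list \<Rightarrow> 'k) set) set set"
  where "uea_filtration R L n =
    uea_proj R L ` {t \<in> carrier (tensor_algebra R L).
                      \<forall>j. int j > n \<longrightarrow> t j = \<zero>\<^bsub>tensor_power R L j\<^esub>}"

definition uea_filtration_module ::
    "('k, 'r) ring_scheme \<Rightarrow> ('k, 'a, 'm) module_scheme \<Rightarrow> int \<Rightarrow>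
     ('k, (nat \<Rightarrow> ('a list \<Rightarrow> 'k) set) set) module"
  where "uea_filtration_module R L n = (uea R L)\<lparr>carrier := uea_filtration R L n\<rparr>"

definition uea_graded ::
    "('k, 'r) ring_scheme \<Rightarrow> ('k, 'a, 'm) module_scheme \<Rightarrow> nat \<Rightarrow>
     ('k, (nat \<Rightarrow> ('a list \<Rightarrow> 'k) set) set set) module"
  where "uea_graded R L n =
    quot (uea_filtration_module R L (int n)) (uea_filtration R L (int n - 1))"

text \<open>
  The map induced on the symmetric power by sending a tensor \<open>t\<close> of degree \<open>n\<close> to the class of its
  image in the enveloping algebra.  An element \<open>s\<close> of the symmetric power is the set of its
  representatives \<open>t\<close>, which all have the same class, selected by \<^const>\<open>the_elem\<close>.
\<close>

definition pbw_map ::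
    "('k, 'r) ring_scheme \<Rightarrow> ('k, 'a, 'm) module_scheme \<Rightarrow> nat \<Rightarrow>
     ('a list \<Rightarrow> 'k) set set \<Rightarrow> (nat \<Rightarrow> ('a list \<Rightarrow> 'k) set) set set"
  where "pbw_map R L n s =
    the_elem ((\<lambda>t. uea_filtration R L (int n - 1)
                     +>\<^bsub>uea_filtration_module R L (int n)\<^esub> uea_proj R L (tensor_incl R L n t)) ` s)"

end

theory Submission
  imports Defs
begin

text \<open>
  Fix a total order on the generators.  The bracketings of the Lyndon words span the free Lie
  algebra, by a rewriting argument with the Jacobi identity.  Hence the symmetric power of degree
  \<open>n\<close> is spanned by the nonincreasing products of \<open>n\<close> such bracketings, and the \<open>n\<close>-th filtration
  step of the enveloping algebra by those with at most \<open>n\<close> factors.  Mapping the enveloping algebra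
  to noncommutative power series, a nonincreasing product of bracketings becomes the concatenation
  of the underlying Lyndon words plus lexicographically larger words of the same length, and the
  concatenation determines the factors.  So these products are linearly independent over any ring,
  and the symbol map is injective.
\<close>

section \<open>Linear maps and submodules\<close>

text \<open>Over an arbitrary commutative ring a Lie algebra need not have a module basis, and the
  symbol map can fail to be injective. Here a mere spanning family of the Lie algebra is enough,
  because independence is proved for its ordered monomials inside the enveloping algebra. It has to
  cover monomials with different numbers of factors at once: the length of a word in the power
  series counts letters and does not see the number of factors. Injectivity then compares two
  expansions. A tensor of degree \<open>n\<close> with vanishing symbol, reduced modulo
  permutations, has an image that is both a combination of monomials with exactly \<open>n\<close>
  factors and a combination of monomials with fewer, so all coefficients vanish. Leading
  coefficients are exactly one, so nothing is ever divided. Two defects of the lexicographic order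
  shape the details. It respects concatenation only when the smaller word is not a proper prefix of
  the larger, so every leading term statement fixes the length. And it has infinite descending
  chains, so the rewriting terminates only because the length is bounded as well.\<close>

context module
begin

lemma submodule_add_closed:
  "\<lbrakk>submodule N R M; x \<in> N; y \<in> N\<rbrakk> \<Longrightarrow> x \<oplus>\<^bsub>M\<^esub> y \<in> N"
  by (rule submoduleE(5))

lemma submodule_smult_closed:
  "\<lbrakk>submodule N R M; a \<in> carrier R; x \<in> N\<rbrakk> \<Longrightarrow> a \<odot>\<^bsub>M\<^esub> x \<in> N"
  by (rule submoduleE(4))

lemma submodule_carrier: "\<lbrakk>submodule N R M; x \<in> N\<rbrakk> \<Longrightarrow> x \<in> carrier M"
  using submoduleE(1) by auto

lemma submodule_zero_closed: "submodule N R M \<Longrightarrow> \<zero>\<^bsub>M\<^esub> \<in> N"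
  using subgroup.one_closed[OF submodule.axioms(1)] by fastforce

lemma submodule_uminus_closed: "\<lbrakk>submodule N R M; x \<in> N\<rbrakk> \<Longrightarrow> \<ominus>\<^bsub>M\<^esub> x \<in> N"
  by (rule submoduleE(3))

lemma submodule_minus_closed: "\<lbrakk>submodule N R M; x \<in> N; y \<in> N\<rbrakk> \<Longrightarrow> x \<ominus>\<^bsub>M\<^esub> y \<in> N"
  unfolding a_minus_def by (intro submodule_add_closed submodule_uminus_closed)

lemma submodule_if_closed:
  assumes "N \<subseteq> carrier M" "\<zero>\<^bsub>M\<^esub> \<in> N"
    "\<And>x y. \<lbrakk>x \<in> N; y \<in> N\<rbrakk> \<Longrightarrow> x \<oplus>\<^bsub>M\<^esub> y \<in> N"
    "\<And>a x. \<lbrakk>a \<in> carrier R; x \<in> N\<rbrakk> \<Longrightarrow> a \<odot>\<^bsub>M\<^esub> x \<in> N"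
  shows "submodule N R M"
proof (rule submoduleI)
  fix v assume "v \<in> N"
  then have "(\<ominus> \<one>) \<odot>\<^bsub>M\<^esub> v \<in> N" "v \<in> carrier M" using assms by auto
  then show "\<ominus>\<^bsub>M\<^esub> v \<in> N" by (simp add: smult_l_minus)
qed (use assms in auto)

lemma submodule_singleton_zero: "submodule {\<zero>\<^bsub>M\<^esub>} R M"
  by (rule submodule_if_closed) auto

lemma module_span_submodule:
  assumes "S \<subseteq> carrier M"
  shows "submodule (module_span R M S) R M"
proof -
  have "carrier M \<in> {N. submodule N R M \<and> S \<subseteq> N}"
    using carrier_is_submodule assms by auto
  then show ?thesis unfolding module_span_def
    by (intro submodule_if_closed)
      (auto intro: submodule_zero_closed submodule_add_closed submodule_smult_closed)
qed

lemma module_span_superset: "S \<subseteq> module_span R M S"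
  by (auto simp: module_span_def)

lemma module_span_least: "\<lbrakk>submodule N R M; S \<subseteq> N\<rbrakk> \<Longrightarrow> module_span R M S \<subseteq> N"
  by (auto simp: module_span_def)

lemma module_span_mono: "S \<subseteq> S' \<Longrightarrow> module_span R M S \<subseteq> module_span R M S'"
  by (auto simp: module_span_def)

lemma module_span_carrier: "S \<subseteq> carrier M \<Longrightarrow> module_span R M S \<subseteq> carrier M"
  by (intro module_span_least carrier_is_submodule)

lemma minus_eq_zero_iff:
  assumes "x \<in> carrier M" "y \<in> carrier M"
  shows "x \<ominus>\<^bsub>M\<^esub> y = \<zero>\<^bsub>M\<^esub> \<longleftrightarrow> x = y"
proof
  assume "x \<ominus>\<^bsub>M\<^esub> y = \<zero>\<^bsub>M\<^esub>"
  then have "(x \<ominus>\<^bsub>M\<^esub> y) \<oplus>\<^bsub>M\<^esub> y = \<zero>\<^bsub>M\<^esub> \<oplus>\<^bsub>M\<^esub> y" by simp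
  then show "x = y" using assms by (simp add: a_minus_def M.a_assoc M.l_neg)
qed (use assms in \<open>simp add: a_minus_def M.r_neg\<close>)

lemma minus_zero: "x \<in> carrier M \<Longrightarrow> x \<ominus>\<^bsub>M\<^esub> \<zero>\<^bsub>M\<^esub> = x"
  using M.add.inv_one by (simp add: a_minus_def a_inv_def)

lemma minus_add_cancel: 
  assumes "x \<in> carrier M" "y \<in> carrier M" "z \<in> carrier M"
  shows "(z \<ominus>\<^bsub>M\<^esub> x) \<oplus>\<^bsub>M\<^esub> (x \<ominus>\<^bsub>M\<^esub> y) = z \<ominus>\<^bsub>M\<^esub> y"
proof -
  have "\<ominus>\<^bsub>M\<^esub> x \<oplus>\<^bsub>M\<^esub> (x \<oplus>\<^bsub>M\<^esub> \<ominus>\<^bsub>M\<^esub> y) = \<ominus>\<^bsub>M\<^esub> y" using assms by (simp add: M.r_neg1)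
  then show ?thesis using assms by (simp add: a_minus_def M.a_assoc)
qed

lemma submodule_minus_iff:
  assumes "submodule N R M" "x \<in> carrier M" "y \<in> N"
  shows "x \<in> N \<longleftrightarrow> x \<ominus>\<^bsub>M\<^esub> y \<in> N"
proof
  assume "x \<ominus>\<^bsub>M\<^esub> y \<in> N"
  then have "(x \<ominus>\<^bsub>M\<^esub> y) \<oplus>\<^bsub>M\<^esub> y \<in> N" using assms by (intro submodule_add_closed) auto
  then show "x \<in> N"
    using assms submodule_carrier[OF assms(1,3)] by (simp add: a_minus_def M.a_assoc M.l_neg)
qed (use assms submodule_minus_closed in auto)

end

text \<open>A predicate on plain functions: values outside the carrier are free, so coset maps,
  \<open>qlift\<close> and \<open>lin_ext\<close> all fit it directly.\<close>

definition lin :: "('k, 'r) ring_scheme \<Rightarrow> ('k, 'a, 'm) module_scheme \<Rightarrow> ('k, 'b, 'n) module_scheme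
    \<Rightarrow> ('a \<Rightarrow> 'b) \<Rightarrow> bool"
  where "lin R M N h \<longleftrightarrow> h \<in> carrier M \<rightarrow> carrier N \<and>
    (\<forall>x\<in>carrier M. \<forall>y\<in>carrier M. h (x \<oplus>\<^bsub>M\<^esub> y) = h x \<oplus>\<^bsub>N\<^esub> h y) \<and>
    (\<forall>a\<in>carrier R. \<forall>x\<in>carrier M. h (a \<odot>\<^bsub>M\<^esub> x) = a \<odot>\<^bsub>N\<^esub> h x)"

lemma linI:
  assumes "\<And>x. x \<in> carrier M \<Longrightarrow> h x \<in> carrier N"
    "\<And>x y. \<lbrakk>x \<in> carrier M; y \<in> carrier M\<rbrakk> \<Longrightarrow> h (x \<oplus>\<^bsub>M\<^esub> y) = h x \<oplus>\<^bsub>N\<^esub> h y"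
    "\<And>a x. \<lbrakk>a \<in> carrier R; x \<in> carrier M\<rbrakk> \<Longrightarrow> h (a \<odot>\<^bsub>M\<^esub> x) = a \<odot>\<^bsub>N\<^esub> h x"
  shows "lin R M N h"
  using assms by (auto simp: lin_def)

lemma lin_closed: "\<lbrakk>lin R M N h; x \<in> carrier M\<rbrakk> \<Longrightarrow> h x \<in> carrier N"
  and lin_add: "\<lbrakk>lin R M N h; x \<in> carrier M; y \<in> carrier M\<rbrakk> \<Longrightarrow> h (x \<oplus>\<^bsub>M\<^esub> y) = h x \<oplus>\<^bsub>N\<^esub> h y"
  and lin_smult: "\<lbrakk>lin R M N h; a \<in> carrier R; x \<in> carrier M\<rbrakk> \<Longrightarrow> h (a \<odot>\<^bsub>M\<^esub> x) = a \<odot>\<^bsub>N\<^esub> h x"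
  by (auto simp: lin_def)

lemma lin_compose: "\<lbrakk>lin R M N h; lin R N P g\<rbrakk> \<Longrightarrow> lin R M P (\<lambda>x. g (h x))"
  by (auto simp: lin_def Pi_iff)

locale module_pair = M: module R M + N: module R N
  for R :: "('k, 'r) ring_scheme" (structure)
  and M :: "('k, 'a, 'm) module_scheme" and N :: "('k, 'b, 'n) module_scheme"
begin

lemma lin_zero: "lin R M N h \<Longrightarrow> h \<zero>\<^bsub>M\<^esub> = \<zero>\<^bsub>N\<^esub>"
  using lin_smult[of R M N h "\<zero>" "\<zero>\<^bsub>M\<^esub>"] lin_closed[of R M N h "\<zero>\<^bsub>M\<^esub>"] by simp

lemma lin_uminus:
  assumes "lin R M N h" "x \<in> carrier M" shows "h (\<ominus>\<^bsub>M\<^esub> x) = \<ominus>\<^bsub>N\<^esub> h x"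
  using lin_smult[of R M N h "\<ominus> \<one>" x] lin_closed[OF assms] assms
  by (simp add: M.smult_l_minus N.smult_l_minus)

lemma lin_minus:
  assumes "lin R M N h" "x \<in> carrier M" "y \<in> carrier M"
  shows "h (x \<ominus>\<^bsub>M\<^esub> y) = h x \<ominus>\<^bsub>N\<^esub> h y"
  unfolding a_minus_def using assms by (simp add: lin_add lin_uminus)

lemma lin_finsum:
  assumes "lin R M N h" "\<And>i. i \<in> A \<Longrightarrow> f i \<in> carrier M"
  shows "h (finsum M f A) = finsum N (\<lambda>i. h (f i)) A"
  using assms(2)
proof (induction A rule: infinite_finite_induct)
  case (insert x F)
  then show ?case using assms(1) lin_closed[OF assms(1)]
    by (simp add: Pi_iff lin_add lin_closed M.M.finsum_closed)
qed (auto intro: lin_zero assms(1))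

lemma submodule_vimage:
  assumes "lin R M N h" "submodule S R N"
  shows "submodule {x \<in> carrier M. h x \<in> S} R M"
  using assms by (intro M.submodule_if_closed)
    (auto simp: lin_add lin_smult lin_zero
      intro: N.submodule_zero_closed N.submodule_add_closed N.submodule_smult_closed)

lemma submodule_kernel:
  "lin R M N h \<Longrightarrow> submodule {x \<in> carrier M. h x = \<zero>\<^bsub>N\<^esub>} R M"
  using submodule_vimage[OF _ N.submodule_singleton_zero] by simp

lemma submodule_equalizer:
  assumes h: "lin R M N h" and g: "lin R M N g"
  shows "submodule {x \<in> carrier M. h x = g x} R M"
  using assms by (intro M.submodule_if_closed) (auto simp: lin_add lin_smult lin_zero)

lemma submodule_image:
  assumes h: "lin R M N h" and S: "submodule S R M"
  shows "submodule (h ` S) R N"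
proof (rule N.submodule_if_closed)
  note c = M.submodule_carrier[OF S]
  show "h ` S \<subseteq> carrier N" using c lin_closed[OF h] by auto
  show "\<zero>\<^bsub>N\<^esub> \<in> h ` S" using lin_zero[OF h] M.submodule_zero_closed[OF S] by force
  show "x \<oplus>\<^bsub>N\<^esub> y \<in> h ` S" if "x \<in> h ` S" "y \<in> h ` S" for x y
    using that by (auto simp flip: lin_add[OF h] simp: c intro!: imageI M.submodule_add_closed[OF S])
  show "a \<odot>\<^bsub>N\<^esub> x \<in> h ` S" if "a \<in> carrier R" "x \<in> h ` S" for a x
    using that by (auto simp flip: lin_smult[OF h] simp: c intro!: imageI M.submodule_smult_closed[OF S])
qed

text \<open>Takes the place of an induction over linear combinations: the preimage of
  \<open>S\<close> is a submodule, so it contains the whole span once it contains the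
  generators.\<close>

lemma lin_span_subset:
  assumes h: "lin R M N h" and S: "submodule S R N" and "\<And>x. x \<in> X \<Longrightarrow> x \<in> carrier M"
    and "\<And>x. x \<in> X \<Longrightarrow> h x \<in> S" and "x \<in> module_span R M X"
  shows "h x \<in> S"
  using M.module_span_least[OF submodule_vimage[OF h S], of X] assms by auto

lemma lin_eq_on_span:
  assumes "lin R M N h" "lin R M N g" "\<And>x. x \<in> X \<Longrightarrow> x \<in> carrier M"
    and "\<And>x. x \<in> X \<Longrightarrow> h x = g x" and "x \<in> module_span R M X"
  shows "h x = g x"
  using M.module_span_least[OF submodule_equalizer[OF assms(1,2)], of X] assms by auto

end

text \<open>Applied to a coset of a submodule in the kernel of \<open>h\<close>, \<^const>\<open>the_elem\<close> picks the common value of \<open>h\<close>.\<close>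

definition qlift :: "('a \<Rightarrow> 'b) \<Rightarrow> 'a set \<Rightarrow> 'b"
  where "qlift h X = the_elem (h ` X)"

section \<open>Cosets and maps induced on quotients\<close>

context module
begin

lemma coset_mem_iff:
  assumes "submodule N R M" "x \<in> carrier M"
  shows "y \<in> N +>\<^bsub>M\<^esub> x \<longleftrightarrow> y \<in> carrier M \<and> y \<ominus>\<^bsub>M\<^esub> x \<in> N"
proof
  assume "y \<in> N +>\<^bsub>M\<^esub> x"
  then obtain n where n: "n \<in> N" "y = n \<oplus>\<^bsub>M\<^esub> x" by (auto simp: a_r_coset_def r_coset_def)
  then have "n \<in> carrier M" using submodule_carrier assms by auto
  with n show "y \<in> carrier M \<and> y \<ominus>\<^bsub>M\<^esub> x \<in> N"
    using assms by (simp add: a_minus_def M.a_assoc M.r_neg)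
next
  assume y: "y \<in> carrier M \<and> y \<ominus>\<^bsub>M\<^esub> x \<in> N"
  then have "y = (y \<ominus>\<^bsub>M\<^esub> x) \<oplus>\<^bsub>M\<^esub> x" using assms by (simp add: a_minus_def M.a_assoc M.l_neg)
  with y show "y \<in> N +>\<^bsub>M\<^esub> x" unfolding a_r_coset_def r_coset_def by auto
qed

lemma coset_eq_iff:
  assumes N: "submodule N R M" and x: "x \<in> carrier M" and y: "y \<in> carrier M"
  shows "N +>\<^bsub>M\<^esub> x = N +>\<^bsub>M\<^esub> y \<longleftrightarrow> x \<ominus>\<^bsub>M\<^esub> y \<in> N"
proof
  assume "N +>\<^bsub>M\<^esub> x = N +>\<^bsub>M\<^esub> y"
  moreover have "x \<in> N +>\<^bsub>M\<^esub> x"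
    using coset_mem_iff[OF N x] x submodule_zero_closed[OF N] by (simp add: a_minus_def M.r_neg)
  ultimately show "x \<ominus>\<^bsub>M\<^esub> y \<in> N" using coset_mem_iff[OF N y] by simp
next
  assume d: "x \<ominus>\<^bsub>M\<^esub> y \<in> N"
  then have d': "y \<ominus>\<^bsub>M\<^esub> x \<in> N"
    using submodule_uminus_closed[OF N d] x y by (simp add: a_minus_def M.minus_add M.a_comm)
  have "z \<ominus>\<^bsub>M\<^esub> x \<in> N \<longleftrightarrow> z \<ominus>\<^bsub>M\<^esub> y \<in> N" if "z \<in> carrier M" for z
    using submodule_add_closed[OF N _ d, of "z \<ominus>\<^bsub>M\<^esub> x"] submodule_add_closed[OF N _ d', of "z \<ominus>\<^bsub>M\<^esub> y"]
    by (auto simp: minus_add_cancel x y that)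
  then show "N +>\<^bsub>M\<^esub> x = N +>\<^bsub>M\<^esub> y"
    using coset_mem_iff[OF N x] coset_mem_iff[OF N y] by auto
qed

lemma zero_quot: "submodule N R M \<Longrightarrow> \<zero>\<^bsub>quot M N\<^esub> = N +>\<^bsub>M\<^esub> \<zero>\<^bsub>M\<^esub>"
  using submoduleE(1) by (simp add: quot_def FactRing_def M.a_coset_add_zero)

lemma coset_eq_zero_iff:
  assumes "submodule N R M" "x \<in> carrier M"
  shows "N +>\<^bsub>M\<^esub> x = \<zero>\<^bsub>quot M N\<^esub> \<longleftrightarrow> x \<in> N"
  using assms by (simp add: zero_quot coset_eq_iff minus_zero)

lemma lin_coset:
  assumes "submodule N R M" shows "lin R M (quot M N) (\<lambda>x. N +>\<^bsub>M\<^esub> x)"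
  using module_quot(2,3)[OF assms] by (intro linI) (auto simp: carrier_quot)

end

context module_pair
begin

lemma qlift_coset:
  assumes h: "lin R M N h" and S: "submodule S R M" and ker: "\<And>s. s \<in> S \<Longrightarrow> h s = \<zero>\<^bsub>N\<^esub>"
    and x: "x \<in> carrier M"
  shows "qlift h (S +>\<^bsub>M\<^esub> x) = h x"
proof -
  have "h y = h x" if yy: "y \<in> S +>\<^bsub>M\<^esub> x" for y
  proof -
    have y: "y \<in> carrier M" "y \<ominus>\<^bsub>M\<^esub> x \<in> S" using M.coset_mem_iff[OF S x] yy by auto
    have "h y \<ominus>\<^bsub>N\<^esub> h x = \<zero>\<^bsub>N\<^esub>" using ker[OF y(2)] lin_minus[OF h y(1) x] by simp
    then show ?thesis using N.minus_eq_zero_iff[OF lin_closed[OF h y(1)] lin_closed[OF h x]] by simp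
  qed
  moreover have "x \<in> S +>\<^bsub>M\<^esub> x"
    using M.coset_mem_iff[OF S x] x M.submodule_zero_closed[OF S] by (simp add: a_minus_def M.M.r_neg)
  ultimately have "h ` (S +>\<^bsub>M\<^esub> x) = {h x}" by blast
  then show ?thesis by (simp add: qlift_def)
qed

lemma lin_qlift:
  assumes h: "lin R M N h" and S: "submodule S R M" and ker: "\<And>s. s \<in> S \<Longrightarrow> h s = \<zero>\<^bsub>N\<^esub>"
  shows "lin R (quot M S) N (qlift h)"
  by (rule linI) (auto simp: carrier_quot M.module_quot(2,3)[OF S] qlift_coset[OF assms]
      lin_add[OF h] lin_smult[OF h] lin_closed[OF h])

text \<open>The first isomorphism theorem, with kernel exactly \<open>S\<close>. The final theorem
  is an instance: \<open>h\<close> becomes the symbol map and \<open>S\<close> the span of the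
  symmetrization relators.\<close>

lemma qlift_module_iso:
  assumes h: "lin R M N h" and S: "submodule S R M" and ker: "\<And>s. s \<in> S \<Longrightarrow> h s = \<zero>\<^bsub>N\<^esub>"
    and inj: "\<And>x. \<lbrakk>x \<in> carrier M; h x = \<zero>\<^bsub>N\<^esub>\<rbrakk> \<Longrightarrow> x \<in> S"
    and surj: "\<And>y. y \<in> carrier N \<Longrightarrow> \<exists>x\<in>carrier M. h x = y"
  shows "qlift h \<in> module_iso R (quot M S) N"
proof -
  note l = lin_qlift[OF h S ker]
  have "inj_on (qlift h) (carrier (quot M S))"
  proof (rule inj_onI)
    fix X Y assume "X \<in> carrier (quot M S)" "Y \<in> carrier (quot M S)" and eq: "qlift h X = qlift h Y"
    then obtain x y where x: "x \<in> carrier M" "X = S +>\<^bsub>M\<^esub> x" and y: "y \<in> carrier M" "Y = S +>\<^bsub>M\<^esub> y"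
      by (auto simp: carrier_quot)
    have "h x = h y" using eq x y by (simp add: qlift_coset[OF h S ker])
    then have "h (x \<ominus>\<^bsub>M\<^esub> y) = \<zero>\<^bsub>N\<^esub>"
      using N.minus_eq_zero_iff[OF lin_closed[OF h x(1)] lin_closed[OF h y(1)]] lin_minus[OF h x(1) y(1)]
      by simp
    then have "x \<ominus>\<^bsub>M\<^esub> y \<in> S" using inj x y by simp
    then show "X = Y" using M.coset_eq_iff[OF S x(1) y(1)] x y by simp
  qed
  moreover have "qlift h ` carrier (quot M S) = carrier N"
  proof
    show "qlift h ` carrier (quot M S) \<subseteq> carrier N" using lin_closed[OF l] by auto
    show "carrier N \<subseteq> qlift h ` carrier (quot M S)"
    proof
      fix y assume "y \<in> carrier N"
      then obtain x where x: "x \<in> carrier M" "h x = y" using surj by auto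
      then have "y = qlift h (S +>\<^bsub>M\<^esub> x)" by (simp add: qlift_coset[OF h S ker])
      then show "y \<in> qlift h ` carrier (quot M S)" using x by (auto simp: carrier_quot)
    qed
  qed
  ultimately show ?thesis
    using l unfolding lin_def by (simp add: module_iso_def iso_def hom_def bij_betw_def)
qed

end

section \<open>Linear extension from free modules\<close>

definition lin_ext :: "('k, 'r) ring_scheme \<Rightarrow> ('k, 'a, 'm) module_scheme \<Rightarrow> ('x \<Rightarrow> 'a) \<Rightarrow> ('x \<Rightarrow> 'k) \<Rightarrow> 'a"
  where "lin_ext R M e c = finsum M (\<lambda>i. c i \<odot>\<^bsub>M\<^esub> e i) {i. c i \<noteq> \<zero>\<^bsub>R\<^esub>}"

lemma free_module_simps:
  "zero (free_module R X) = (\<lambda>x. \<zero>\<^bsub>R\<^esub>)"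
  "f \<oplus>\<^bsub>free_module R X\<^esub> g = (\<lambda>x. f x \<oplus>\<^bsub>R\<^esub> g x)"
  "a \<odot>\<^bsub>free_module R X\<^esub> f = (\<lambda>x. a \<otimes>\<^bsub>R\<^esub> f x)"
  by (auto simp: free_module_def)

lemma free_moduleD:
  assumes "f \<in> carrier (free_module R X)"
  shows "f x \<in> carrier R" "x \<notin> X \<Longrightarrow> f x = \<zero>\<^bsub>R\<^esub>" "finite {x. f x \<noteq> \<zero>\<^bsub>R\<^esub>}" "{x. f x \<noteq> \<zero>\<^bsub>R\<^esub>} \<subseteq> X"
  using assms by (auto simp: free_module_def)

lemma unit_vec_closed:
  assumes "cring R" "x \<in> X" shows "unit_vec R x \<in> carrier (free_module R X)"
proof -
  interpret cring R by fact
  have "finite {y. unit_vec R x y \<noteq> \<zero>\<^bsub>R\<^esub>}"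
    by (rule finite_subset[of _ "{x}"]) (auto simp: unit_vec_def)
  then show ?thesis using assms(2) by (auto simp: free_module_def unit_vec_def)
qed

lemma (in cring) free_module_span:
  "module_span R (free_module R X) (unit_vec R ` X) = carrier (free_module R X)"
proof -
  interpret F: module R "free_module R X" by (rule free_module_module) (rule is_cring)
  let ?S = "module_span R (free_module R X) (unit_vec R ` X)"
  have sub: "unit_vec R ` X \<subseteq> carrier (free_module R X)" using unit_vec_closed[OF is_cring] by auto
  note S = F.module_span_submodule[OF sub]
  \<comment> \<open>The induction runs over a finite set that contains the support, not over the
    support itself, so clearing one coordinate needs no exact description of the new
    support.\<close>
  have "f \<in> ?S" if "finite A" "{x. f x \<noteq> \<zero>} \<subseteq> A" "f \<in> carrier (free_module R X)" for A f
    using that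
  proof (induction A arbitrary: f rule: finite_induct)
    case empty
    then have "f = \<zero>\<^bsub>free_module R X\<^esub>" by (auto simp: free_module_simps)
    then show ?case using F.submodule_zero_closed[OF S] by simp
  next
    case (insert a A)
    let ?g = "f(a := \<zero>)"
    show ?case
    proof (cases "a \<in> X")
      case False
      then have "f a = \<zero>" using insert.prems by (auto simp: free_module_def)
      then show ?thesis using insert by (intro insert.IH) auto
    next
      case True
      have fin: "finite {x. ?g x \<noteq> \<zero>}" by (rule finite_subset[OF _ insert.hyps(1)]) (use insert.prems in auto)
      then have g: "?g \<in> carrier (free_module R X)"
        using free_moduleD[OF insert.prems(2)] fin unfolding free_module_def by (simp del: fun_upd_apply) simp
      have eq: "f = ?g \<oplus>\<^bsub>free_module R X\<^esub> f a \<odot>\<^bsub>free_module R X\<^esub> unit_vec R a"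
        using free_moduleD(1)[OF insert.prems(2)]
        by (simp add: free_module_simps unit_vec_def fun_eq_iff)
      have "?g \<in> ?S" using insert.prems(1) by (intro insert.IH[OF _ g]) auto
      moreover have "unit_vec R a \<in> ?S" using F.module_span_superset[of "unit_vec R ` X"] True by auto
      ultimately show ?thesis using free_moduleD(1)[OF insert.prems(2)]
        by (subst eq) (intro F.submodule_add_closed[OF S] F.submodule_smult_closed[OF S])
    qed
  qed
  then have "carrier (free_module R X) \<subseteq> ?S" by (auto dest: free_moduleD(3))
  then show ?thesis using F.module_span_carrier[OF sub] by auto
qed

context module
begin

text \<open>Zero coefficients contribute nothing, so combinations with different supports can be
  summed over one common finite set before they are added.\<close>

lemma lin_ext_superset:
  assumes "c \<in> carrier (free_module R X)" "e \<in> X \<rightarrow> carrier M" "finite B" "{i. c i \<noteq> \<zero>} \<subseteq> B" "B \<subseteq> X"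
  shows "lin_ext R M e c = finsum M (\<lambda>i. c i \<odot>\<^bsub>M\<^esub> e i) B"
proof -
  have "e i \<in> carrier M" if "i \<in> B" for i using assms(2,5) that by auto
  then show ?thesis
    unfolding lin_ext_def using assms(3,4) free_moduleD(1)[OF assms(1)]
    by (intro M.add.finprod_mono_neutral_cong_left) auto
qed

lemma lin_lin_ext:
  assumes e: "e \<in> X \<rightarrow> carrier M"
  shows "lin R (free_module R X) M (lin_ext R M e)"
proof -
  interpret F: module R "free_module R X" by (rule free_module_module) (rule is_cring)
  have ec: "e i \<in> carrier M" if "i \<in> X" for i using e that by auto
  show ?thesis
  proof (rule linI)
    fix c d assume c: "c \<in> carrier (free_module R X)"
    note C = free_moduleD[OF c]
    have cl: "(\<lambda>i. c i \<odot>\<^bsub>M\<^esub> e i) \<in> B \<rightarrow> carrier M" if "B \<subseteq> X" for B using C(1) ec that by auto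
    show "lin_ext R M e c \<in> carrier M" unfolding lin_ext_def using cl C(4) by auto
    {
      assume d: "d \<in> carrier (free_module R X)"
      note D = free_moduleD[OF d]
      let ?B = "{x. c x \<noteq> \<zero>} \<union> {x. d x \<noteq> \<zero>}"
      have B: "finite ?B" "?B \<subseteq> X" using C D by auto
      have dl: "(\<lambda>i. d i \<odot>\<^bsub>M\<^esub> e i) \<in> ?B \<rightarrow> carrier M" using D(1) ec B(2) by auto
      have "lin_ext R M e (c \<oplus>\<^bsub>free_module R X\<^esub> d) = finsum M (\<lambda>i. (c i \<oplus> d i) \<odot>\<^bsub>M\<^esub> e i) ?B"
        using C D by (subst lin_ext_superset[OF F.M.a_closed[OF c d] e B(1) _ B(2)])
          (auto simp: free_module_simps)
      also have "\<dots> = finsum M (\<lambda>i. c i \<odot>\<^bsub>M\<^esub> e i \<oplus>\<^bsub>M\<^esub> d i \<odot>\<^bsub>M\<^esub> e i) ?B"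
        using C D B ec by (intro M.finsum_cong') (auto simp: smult_l_distr)
      also have "\<dots> = finsum M (\<lambda>i. c i \<odot>\<^bsub>M\<^esub> e i) ?B \<oplus>\<^bsub>M\<^esub> finsum M (\<lambda>i. d i \<odot>\<^bsub>M\<^esub> e i) ?B"
        using cl[OF B(2)] dl by (intro M.finsum_addf)
      also have "\<dots> = lin_ext R M e c \<oplus>\<^bsub>M\<^esub> lin_ext R M e d"
        by (subst (1 2) lin_ext_superset[OF _ e B(1) _ B(2)]) (use c d in auto)
      finally show "lin_ext R M e (c \<oplus>\<^bsub>free_module R X\<^esub> d) = lin_ext R M e c \<oplus>\<^bsub>M\<^esub> lin_ext R M e d" .
    }
    fix a assume a: "a \<in> carrier R"
    let ?B = "{x. c x \<noteq> \<zero>}"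
    have "lin_ext R M e (a \<odot>\<^bsub>free_module R X\<^esub> c) = finsum M (\<lambda>i. (a \<otimes> c i) \<odot>\<^bsub>M\<^esub> e i) ?B"
      using C a by (subst lin_ext_superset[OF F.smult_closed[OF a c] e C(3) _ C(4)])
        (auto simp: free_module_simps)
    also have "\<dots> = finsum M (\<lambda>i. a \<odot>\<^bsub>M\<^esub> (c i \<odot>\<^bsub>M\<^esub> e i)) ?B"
      using C a ec by (intro M.finsum_cong') (auto simp: smult_assoc1)
    also have "\<dots> = a \<odot>\<^bsub>M\<^esub> lin_ext R M e c"
      unfolding lin_ext_def using cl C(3,4) a by (intro finsum_smult_ldistr[symmetric]) auto
    finally show "lin_ext R M e (a \<odot>\<^bsub>free_module R X\<^esub> c) = a \<odot>\<^bsub>M\<^esub> lin_ext R M e c" .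
  qed
qed

lemma lin_ext_unit_vec:
  assumes "e \<in> X \<rightarrow> carrier M" "x \<in> X"
  shows "lin_ext R M e (unit_vec R x) = e x"
proof -
  have "lin_ext R M e (unit_vec R x) = finsum M (\<lambda>i. unit_vec R x i \<odot>\<^bsub>M\<^esub> e i) {x}"
    using assms unit_vec_closed[OF is_cring assms(2)]
    by (intro lin_ext_superset[of _ X]) (auto simp: unit_vec_def)
  then show ?thesis using assms by (simp add: unit_vec_def Pi_iff)
qed

text \<open>Converts membership in a span into coefficients, the form in which independence is
  stated. The combinations are the image of a free module, hence a submodule containing all
  generators.\<close>

lemma span_imp_lin_ext:
  assumes e: "e \<in> X \<rightarrow> carrier M" and x: "x \<in> module_span R M (e ` X)"
  obtains c where "c \<in> carrier (free_module R X)" "x = lin_ext R M e c"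
proof -
  interpret F: module R "free_module R X" by (rule free_module_module) (rule is_cring)
  interpret FM: module_pair R "free_module R X" M ..
  have "submodule (lin_ext R M e ` carrier (free_module R X)) R M"
    by (rule FM.submodule_image[OF lin_lin_ext[OF e] F.carrier_is_submodule])
  moreover have "e ` X \<subseteq> lin_ext R M e ` carrier (free_module R X)"
    using lin_ext_unit_vec[OF e] unit_vec_closed[OF is_cring] by (force simp: image_iff)
  ultimately have "x \<in> lin_ext R M e ` carrier (free_module R X)"
    using module_span_least x by blast
  then show ?thesis using that by auto
qed

end

lemma (in module_pair) lin_of_lin_ext:
  assumes h: "lin R M N h" and e: "e \<in> X \<rightarrow> carrier M" and c: "c \<in> carrier (free_module R X)"
  shows "h (lin_ext R M e c) = lin_ext R N (\<lambda>x. h (e x)) c"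
proof -
  note C = free_moduleD[OF c]
  have *: "\<And>i. c i \<noteq> \<zero> \<Longrightarrow> e i \<in> carrier M" using e C(4) by auto
  show ?thesis
    unfolding lin_ext_def using C * lin_closed[OF h]
    by (subst lin_finsum[OF h]) (auto simp: lin_smult[OF h] intro!: N.M.finsum_cong')
qed

section \<open>Noncommutative power series\<close>

text \<open>
  The convolution product is written as a recursion on the word, through the left derivatives
  \<open>\<lambda>u. f (v # u)\<close>; associativity is then a plain induction without double sums.
\<close>

fun conv :: "('k, 'r) ring_scheme \<Rightarrow> ('v list \<Rightarrow> 'k) \<Rightarrow> ('v list \<Rightarrow> 'k) \<Rightarrow> 'v list \<Rightarrow> 'k" where
  "conv R f g [] = f [] \<otimes>\<^bsub>R\<^esub> g []"
| "conv R f g (v # w) = f [] \<otimes>\<^bsub>R\<^esub> g (v # w) \<oplus>\<^bsub>R\<^esub> conv R (\<lambda>u. f (v # u)) g w"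

definition nc_series :: "('k, 'r) ring_scheme \<Rightarrow> ('k, 'v list \<Rightarrow> 'k) module"
  where "nc_series R =
    \<lparr>carrier = {f. \<forall>w. f w \<in> carrier R}, mult = conv R, one = unit_vec R [],
     zero = (\<lambda>w. \<zero>\<^bsub>R\<^esub>), add = (\<lambda>f g w. f w \<oplus>\<^bsub>R\<^esub> g w), smult = (\<lambda>a f w. a \<otimes>\<^bsub>R\<^esub> f w)\<rparr>"

lemma nc_series_simps:
  "f \<in> carrier (nc_series R) \<longleftrightarrow> (\<forall>w. f w \<in> carrier R)"
  "f \<otimes>\<^bsub>nc_series R\<^esub> g = conv R f g"
  "\<one>\<^bsub>nc_series R\<^esub> = unit_vec R []"
  "\<zero>\<^bsub>nc_series R\<^esub> = (\<lambda>w. \<zero>\<^bsub>R\<^esub>)"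
  "f \<oplus>\<^bsub>nc_series R\<^esub> g = (\<lambda>w. f w \<oplus>\<^bsub>R\<^esub> g w)"
  "a \<odot>\<^bsub>nc_series R\<^esub> f = (\<lambda>w. a \<otimes>\<^bsub>R\<^esub> f w)"
  by (auto simp: nc_series_def)

context cring
begin

lemma conv_closed:
  "\<lbrakk>\<And>w. f w \<in> carrier R; \<And>w. g w \<in> carrier R\<rbrakk> \<Longrightarrow> conv R f g w \<in> carrier R"
  by (induction w arbitrary: f) auto

lemma conv_add_left:
  "\<lbrakk>\<And>w. f w \<in> carrier R; \<And>w. g w \<in> carrier R; \<And>w. h w \<in> carrier R\<rbrakk> \<Longrightarrow>
   conv R (\<lambda>w. f w \<oplus> g w) h w = conv R f h w \<oplus> conv R g h w"
  by (induction w arbitrary: f g) (auto simp: l_distr a_ac conv_closed)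

lemma conv_add_right:
  "\<lbrakk>\<And>w. f w \<in> carrier R; \<And>w. g w \<in> carrier R; \<And>w. h w \<in> carrier R\<rbrakk> \<Longrightarrow>
   conv R f (\<lambda>w. g w \<oplus> h w) w = conv R f g w \<oplus> conv R f h w"
  by (induction w arbitrary: f) (auto simp: r_distr a_ac conv_closed)

lemma conv_smult_left:
  "\<lbrakk>a \<in> carrier R; \<And>w. f w \<in> carrier R; \<And>w. g w \<in> carrier R\<rbrakk> \<Longrightarrow>
   conv R (\<lambda>w. a \<otimes> f w) g w = a \<otimes> conv R f g w"
  by (induction w arbitrary: f) (auto simp: r_distr m_assoc conv_closed)

lemma conv_smult_right:
  "\<lbrakk>a \<in> carrier R; \<And>w. f w \<in> carrier R; \<And>w. g w \<in> carrier R\<rbrakk> \<Longrightarrow>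
   conv R f (\<lambda>w. a \<otimes> g w) w = a \<otimes> conv R f g w"
  by (induction w arbitrary: f) (auto simp: r_distr m_lcomm conv_closed)

lemma conv_assoc:
  "\<lbrakk>\<And>w. f w \<in> carrier R; \<And>w. g w \<in> carrier R; \<And>w. h w \<in> carrier R\<rbrakk> \<Longrightarrow>
   conv R (conv R f g) h w = conv R f (conv R g h) w"
proof (induction w arbitrary: f)
  case (Cons v w)
  \<comment> \<open>The left derivative of the product of \<open>f\<close> and \<open>g\<close> is
    \<open>f []\<close> times the derivative of \<open>g\<close> plus the product of the derivative
    of \<open>f\<close> with \<open>g\<close>. The induction hypothesis applies to the second
    summand.\<close>
  have "conv R (\<lambda>u. f [] \<otimes> g (v # u) \<oplus> conv R (\<lambda>u. f (v # u)) g u) h w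
      = f [] \<otimes> conv R (\<lambda>u. g (v # u)) h w \<oplus> conv R (\<lambda>u. f (v # u)) (conv R g h) w"
    using Cons.prems by (simp add: conv_add_left conv_smult_left conv_closed Cons.IH)
  then show ?case using Cons.prems by (simp add: conv_closed r_distr m_assoc a_assoc)
qed (simp add: m_assoc)

lemma conv_zero_left: "(\<And>w. g w \<in> carrier R) \<Longrightarrow> conv R (\<lambda>w. \<zero>) g w = \<zero>"
  by (induction w) auto

lemma conv_one_left: "(\<And>w. g w \<in> carrier R) \<Longrightarrow> conv R (unit_vec R []) g w = g w"
  by (cases w) (auto simp: unit_vec_def conv_zero_left)

lemma conv_one_right: "(\<And>w. f w \<in> carrier R) \<Longrightarrow> conv R f (unit_vec R []) w = f w"
  by (induction w arbitrary: f) (auto simp: unit_vec_def)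

lemma nc_series_module: "module R (nc_series R)"
proof (rule moduleI[OF is_cring])
  show "abelian_group (nc_series R)"
  proof (rule abelian_groupI)
    fix f assume "f \<in> carrier (nc_series R)"
    then show "\<exists>g\<in>carrier (nc_series R). g \<oplus>\<^bsub>nc_series R\<^esub> f = \<zero>\<^bsub>nc_series R\<^esub>"
      by (intro bexI[of _ "\<lambda>w. \<ominus> f w"]) (auto simp: nc_series_simps l_neg)
  qed (auto simp: nc_series_simps a_ac)
qed (auto simp: nc_series_simps l_distr r_distr m_assoc)

lemma nc_series_algebra: "nonassoc_algebra R (nc_series R)"
  by (intro nonassoc_algebra.intro nc_series_module nonassoc_algebra_axioms.intro)
    (auto simp: nc_series_simps conv_closed conv_add_left conv_add_right conv_smult_left
      conv_smult_right fun_eq_iff)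

lemma unit_vec_nc: "unit_vec R w \<in> carrier (nc_series R)"
  by (auto simp: nc_series_simps unit_vec_def)

lemma nc_series_ring: "ring (nc_series R)"
proof -
  interpret N: nonassoc_algebra R "nc_series R" by (rule nc_series_algebra)
  show ?thesis
    by (intro ringI monoidI N.abelian_group_axioms)
      (auto simp: N.prod_closed N.prod_add_left N.prod_add_right unit_vec_nc[unfolded nc_series_simps]
        nc_series_simps conv_assoc conv_one_left conv_one_right conv_closed fun_eq_iff
        conv_add_left conv_add_right)
qed

lemma nc_series_finsum:
  "(\<And>i. i \<in> A \<Longrightarrow> f i \<in> carrier (nc_series R)) \<Longrightarrow>
   finsum (nc_series R) f A w = finsum R (\<lambda>i. f i w) A"
proof (induction A rule: infinite_finite_induct)
  case (insert x F)
  interpret N: module R "nc_series R" by (rule nc_series_module)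
  have "finsum (nc_series R) f (insert x F) w = f x w \<oplus> finsum (nc_series R) f F w"
    using insert by (subst N.M.finsum_insert) (auto simp: nc_series_simps)
  then show ?case using insert by (simp add: finsum_insert nc_series_simps Pi_iff)
\<comment> \<open>Over an infinite index set both sums are zero by convention.\<close>
qed (auto simp: finsum_def finprod_def nc_series_simps)

text \<open>If \<open>f\<close> lives in the single length \<open>m\<close>, only one way of
  splitting the word contributes. This reduces leading terms of products to a comparison of two
  pieces.\<close>

lemma conv_homogeneous:
  assumes "\<And>w. f w \<in> carrier R" "\<And>w. g w \<in> carrier R" "\<And>w. f w \<noteq> \<zero> \<Longrightarrow> length w = m"
  shows "conv R f g w = (if m \<le> length w then f (take m w) \<otimes> g (drop m w) else \<zero>)"
  using assms
proof (induction w arbitrary: f m)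
  case Nil
  then show ?case using Nil(3)[of "[]"] by (cases "f [] = \<zero>") simp_all
next
  case (Cons v w)
  \<comment> \<open>In positive degree the constant term vanishes, in degree zero all left
    derivatives do; either way only one summand of the recursion survives.\<close>
  have f0: "f [] = \<zero>" if "m \<noteq> 0" using Cons.prems(3)[of "[]"] that by auto
  have fv: "f (v # u) = \<zero>" if "m = 0" for u using Cons.prems(3)[of "v # u"] that by auto
  show ?case
  proof (cases m)
    case 0
    then show ?thesis using fv Cons.prems by (simp add: conv_zero_left)
  next
    case (Suc n)
    have "conv R (\<lambda>u. f (v # u)) g w
        = (if n \<le> length w then f (v # take n w) \<otimes> g (drop n w) else \<zero>)"
      using Suc by (intro Cons.IH) (auto simp: Cons.prems(1,2) dest: Cons.prems(3))
    then show ?thesis using f0 Suc Cons.prems by simp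
  qed
qed

end

section \<open>Lyndon trees\<close>

primrec foliage :: "'v magma \<Rightarrow> 'v list" where
  "foliage (Gen v) = [v]"
| "foliage (Node s t) = foliage s @ foliage t"

lemma foliage_not_Nil [simp]: "foliage t \<noteq> []"
  by (induction t) auto

lemma set_foliage [simp]: "set (foliage t) = gens t"
  by (induction t) auto

abbreviation foliages :: "'v magma list \<Rightarrow> 'v list"
  where "foliages ts \<equiv> concat (map foliage ts)"

text \<open>The order is a relation given as a parameter, since the generators come from an
  arbitrary type; one is chosen only at the very end.\<close>

locale strict_total_order =
  fixes r :: "('v \<times> 'v) set"
  assumes irrefl: "irrefl r" and trans: "trans r" and total: "total r"
begin

abbreviation lex_less :: "'v list \<Rightarrow> 'v list \<Rightarrow> bool" (infix "\<prec>" 50)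
  where "u \<prec> v \<equiv> (u, v) \<in> lexord r"

abbreviation lex_le :: "'v list \<Rightarrow> 'v list \<Rightarrow> bool" (infix "\<preceq>" 50)
  where "u \<preceq> v \<equiv> u = v \<or> u \<prec> v"

lemma lex_irrefl: "\<not> u \<prec> u"
  using lexord_irrefl[OF irrefl] by (simp add: irrefl_def)

lemma lex_trans: "u \<prec> v \<Longrightarrow> v \<prec> w \<Longrightarrow> u \<prec> w"
  using lexord_trans trans by blast

lemma lex_total: "u \<prec> v \<or> u = v \<or> v \<prec> u"
  using total_lexord[OF total] by (auto simp: total_on_def)

lemma lex_asym: "u \<prec> v \<Longrightarrow> \<not> v \<prec> u"
  using lex_irrefl lex_trans by blast

lemma lex_le_append: "u \<preceq> u @ v"
  by (cases v) (auto intro: lexord_append_rightI)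

text \<open>A Hall-type condition for the lexicographic order. The last clause selects one
  bracketing per word, and its failure yields \<open>foliage s2 \<prec> foliage t\<close>, which is
  what makes an expansion of \<open>s\<close> profitable in \<open>lyndon_bracket\<close>.\<close>

primrec lyndon :: "'v magma \<Rightarrow> bool" where
  "lyndon (Gen v) \<longleftrightarrow> True"
| "lyndon (Node s t) \<longleftrightarrow> lyndon s \<and> lyndon t \<and> foliage s \<prec> foliage t \<and>
     (\<forall>s1 s2. s = Node s1 s2 \<longrightarrow> foliage t \<preceq> foliage s2)"

text \<open>
  The foliage of a Lyndon tree is a Lyndon word, and the foliage of its right subtree is the least
  proper suffix; hence the tree can be recovered from its foliage.
\<close>

lemma lyndon_suffix:
  assumes "lyndon t" "foliage t = x @ y" "x \<noteq> []" "y \<noteq> []"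
  shows "foliage t \<prec> y \<and> (\<forall>t1 t2. t = Node t1 t2 \<longrightarrow> foliage t2 \<preceq> y)"
  using assms
proof (induction t arbitrary: x y)
  case (Gen v)
  then show ?case by (auto simp: append_eq_Cons_conv Cons_eq_append_conv)
next
  case (Node s t)
  let ?u = "foliage s" and ?v = "foliage t"
  have uv: "?u \<prec> ?v" and ls: "lyndon s" and lt: "lyndon t" using Node.prems by auto
  have 1: "?u @ ?v \<prec> ?v"
  proof -
    \<comment> \<open>Either \<open>?u\<close> is a proper prefix of \<open>?v\<close>, or the two
      differ at a first letter, where appending changes nothing. In the prefix case the induction
      hypothesis puts \<open>?v\<close> below its own suffix \<open>a # z\<close>; prefixing
      \<open>?u\<close> on both sides gives the claim.\<close>
    consider a z where "?v = ?u @ a # z" | p a b q q' where "?u = p @ a # q" "?v = p @ b # q'" "(a, b) \<in> r"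
      using uv unfolding lexord_def by blast
    then show ?thesis
    proof cases
      case 1
      then have "?v \<prec> a # z" using Node.IH(2)[OF lt 1] by simp
      then show ?thesis using lexord_append_leftI[of ?v "a # z" r ?u] 1 by simp
    next
      case 2
      then show ?thesis by (simp add: lexord_append_left_rightI)
    qed
  qed
  have "?v \<preceq> y"
  proof -
    \<comment> \<open>The suffix starts inside \<open>s\<close> or inside \<open>t\<close>. In the
      first case its part \<open>z\<close> in \<open>s\<close>, if nonempty, is at least
      \<open>foliage s2\<close>, which is at least \<open>?v\<close> by the last clause of
      \<open>lyndon\<close>; lengthening \<open>z\<close> to \<open>y\<close> only increases
      it.\<close>
    from Node.prems(2) consider z where "?u = x @ z" "y = z @ ?v" | z where "x = ?u @ z" "?v = z @ y"
      by (auto simp: append_eq_append_conv2)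
    then show ?thesis
    proof cases
      case 1
      show ?thesis
      proof (cases "z = []")
        case False
        obtain s1 s2 where s: "s = Node s1 s2"
        proof (cases s)
          case (Gen a)
          then show ?thesis using 1 Node.prems(3) False by (auto simp: Cons_eq_append_conv)
        qed auto
        have "foliage s2 \<preceq> z" using Node.IH(1)[OF ls 1(1) Node.prems(3) False] s by auto
        moreover have "?v \<preceq> foliage s2" using Node.prems(1) s by auto
        ultimately show ?thesis using 1 lex_le_append[of z ?v] lex_trans by metis
      qed (use 1 in auto)
    next
      case 2
      then show ?thesis using Node.IH(2)[OF lt 2(2)] Node.prems(4) by (cases "z = []") auto
    qed
  qed
  then show ?case using 1 lex_trans by auto
qed

lemma foliage_inj:
  assumes "lyndon s" "lyndon t" "foliage s = foliage t"
  shows "s = t"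
  using assms
proof (induction s arbitrary: t)
  case (Gen v)
  then show ?case by (cases t) (auto simp: Cons_eq_append_conv)
next
  case (Node s1 s2)
  obtain t1 t2 where t: "t = Node t1 t2"
    using Node.prems(3) by (cases t) (auto simp: append_eq_Cons_conv)
  have "foliage s2 \<preceq> foliage t2"
    using lyndon_suffix[OF Node.prems(1), of "foliage t1" "foliage t2"] Node.prems(3) t by auto
  moreover have "foliage t2 \<preceq> foliage s2"
    using lyndon_suffix[OF Node.prems(2), of "foliage s1" "foliage s2"] Node.prems(3) t by auto
  ultimately have 2: "foliage s2 = foliage t2" using lex_asym by auto
  moreover have "foliage s1 = foliage t1" using Node.prems(3) t 2 by simp
  ultimately show ?case using Node t by auto
qed

text \<open>Nonincreasing order is the order of the Chen-Fox-Lyndon factorization, which is what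
  makes the list recoverable from its concatenated foliages.\<close>

definition lyndon_list :: "'v magma list \<Rightarrow> bool"
  where "lyndon_list ts \<longleftrightarrow> (\<forall>t\<in>set ts. lyndon t) \<and> sorted_wrt (\<lambda>s t. foliage t \<preceq> foliage s) ts"

text \<open>The suffix begins inside one of the foliages. Its part there is a suffix of a Lyndon
  word, hence at least that word and so at least \<open>v\<close>; the letters after it only
  increase it.\<close>

lemma foliages_suffix:
  assumes "\<forall>t\<in>set ts. lyndon t \<and> v \<preceq> foliage t" "foliages ts = x @ y" "y \<noteq> []"
  shows "v \<preceq> y"
  using assms
proof (induction ts arbitrary: x)
  case (Cons t ts)
  from Cons.prems(2) consider z where "foliage t = x @ z" "y = z @ foliages ts"
    | z where "x = foliage t @ z" "foliages ts = z @ y"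
    by (auto simp: append_eq_append_conv2)
  then show ?case
  proof cases
    case 1
    show ?thesis
    proof (cases "z = []")
      case True
      then show ?thesis using Cons.IH[of "[]"] Cons.prems 1 by auto
    next
      case False
      have "foliage t \<preceq> z" using lyndon_suffix[of t x z] Cons.prems(1) False 1(1) by (cases "x = []") auto
      moreover have "v \<preceq> foliage t" using Cons.prems(1) by auto
      moreover have "z \<preceq> y" using 1 lex_le_append[of z "foliages ts"] by auto
      ultimately show ?thesis using lex_trans by metis
    qed
  next
    case 2
    then show ?thesis using Cons by auto
  qed
qed simp

lemma lyndon_list_snoc:
  assumes "lyndon_list (ts @ [t])"
  shows "lyndon_list ts" "\<forall>s\<in>set (ts @ [t]). lyndon s \<and> foliage t \<preceq> foliage s"
  using assms by (auto simp: lyndon_list_def sorted_wrt_append)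

text \<open>By \<open>foliages_suffix\<close> the last factor is the least nonempty suffix of the
  concatenation. So both lists end in the same tree, which is cancelled.\<close>

lemma foliages_inj:
  assumes "lyndon_list ss" "lyndon_list ts" "foliages ss = foliages ts"
  shows "ss = ts"
  using assms
proof (induction ss arbitrary: ts rule: rev_induct)
  case (snoc s ss)
  obtain t ts' where ts: "ts = ts' @ [t]" using snoc.prems(3) by (cases ts rule: rev_cases) auto
  note s = lyndon_list_snoc[OF snoc.prems(1)] and t = lyndon_list_snoc[OF snoc.prems(2)[unfolded ts]]
  have eq: "foliages ss @ foliage s = foliages ts' @ foliage t" using snoc.prems(3) ts by simp
  have "foliage s \<preceq> foliage t" using foliages_suffix[OF s(2), of "foliages ts'" "foliage t"] eq by simp
  moreover have "foliage t \<preceq> foliage s"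
    using foliages_suffix[OF t(2), of "foliages ss" "foliage s"] eq by simp
  ultimately have st: "foliage s = foliage t" using lex_asym by auto
  then have "s = t" using foliage_inj s t by auto
  moreover have "ss = ts'" using snoc.IH[OF s(1) t(1)] eq st by simp
  ultimately show ?case using ts by simp
qed (auto simp: concat_eq_Nil_conv)

end

section \<open>Independence of the products of Lyndon commutators\<close>

primrec commutator_tree :: "('k, 'r) ring_scheme \<Rightarrow> 'v magma \<Rightarrow> 'v list \<Rightarrow> 'k" where
  "commutator_tree R (Gen v) = unit_vec R [v]"
| "commutator_tree R (Node s t) =
     commutator_tree R s \<otimes>\<^bsub>nc_series R\<^esub> commutator_tree R t \<ominus>\<^bsub>nc_series R\<^esub>
     commutator_tree R t \<otimes>\<^bsub>nc_series R\<^esub> commutator_tree R s"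

definition commutator_prod :: "('k, 'r) ring_scheme \<Rightarrow> 'v magma list \<Rightarrow> 'v list \<Rightarrow> 'k"
  where "commutator_prod R ts = foldr (\<lambda>t f. commutator_tree R t \<otimes>\<^bsub>nc_series R\<^esub> f) ts \<one>\<^bsub>nc_series R\<^esub>"

lemma (in cring) commutator_tree_closed: "commutator_tree R t \<in> carrier (nc_series R)"
proof -
  interpret N: ring "nc_series R" by (rule nc_series_ring)
  show ?thesis by (induction t) (auto simp: unit_vec_nc)
qed

locale ordered_cring = cring R + strict_total_order r
  for R :: "('k, 'r) ring_scheme" (structure) and r :: "('v \<times> 'v) set"
begin

text \<open>Fixing the length excludes that \<open>w\<close> is a proper prefix of another word of
  the support; without this, concatenation would not preserve the comparison.\<close>

definition leads :: "('v list \<Rightarrow> 'k) \<Rightarrow> 'v list \<Rightarrow> bool"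
  where "leads f w \<longleftrightarrow> f \<in> carrier (nc_series R) \<and> f w = \<one> \<and>
    (\<forall>u. f u \<noteq> \<zero> \<longrightarrow> length u = length w \<and> w \<preceq> u)"

lemma leads_closed: "leads f w \<Longrightarrow> f u \<in> carrier R"
  by (simp add: leads_def nc_series_simps)

lemma leads_support: "\<lbrakk>leads f w; f u \<noteq> \<zero>\<rbrakk> \<Longrightarrow> length u = length w \<and> w \<preceq> u"
  by (simp add: leads_def)

lemma leads_mult:
  assumes f: "leads f u" and g: "leads g v"
  shows "leads (f \<otimes>\<^bsub>nc_series R\<^esub> g) (u @ v)"
proof -
  interpret N: ring "nc_series R" by (rule nc_series_ring)
  have eq: "(f \<otimes>\<^bsub>nc_series R\<^esub> g) w
      = (if length u \<le> length w then f (take (length u) w) \<otimes> g (drop (length u) w) else \<zero>)" for w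
    unfolding nc_series_simps using f g
    by (intro conv_homogeneous) (auto simp: leads_def nc_series_simps)
  have "length w = length (u @ v) \<and> u @ v \<preceq> w" if w: "(f \<otimes>\<^bsub>nc_series R\<^esub> g) w \<noteq> \<zero>" for w
  proof -
    let ?a = "take (length u) w" and ?b = "drop (length u) w"
    have l: "length u \<le> length w" and ab: "f ?a \<otimes> g ?b \<noteq> \<zero>" using w eq by (auto split: if_splits)
    have "f ?a \<noteq> \<zero>" "g ?b \<noteq> \<zero>" using ab leads_closed[OF f, of ?a] leads_closed[OF g, of ?b] by auto
    then have a: "u \<preceq> ?a" and b: "length ?b = length v" "v \<preceq> ?b"
      using leads_support[OF f] leads_support[OF g] by blast+
    \<comment> \<open>If the first halves agree, the second halves decide. Otherwise the first
      halves have equal length and differ at a letter, so what follows is irrelevant.\<close>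
    have "u @ v \<preceq> ?a @ ?b"
    proof (cases "u = ?a")
      case True
      then show ?thesis using b(2) lexord_append_leftI[of v ?b r u] by auto
    next
      case False
      then show ?thesis using a l lexord_sufI[of u ?a r v ?b] by auto
    qed
    then show ?thesis using b l by simp
  qed
  moreover have "(f \<otimes>\<^bsub>nc_series R\<^esub> g) (u @ v) = \<one>" using f g by (simp add: eq leads_def)
  ultimately show ?thesis using f g by (simp add: leads_def)
qed

lemma leads_one: "leads \<one>\<^bsub>nc_series R\<^esub> []"
  using unit_vec_nc[of "[]"] by (auto simp: leads_def nc_series_simps(3)) (auto simp: unit_vec_def split: if_splits)

lemma leads_minus:
  assumes f: "leads f u" and g: "leads g v" and uv: "u \<prec> v" "length u = length v"
  shows "leads (f \<ominus>\<^bsub>nc_series R\<^esub> g) u"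
proof -
  interpret N: module R "nc_series R" by (rule nc_series_module)
  have fc: "f \<in> carrier (nc_series R)" "g \<in> carrier (nc_series R)"
    and fc': "\<And>w. f w \<in> carrier R" "\<And>w. g w \<in> carrier R"
    using f g by (auto simp: leads_def nc_series_simps)
  have "\<ominus>\<^bsub>nc_series R\<^esub> g = (\<lambda>w. \<ominus> g w)"
    using fc fc' by (intro N.M.minus_equality) (auto simp: nc_series_simps l_neg)
  then have eq: "(f \<ominus>\<^bsub>nc_series R\<^esub> g) w = f w \<ominus> g w" for w
    unfolding a_minus_def by (simp add: nc_series_simps)
  \<comment> \<open>\<open>u\<close> lies strictly below the leading word of \<open>g\<close>, so
    the coefficient one of \<open>f\<close> at \<open>u\<close> survives the subtraction.\<close>
  have z: "g u = \<zero>" using g uv lex_asym lex_irrefl by (auto simp: leads_def)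
  have "f w \<noteq> \<zero> \<or> g w \<noteq> \<zero>" if "f w \<ominus> g w \<noteq> \<zero>" for w
    using that by (auto simp: a_minus_def)
  then have "length w = length u \<and> u \<preceq> w" if "f w \<ominus> g w \<noteq> \<zero>" for w
    using that f g uv lex_trans unfolding leads_def by metis
  then show ?thesis
    using f z fc by (auto simp: leads_def eq) (simp add: a_minus_def)
qed

text \<open>Of the two products in the commutator the one in tree order has the smaller leading
  word: \<open>foliage s @ foliage t\<close> is below its suffix \<open>foliage t\<close>, which is
  a prefix of the other word.\<close>

lemma leads_commutator_tree: "lyndon t \<Longrightarrow> leads (commutator_tree R t) (foliage t)"
proof (induction t)
  case (Gen v)
  then show ?case using unit_vec_nc[of "[v]"] by (auto simp: leads_def) (auto simp: unit_vec_def split: if_splits)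
next
  case (Node s t)
  have "foliage s @ foliage t \<prec> foliage t"
    using lyndon_suffix[OF Node.prems, of "foliage s" "foliage t"] by simp
  then have "foliage s @ foliage t \<prec> foliage t @ foliage s"
    using lex_le_append[of "foliage t" "foliage s"] lex_trans by metis
  then show ?case using Node by (auto intro!: leads_minus leads_mult)
qed

lemma leads_commutator_prod:
  "\<forall>t\<in>set ts. lyndon t \<Longrightarrow> leads (commutator_prod R ts) (foliages ts)"
  by (induction ts) (auto simp: commutator_prod_def intro!: leads_one leads_mult leads_commutator_tree)

text \<open>Triangularity: at the least concatenation that occurs, only its own product contributes,
  with factor one. The value there is the bare coefficient, so zero divisors do no harm.\<close>

lemma commutator_prod_independent:
  assumes c: "c \<in> carrier (free_module R {ts. lyndon_list ts})"
    and z: "lin_ext R (nc_series R) (commutator_prod R) c = \<zero>\<^bsub>nc_series R\<^esub>"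
  shows "c ts = \<zero>"
proof (rule ccontr)
  assume "c ts \<noteq> \<zero>"
  let ?S = "{ts. c ts \<noteq> \<zero>}"
  note C = free_moduleD[OF c]
  have "\<exists>m\<in>?S. \<forall>x\<in>?S. x \<noteq> m \<longrightarrow> \<not> foliages x \<prec> foliages m"
  proof (rule Finite_Set.bex_min_element)
    show "asymp_on ?S (\<lambda>x y. foliages x \<prec> foliages y)" by (rule asymp_onI) (rule lex_asym)
    show "transp_on ?S (\<lambda>x y. foliages x \<prec> foliages y)" by (rule transp_onI) (rule lex_trans)
  qed (use C(3) \<open>c ts \<noteq> \<zero>\<close> in auto)
  then obtain m where m: "c m \<noteq> \<zero>" and min: "\<And>x. \<lbrakk>c x \<noteq> \<zero>; x \<noteq> m\<rbrakk> \<Longrightarrow> \<not> foliages x \<prec> foliages m"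
    by blast
  have ld: "leads (commutator_prod R x) (foliages x)" "lyndon_list x" if "c x \<noteq> \<zero>" for x
    using C(4) that leads_commutator_prod by (auto simp: lyndon_list_def)
  interpret N: module R "nc_series R" by (rule nc_series_module)
  have cl: "c x \<odot>\<^bsub>nc_series R\<^esub> commutator_prod R x \<in> carrier (nc_series R)" if "c x \<noteq> \<zero>" for x
    using ld[OF that] C(1) by (auto simp: leads_def)
  have "\<zero> = lin_ext R (nc_series R) (commutator_prod R) c (foliages m)"
    using z by (simp add: nc_series_simps)
  also have "\<dots> = finsum R (\<lambda>x. c x \<otimes> commutator_prod R x (foliages m)) ?S"
    unfolding lin_ext_def using cl by (subst nc_series_finsum) (auto simp: nc_series_simps)
  also have "\<dots> = finsum R (\<lambda>x. if m = x then c x else \<zero>) ?S"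
  proof (rule finsum_cong')
    fix x assume x: "x \<in> ?S"
    show "c x \<otimes> commutator_prod R x (foliages m) = (if m = x then c x else \<zero>)"
    proof (cases "m = x")
      case True
      then show ?thesis using ld(1)[of x] x C(1) by (auto simp: leads_def)
    next
      case False
      \<comment> \<open>Unique factorization enters here. The support of the product for
        \<open>x\<close> starts at \<open>foliages x\<close>, which is neither equal to nor below
        \<open>foliages m\<close>, so it misses that word.\<close>
      have "foliages x \<noteq> foliages m" using foliages_inj ld(2) x m False by auto
      then have "commutator_prod R x (foliages m) = \<zero>"
        using ld(1)[of x] x min[of x] False unfolding leads_def by auto
      then show ?thesis using False C(1) by simp
    qed
  qed (use C(1) in auto)
  also have "\<dots> = c m" using C(1,3) m by (intro finsum_singleton) auto
  finally show False using m by simp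
qed

end

section \<open>Bilinear maps\<close>

definition bilin :: "('k, 'r) ring_scheme \<Rightarrow> ('k, 'a, 'm) module_scheme \<Rightarrow> ('k, 'b, 'n) module_scheme
    \<Rightarrow> ('k, 'c, 'p) module_scheme \<Rightarrow> ('a \<Rightarrow> 'b \<Rightarrow> 'c) \<Rightarrow> bool"
  where "bilin R A B C f \<longleftrightarrow>
    (\<forall>b\<in>carrier B. lin R A C (\<lambda>a. f a b)) \<and> (\<forall>a\<in>carrier A. lin R B C (f a))"

lemma bilinI:
  assumes "\<And>a b. \<lbrakk>a \<in> carrier A; b \<in> carrier B\<rbrakk> \<Longrightarrow> f a b \<in> carrier C"
    "\<And>a a' b. \<lbrakk>a \<in> carrier A; a' \<in> carrier A; b \<in> carrier B\<rbrakk> \<Longrightarrow> f (a \<oplus>\<^bsub>A\<^esub> a') b = f a b \<oplus>\<^bsub>C\<^esub> f a' b"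
    "\<And>a b b'. \<lbrakk>a \<in> carrier A; b \<in> carrier B; b' \<in> carrier B\<rbrakk> \<Longrightarrow> f a (b \<oplus>\<^bsub>B\<^esub> b') = f a b \<oplus>\<^bsub>C\<^esub> f a b'"
    "\<And>c a b. \<lbrakk>c \<in> carrier R; a \<in> carrier A; b \<in> carrier B\<rbrakk> \<Longrightarrow> f (c \<odot>\<^bsub>A\<^esub> a) b = c \<odot>\<^bsub>C\<^esub> f a b"
    "\<And>c a b. \<lbrakk>c \<in> carrier R; a \<in> carrier A; b \<in> carrier B\<rbrakk> \<Longrightarrow> f a (c \<odot>\<^bsub>B\<^esub> b) = c \<odot>\<^bsub>C\<^esub> f a b"
  shows "bilin R A B C f"
  unfolding bilin_def by (intro conjI ballI linI) (use assms in auto)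

lemma bilin_left: "\<lbrakk>bilin R A B C f; b \<in> carrier B\<rbrakk> \<Longrightarrow> lin R A C (\<lambda>a. f a b)"
  and bilin_right: "\<lbrakk>bilin R A B C f; a \<in> carrier A\<rbrakk> \<Longrightarrow> lin R B C (f a)"
  by (auto simp: bilin_def)

lemma bilin_closed: "\<lbrakk>bilin R A B C f; a \<in> carrier A; b \<in> carrier B\<rbrakk> \<Longrightarrow> f a b \<in> carrier C"
  by (auto intro: lin_closed bilin_right)

lemma bilin_compose:
  "\<lbrakk>bilin R A B C f; lin R A' A g; lin R B' B h\<rbrakk> \<Longrightarrow> bilin R A' B' C (\<lambda>a b. f (g a) (h b))"
  unfolding bilin_def by (auto simp: lin_def Pi_iff)

lemma lin_bilin_compose:
  "\<lbrakk>bilin R A B C f; lin R C C' h\<rbrakk> \<Longrightarrow> bilin R A B C' (\<lambda>a b. h (f a b))"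
  unfolding bilin_def by (auto intro: lin_compose)

lemma bilin_span_subset:
  assumes mods: "module R A" "module R B" "module R C" and f: "bilin R A B C f"
    and S: "submodule S R C" and X: "X \<subseteq> carrier A" and Y: "Y \<subseteq> carrier B"
    and gen: "\<And>x y. \<lbrakk>x \<in> X; y \<in> Y\<rbrakk> \<Longrightarrow> f x y \<in> S"
    and a: "a \<in> module_span R A X" and b: "b \<in> module_span R B Y"
  shows "f a b \<in> S"
proof -
  interpret A: module R A by fact
  interpret B: module R B by fact
  interpret C: module R C by fact
  interpret AC: module_pair R A C ..
  interpret BC: module_pair R B C ..
  have b': "b \<in> carrier B" using B.module_span_carrier[OF Y] b by auto
  have "f x b \<in> S" if "x \<in> X" for x
    by (rule BC.lin_span_subset[OF bilin_right[OF f] S _ _ b]) (use that X Y gen in auto)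
  then show ?thesis
    by (intro AC.lin_span_subset[OF bilin_left[OF f b'] S _ _ a]) (use X in auto)
qed

lemma bilin_eq_on_span:
  assumes mods: "module R A" "module R B" "module R C"
    and f: "bilin R A B C f" and g: "bilin R A B C g"
    and X: "X \<subseteq> carrier A" and Y: "Y \<subseteq> carrier B"
    and gen: "\<And>x y. \<lbrakk>x \<in> X; y \<in> Y\<rbrakk> \<Longrightarrow> f x y = g x y"
    and a: "a \<in> module_span R A X" and b: "b \<in> module_span R B Y"
  shows "f a b = g a b"
proof -
  interpret A: module R A by fact
  interpret B: module R B by fact
  interpret C: module R C by fact
  interpret AC: module_pair R A C ..
  interpret BC: module_pair R B C ..
  have b': "b \<in> carrier B" using B.module_span_carrier[OF Y] b by auto
  have "f x b = g x b" if "x \<in> X" for x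
    by (rule BC.lin_eq_on_span[OF bilin_right[OF f] bilin_right[OF g] _ _ b]) (use that X Y gen in auto)
  then show ?thesis
    by (intro AC.lin_eq_on_span[OF bilin_left[OF f b'] bilin_left[OF g b'] _ _ a]) (use X in auto)
qed

lemma (in nonassoc_algebra) bilin_prod: "bilin R A A A (\<lambda>x y. x \<otimes>\<^bsub>A\<^esub> y)"
  by (rule bilinI) (auto simp: prod_closed prod_add_left prod_add_right prod_smult_left prod_smult_right)

section \<open>Tensor powers\<close>

context module
begin

abbreviation "F \<equiv> \<lambda>n. free_module R (tensor_words M n)"
abbreviation "N \<equiv> multilinear_submodule R M"
abbreviation "T \<equiv> tensor_power R M"
abbreviation "pt \<equiv> pure_tensor R M"
abbreviation "TA \<equiv> tensor_algebra R M"

lemma tensor_words_iff: "xs \<in> tensor_words M n \<longleftrightarrow> length xs = n \<and> set xs \<subseteq> carrier M"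
  by (auto simp: tensor_words_def)

lemma F_module: "module R (F n)"
  by (rule free_module_module) (rule is_cring)

lemma F_closed:
  "\<lbrakk>x \<in> carrier (F n); y \<in> carrier (F n)\<rbrakk> \<Longrightarrow> x \<oplus>\<^bsub>F n\<^esub> y \<in> carrier (F n)"
  "\<lbrakk>x \<in> carrier (F n); y \<in> carrier (F n)\<rbrakk> \<Longrightarrow> x \<ominus>\<^bsub>F n\<^esub> y \<in> carrier (F n)"
  "\<lbrakk>a \<in> carrier R; x \<in> carrier (F n)\<rbrakk> \<Longrightarrow> a \<odot>\<^bsub>F n\<^esub> x \<in> carrier (F n)"
proof -
  interpret F: module R "F n" by (rule F_module)
  show "\<lbrakk>x \<in> carrier (F n); y \<in> carrier (F n)\<rbrakk> \<Longrightarrow> x \<oplus>\<^bsub>F n\<^esub> y \<in> carrier (F n)"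
    "\<lbrakk>x \<in> carrier (F n); y \<in> carrier (F n)\<rbrakk> \<Longrightarrow> x \<ominus>\<^bsub>F n\<^esub> y \<in> carrier (F n)"
    "\<lbrakk>a \<in> carrier R; x \<in> carrier (F n)\<rbrakk> \<Longrightarrow> a \<odot>\<^bsub>F n\<^esub> x \<in> carrier (F n)"
    by auto
qed

lemma unit_vec_F: "xs \<in> tensor_words M n \<Longrightarrow> unit_vec R xs \<in> carrier (F n)"
  by (rule unit_vec_closed[OF is_cring])

lemma multilinear_relators_closed: "multilinear_relators R M n \<subseteq> carrier (F n)"
  unfolding multilinear_relators_def Let_def
  by (auto intro!: F_closed unit_vec_F simp: tensor_words_iff)

lemma N_submodule: "submodule (N n) R (F n)"
proof -
  interpret F: module R "F n" by (rule F_module)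
  show ?thesis unfolding multilinear_submodule_def
    by (rule F.module_span_submodule) (rule multilinear_relators_closed)
qed

lemma T_module: "module R (T n)"
  unfolding tensor_power_def by (rule module.module_quot[OF F_module N_submodule])

lemma lin_F_T: "lin R (F n) (T n) (\<lambda>x. N n +>\<^bsub>F n\<^esub> x)"
  unfolding tensor_power_def by (rule module.lin_coset[OF F_module N_submodule])

lemma pure_tensor_eq: "length xs = n \<Longrightarrow> pt xs = N n +>\<^bsub>F n\<^esub> unit_vec R xs"
  by (auto simp: pure_tensor_def)

lemma pure_tensor_closed: "xs \<in> tensor_words M n \<Longrightarrow> pt xs \<in> carrier (T n)"
  using lin_closed[OF lin_F_T unit_vec_F] by (auto simp: tensor_words_iff pure_tensor_eq)

lemma pure_tensor_span: "module_span R (T n) (pt ` tensor_words M n) = carrier (T n)"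
proof
  interpret Fn: module R "F n" by (rule F_module)
  interpret Tn: module R "T n" by (rule T_module)
  interpret FT: module_pair R "F n" "T n" ..
  let ?S = "module_span R (T n) (pt ` tensor_words M n)"
  have sub: "pt ` tensor_words M n \<subseteq> carrier (T n)" using pure_tensor_closed by auto
  then show "?S \<subseteq> carrier (T n)" by (rule Tn.module_span_carrier)
  have "N n +>\<^bsub>F n\<^esub> x \<in> ?S" if "x \<in> carrier (F n)" for x
  proof (rule FT.lin_span_subset[OF lin_F_T Tn.module_span_submodule[OF sub]])
    show "x \<in> module_span R (F n) (unit_vec R ` tensor_words M n)"
      using that by (simp add: free_module_span)
    show "N n +>\<^bsub>F n\<^esub> y \<in> ?S" if y: "y \<in> unit_vec R ` tensor_words M n" for y
    proof -
      obtain xs where xs: "xs \<in> tensor_words M n" "y = unit_vec R xs" using y by auto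
      then have "N n +>\<^bsub>F n\<^esub> y = pt xs" by (simp add: pure_tensor_eq tensor_words_iff)
      then show ?thesis using Tn.module_span_superset[of "pt ` tensor_words M n"] xs by auto
    qed
  qed (auto intro: unit_vec_F)
  then show "carrier (T n) \<subseteq> ?S" by (auto simp: tensor_power_def carrier_quot)
qed

lemma pure_tensor_add:
  assumes "x \<in> carrier M" "y \<in> carrier M" "set us \<subseteq> carrier M" "set vs \<subseteq> carrier M"
    and n: "n = Suc (length us + length vs)"
  shows "pt (us @ (x \<oplus>\<^bsub>M\<^esub> y) # vs) = pt (us @ x # vs) \<oplus>\<^bsub>T n\<^esub> pt (us @ y # vs)"
proof -
  interpret Fn: module R "F n" by (rule F_module)
  let ?e = "\<lambda>z. unit_vec R (us @ z # vs)"
  have c: "?e z \<in> carrier (F n)" if "z \<in> carrier M" for z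
    using assms that by (intro unit_vec_F) (auto simp: tensor_words_iff)
  have "?e (x \<oplus>\<^bsub>M\<^esub> y) \<ominus>\<^bsub>F n\<^esub> (?e x \<oplus>\<^bsub>F n\<^esub> ?e y) \<in> multilinear_relators R M n"
    unfolding multilinear_relators_def Let_def
    by (rule UnI1, rule CollectI, rule exI[of _ us], rule exI[of _ vs], rule exI[of _ x], rule exI[of _ y])
      (use assms in auto)
  then have "?e (x \<oplus>\<^bsub>M\<^esub> y) \<ominus>\<^bsub>F n\<^esub> (?e x \<oplus>\<^bsub>F n\<^esub> ?e y) \<in> N n"
    unfolding multilinear_submodule_def using Fn.module_span_superset[of "multilinear_relators R M n"] by auto
  then have "N n +>\<^bsub>F n\<^esub> ?e (x \<oplus>\<^bsub>M\<^esub> y) = N n +>\<^bsub>F n\<^esub> (?e x \<oplus>\<^bsub>F n\<^esub> ?e y)"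
    using c assms(1-4) by (subst Fn.coset_eq_iff[OF N_submodule]) (auto intro: F_closed)
  then show ?thesis using c assms n by (simp add: pure_tensor_eq[of _ n] lin_add[OF lin_F_T])
qed

lemma pure_tensor_smult:
  assumes "a \<in> carrier R" "x \<in> carrier M" "set us \<subseteq> carrier M" "set vs \<subseteq> carrier M"
    and n: "n = Suc (length us + length vs)"
  shows "pt (us @ (a \<odot>\<^bsub>M\<^esub> x) # vs) = a \<odot>\<^bsub>T n\<^esub> pt (us @ x # vs)"
proof -
  interpret Fn: module R "F n" by (rule F_module)
  let ?e = "\<lambda>z. unit_vec R (us @ z # vs)"
  have c: "?e z \<in> carrier (F n)" if "z \<in> carrier M" for z
    using assms that by (intro unit_vec_F) (auto simp: tensor_words_iff)
  have "?e (a \<odot>\<^bsub>M\<^esub> x) \<ominus>\<^bsub>F n\<^esub> a \<odot>\<^bsub>F n\<^esub> ?e x \<in> multilinear_relators R M n"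
    unfolding multilinear_relators_def Let_def
    by (rule UnI2, rule CollectI, rule exI[of _ us], rule exI[of _ vs], rule exI[of _ a], rule exI[of _ x])
      (use assms in auto)
  then have "?e (a \<odot>\<^bsub>M\<^esub> x) \<ominus>\<^bsub>F n\<^esub> a \<odot>\<^bsub>F n\<^esub> ?e x \<in> N n"
    unfolding multilinear_submodule_def using Fn.module_span_superset[of "multilinear_relators R M n"] by auto
  then have "N n +>\<^bsub>F n\<^esub> ?e (a \<odot>\<^bsub>M\<^esub> x) = N n +>\<^bsub>F n\<^esub> (a \<odot>\<^bsub>F n\<^esub> ?e x)"
    using c assms(1-4) by (subst Fn.coset_eq_iff[OF N_submodule]) (auto intro: F_closed)
  then show ?thesis using c assms n by (simp add: pure_tensor_eq[of _ n] lin_smult[OF lin_F_T])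
qed

lemma lin_slot:
  assumes "set us \<subseteq> carrier M" "set vs \<subseteq> carrier M" "n = Suc (length us + length vs)"
  shows "lin R M (T n) (\<lambda>x. pt (us @ x # vs))"
  by (rule linI) (use assms in \<open>auto simp: pure_tensor_add pure_tensor_smult tensor_words_iff
    intro!: pure_tensor_closed\<close>)

text \<open>Existence half of the universal property of the tensor power. Linearity is asked for one
  slot with fixed context \<open>us\<close>, \<open>vs\<close>, which is exactly the shape of a
  relator.\<close>

lemma tensor_power_lift:
  assumes P: "module R P" and f: "f \<in> tensor_words M n \<rightarrow> carrier P"
    and slot: "\<And>us vs. \<lbrakk>set us \<subseteq> carrier M; set vs \<subseteq> carrier M; n = Suc (length us + length vs)\<rbrakk> \<Longrightarrow>
      lin R M P (\<lambda>x. f (us @ x # vs))"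
  shows "\<exists>g. lin R (T n) P g \<and> (\<forall>xs\<in>tensor_words M n. g (pt xs) = f xs)"
proof -
  interpret P: module R P by fact
  interpret Fn: module R "F n" by (rule F_module)
  interpret FP: module_pair R "F n" P ..
  note l = P.lin_lin_ext[OF f] and u = P.lin_ext_unit_vec[OF f]
  have ker: "lin_ext R P f s = \<zero>\<^bsub>P\<^esub>" if s: "s \<in> N n" for s
  proof -
    have "lin_ext R P f s \<in> {\<zero>\<^bsub>P\<^esub>}"
    proof (rule FP.lin_span_subset[OF l P.submodule_singleton_zero])
      show "s \<in> module_span R (F n) (multilinear_relators R M n)"
        using s by (simp add: multilinear_submodule_def)
      fix x assume x: "x \<in> multilinear_relators R M n"
      then show "x \<in> carrier (F n)" using multilinear_relators_closed by auto
      from x consider us vs y z where "x = unit_vec R (us @ [y \<oplus>\<^bsub>M\<^esub> z] @ vs) \<ominus>\<^bsub>F n\<^esub>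
            (unit_vec R (us @ [y] @ vs) \<oplus>\<^bsub>F n\<^esub> unit_vec R (us @ [z] @ vs))"
          "y \<in> carrier M" "z \<in> carrier M" "set us \<union> set vs \<subseteq> carrier M" "length us + 1 + length vs = n"
        | us vs a y where "x = unit_vec R (us @ [a \<odot>\<^bsub>M\<^esub> y] @ vs) \<ominus>\<^bsub>F n\<^esub> a \<odot>\<^bsub>F n\<^esub> unit_vec R (us @ [y] @ vs)"
          "a \<in> carrier R" "y \<in> carrier M" "set us \<union> set vs \<subseteq> carrier M" "length us + 1 + length vs = n"
        unfolding multilinear_relators_def Let_def by blast
      then show "lin_ext R P f x \<in> {\<zero>\<^bsub>P\<^esub>}"
      proof cases
        case 1
        have w: "us @ b # vs \<in> tensor_words M n" if "b \<in> carrier M" for b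
          using 1 that by (auto simp: tensor_words_iff)
        have s: "lin R M P (\<lambda>x. f (us @ x # vs))" using 1 by (intro slot) auto
        show ?thesis using 1(1-3) w lin_closed[OF s]
          by (simp add: FP.lin_minus[OF l] lin_add[OF l] u unit_vec_F lin_add[OF s] P.minus_eq_zero_iff)
      next
        case 2
        have w: "us @ b # vs \<in> tensor_words M n" if "b \<in> carrier M" for b
          using 2 that by (auto simp: tensor_words_iff)
        have s: "lin R M P (\<lambda>x. f (us @ x # vs))" using 2 by (intro slot) auto
        show ?thesis using 2(1-3) w lin_closed[OF s]
          by (simp add: FP.lin_minus[OF l] lin_smult[OF l] u unit_vec_F lin_smult[OF s] P.minus_eq_zero_iff)
      qed
    qed
    then show ?thesis by simp
  qed
  show ?thesis
  proof (intro exI conjI ballI)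
    show "lin R (T n) P (qlift (lin_ext R P f))"
      unfolding tensor_power_def by (rule FP.lin_qlift[OF l N_submodule ker])
    fix xs assume xs: "xs \<in> tensor_words M n"
    have "qlift (lin_ext R P f) (N n +>\<^bsub>F n\<^esub> unit_vec R xs) = f xs"
      using xs u by (simp add: FP.qlift_coset[OF l N_submodule ker] unit_vec_F)
    then show "qlift (lin_ext R P f) (pt xs) = f xs" using xs by (simp add: pure_tensor_eq tensor_words_iff)
  qed
qed

lemma pure_tensor_span_generators:
  assumes S: "S \<subseteq> carrier M" "module_span R M S = carrier M"
  shows "module_span R (T n) {pt xs | xs. length xs = n \<and> set xs \<subseteq> S} = carrier (T n)"
proof
  interpret Tn: module R "T n" by (rule T_module)
  interpret MT: module_pair R M "T n" ..
  let ?G = "{pt xs | xs. length xs = n \<and> set xs \<subseteq> S}"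
  have sub: "?G \<subseteq> carrier (T n)" using S(1) by (auto intro!: pure_tensor_closed simp: tensor_words_iff)
  then show "module_span R (T n) ?G \<subseteq> carrier (T n)" by (rule Tn.module_span_carrier)
  note sm = Tn.module_span_submodule[OF sub]
  \<comment> \<open>\<open>us\<close> holds the entries already taken from \<open>S\<close>,
    \<open>vs\<close> those still arbitrary. Linearity in the slot at the boundary moves it one
    place to the right.\<close>
  have "pt (us @ vs) \<in> module_span R (T n) ?G"
    if "set us \<subseteq> S" "set vs \<subseteq> carrier M" "length us + length vs = n" for us vs
    using that
  proof (induction vs arbitrary: us)
    case Nil
    then show ?case using Tn.module_span_superset[of ?G] by auto
  next
    case (Cons v vs)
    show ?case
    proof (rule MT.lin_span_subset[OF _ sm])
      show "lin R M (T n) (\<lambda>x. pt (us @ x # vs))" using Cons.prems S(1) by (intro lin_slot) auto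
      show "v \<in> module_span R M S" using S(2) Cons.prems by auto
      show "pt (us @ x # vs) \<in> module_span R (T n) ?G" if "x \<in> S" for x
        using Cons.IH[of "us @ [x]"] Cons.prems that by auto
    qed (use S in auto)
  qed
  from this[of "[]"] have "pt ` tensor_words M n \<subseteq> module_span R (T n) ?G"
    by (auto simp: tensor_words_iff)
  then show "carrier (T n) \<subseteq> module_span R (T n) ?G"
    using Tn.module_span_least[OF sm] pure_tensor_span by blast
qed

section \<open>The tensor algebra\<close>

abbreviation "conc \<equiv> \<lambda>i a b w. a (take i w) \<otimes>\<^bsub>R\<^esub> b (drop i w)"

lemma conc_bilin: "bilin R (F i) (F j) (F (i + j)) (conc i)"
proof (rule bilinI)
  fix a b assume a: "a \<in> carrier (F i)" and b: "b \<in> carrier (F j)"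
  note A = free_moduleD[OF a] and B = free_moduleD[OF b]
  show "conc i a b \<in> carrier (F (i + j))"
    unfolding free_module_def
  proof (simp, intro conjI allI impI)
    fix w assume "w \<notin> tensor_words M (i + j)"
    then have "take i w \<notin> tensor_words M i \<or> drop i w \<notin> tensor_words M j"
      using set_append[of "take i w" "drop i w"] unfolding append_take_drop_id
      by (auto simp: tensor_words_iff)
    then show "a (take i w) \<otimes> b (drop i w) = \<zero>" using A(1,2) B(1,2) by auto
  next
    show "finite {w. a (take i w) \<otimes> b (drop i w) \<noteq> \<zero>}"
    proof (rule finite_subset)
      show "{w. a (take i w) \<otimes> b (drop i w) \<noteq> \<zero>} \<subseteq>
          (\<lambda>(u, v). u @ v) ` ({u. a u \<noteq> \<zero>} \<times> {v. b v \<noteq> \<zero>})"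
      proof
        fix w assume w: "w \<in> {w. a (take i w) \<otimes> b (drop i w) \<noteq> \<zero>}"
        then have "a (take i w) \<noteq> \<zero>" "b (drop i w) \<noteq> \<zero>" using A(1) B(1) by auto
        then show "w \<in> (\<lambda>(u, v). u @ v) ` ({u. a u \<noteq> \<zero>} \<times> {v. b v \<noteq> \<zero>})"
          by (intro image_eqI[of _ _ "(take i w, drop i w)"]) auto
      qed
    qed (use A(3) B(3) in auto)
  qed (use A(1) B(1) in auto)
qed (simp_all add: free_module_simps fun_eq_iff l_distr r_distr m_assoc m_lcomm free_moduleD(1))

lemma conc_unit_vec:
  assumes "length us = i" shows "conc i (unit_vec R us) (unit_vec R vs) = unit_vec R (us @ vs)"
proof
  fix w
  have "take i w = us \<and> drop i w = vs \<longleftrightarrow> w = us @ vs"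
    using assms append_eq_conv_conj[of us vs w] by metis
  then show "conc i (unit_vec R us) (unit_vec R vs) w = unit_vec R (us @ vs) w"
    by (auto simp: unit_vec_def)
qed

text \<open>Concatenation with a word only lengthens the context of a relator, on the right in one
  case and on the left in the other, and yields a relator again. This is the reason the tensor
  product descends to cosets.\<close>

lemma multilinear_relators_mult:
  assumes x: "x \<in> multilinear_relators R M i" and ws: "ws \<in> tensor_words M j"
  shows "conc i x (unit_vec R ws) \<in> N (i + j)" and "conc j (unit_vec R ws) x \<in> N (j + i)"
proof -
  interpret Fi: module R "F i" by (rule F_module)
  interpret Fij: module R "F (i + j)" by (rule F_module)
  interpret Fji: module R "F (j + i)" by (rule F_module)
  interpret p1: module_pair R "F i" "F (i + j)" ..
  interpret p2: module_pair R "F i" "F (j + i)" ..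
  have l1: "lin R (F i) (F (i + j)) (\<lambda>a. conc i a (unit_vec R ws))"
    by (rule bilin_left[OF conc_bilin unit_vec_F[OF ws]])
  have l2: "lin R (F i) (F (j + i)) (\<lambda>a. conc j (unit_vec R ws) a)"
    by (rule bilin_right[OF conc_bilin unit_vec_F[OF ws]])
  have lw: "length ws = j" "set ws \<subseteq> carrier M" using ws by (auto simp: tensor_words_iff)
  have "conc i x (unit_vec R ws) \<in> multilinear_relators R M (i + j) \<and>
      conc j (unit_vec R ws) x \<in> multilinear_relators R M (j + i)"
  proof -
    from x consider us vs y z where "x = unit_vec R (us @ [y \<oplus>\<^bsub>M\<^esub> z] @ vs) \<ominus>\<^bsub>F i\<^esub>
          (unit_vec R (us @ [y] @ vs) \<oplus>\<^bsub>F i\<^esub> unit_vec R (us @ [z] @ vs))"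
        "y \<in> carrier M" "z \<in> carrier M" "set us \<union> set vs \<subseteq> carrier M" "length us + 1 + length vs = i"
      | us vs a y where "x = unit_vec R (us @ [a \<odot>\<^bsub>M\<^esub> y] @ vs) \<ominus>\<^bsub>F i\<^esub> a \<odot>\<^bsub>F i\<^esub> unit_vec R (us @ [y] @ vs)"
        "a \<in> carrier R" "y \<in> carrier M" "set us \<union> set vs \<subseteq> carrier M" "length us + 1 + length vs = i"
      unfolding multilinear_relators_def Let_def by blast
    then show ?thesis
    proof cases
      case 1
      have e: "unit_vec R (us @ b # vs) \<in> carrier (F i)" if "b \<in> carrier M" for b
        using 1 that by (intro unit_vec_F) (auto simp: tensor_words_iff)
      have c1: "conc i (unit_vec R (us @ b # vs)) (unit_vec R ws) = unit_vec R (us @ b # vs @ ws)"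
        and c2: "conc j (unit_vec R ws) (unit_vec R (us @ b # vs)) = unit_vec R (ws @ us @ b # vs)" for b
        using 1(5) lw by (simp_all add: conc_unit_vec)
      have "conc i x (unit_vec R ws) = unit_vec R (us @ [y \<oplus>\<^bsub>M\<^esub> z] @ (vs @ ws)) \<ominus>\<^bsub>F (i + j)\<^esub>
          (unit_vec R (us @ [y] @ (vs @ ws)) \<oplus>\<^bsub>F (i + j)\<^esub> unit_vec R (us @ [z] @ (vs @ ws)))"
        using 1(1-3) e by (simp add: p1.lin_minus[OF l1] lin_add[OF l1] c1)
      moreover have "conc j (unit_vec R ws) x = unit_vec R ((ws @ us) @ [y \<oplus>\<^bsub>M\<^esub> z] @ vs) \<ominus>\<^bsub>F (j + i)\<^esub>
          (unit_vec R ((ws @ us) @ [y] @ vs) \<oplus>\<^bsub>F (j + i)\<^esub> unit_vec R ((ws @ us) @ [z] @ vs))"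
        using 1(1-3) e by (simp add: p2.lin_minus[OF l2] lin_add[OF l2] c2)
      moreover have "set us \<union> set (vs @ ws) \<subseteq> carrier M" "length us + 1 + length (vs @ ws) = i + j"
        "set (ws @ us) \<union> set vs \<subseteq> carrier M" "length (ws @ us) + 1 + length vs = j + i"
        using 1 lw by auto
      ultimately show ?thesis using 1(2,3) unfolding multilinear_relators_def Let_def by blast
    next
      case 2
      have e: "unit_vec R (us @ b # vs) \<in> carrier (F i)" if "b \<in> carrier M" for b
        using 2 that by (intro unit_vec_F) (auto simp: tensor_words_iff)
      have c1: "conc i (unit_vec R (us @ b # vs)) (unit_vec R ws) = unit_vec R (us @ b # vs @ ws)"
        and c2: "conc j (unit_vec R ws) (unit_vec R (us @ b # vs)) = unit_vec R (ws @ us @ b # vs)" for b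
        using 2(5) lw by (simp_all add: conc_unit_vec)
      have "conc i x (unit_vec R ws) = unit_vec R (us @ [a \<odot>\<^bsub>M\<^esub> y] @ (vs @ ws)) \<ominus>\<^bsub>F (i + j)\<^esub>
          a \<odot>\<^bsub>F (i + j)\<^esub> unit_vec R (us @ [y] @ (vs @ ws))"
        using 2(1-3) e by (simp add: p1.lin_minus[OF l1] lin_smult[OF l1] c1)
      moreover have "conc j (unit_vec R ws) x = unit_vec R ((ws @ us) @ [a \<odot>\<^bsub>M\<^esub> y] @ vs) \<ominus>\<^bsub>F (j + i)\<^esub>
          a \<odot>\<^bsub>F (j + i)\<^esub> unit_vec R ((ws @ us) @ [y] @ vs)"
        using 2(1-3) e by (simp add: p2.lin_minus[OF l2] lin_smult[OF l2] c2)
      moreover have "set us \<union> set (vs @ ws) \<subseteq> carrier M" "length us + 1 + length (vs @ ws) = i + j"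
        "set (ws @ us) \<union> set vs \<subseteq> carrier M" "length (ws @ us) + 1 + length vs = j + i"
        using 2 lw by auto
      ultimately show ?thesis using 2(2,3) unfolding multilinear_relators_def Let_def by blast
    qed
  qed
  then show "conc i x (unit_vec R ws) \<in> N (i + j)" "conc j (unit_vec R ws) x \<in> N (j + i)"
    unfolding multilinear_submodule_def
    using Fij.module_span_superset[of "multilinear_relators R M (i + j)"]
      Fji.module_span_superset[of "multilinear_relators R M (j + i)"] by blast+
qed

lemma N_mult:
  shows "\<lbrakk>a \<in> N i; b \<in> carrier (F j)\<rbrakk> \<Longrightarrow> conc i a b \<in> N (i + j)"
    and "\<lbrakk>a \<in> carrier (F i); b \<in> N j\<rbrakk> \<Longrightarrow> conc i a b \<in> N (i + j)"
proof -
  have sp: "carrier (F n) = module_span R (F n) (unit_vec R ` tensor_words M n)" for n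
    by (simp add: free_module_span)
  have u: "unit_vec R ` tensor_words M n \<subseteq> carrier (F n)" for n using unit_vec_F by auto
  show "conc i a b \<in> N (i + j)" if "a \<in> N i" "b \<in> carrier (F j)"
    by (rule bilin_span_subset[OF F_module F_module F_module conc_bilin N_submodule
          multilinear_relators_closed u]) (use that sp multilinear_relators_mult(1) in \<open>auto simp: multilinear_submodule_def\<close>)
  show "conc i a b \<in> N (i + j)" if "a \<in> carrier (F i)" "b \<in> N j"
    by (rule bilin_span_subset[OF F_module F_module F_module conc_bilin N_submodule
          u multilinear_relators_closed]) (use that sp multilinear_relators_mult(2) in \<open>auto simp: multilinear_submodule_def\<close>)
qed

text \<open>Representatives are exchanged one factor at a time; by bilinearity each difference is a
  product with one factor in the relator submodule, which \<open>N_mult\<close> absorbs.\<close>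

lemma tensor_mult_coset:
  assumes a: "a \<in> carrier (F i)" and b: "b \<in> carrier (F j)"
  shows "tensor_mult R M i j (N i +>\<^bsub>F i\<^esub> a) (N j +>\<^bsub>F j\<^esub> b) = N (i + j) +>\<^bsub>F (i + j)\<^esub> conc i a b"
proof -
  interpret Fi: module R "F i" by (rule F_module)
  interpret Fj: module R "F j" by (rule F_module)
  interpret Fij: module R "F (i + j)" by (rule F_module)
  interpret p1: module_pair R "F i" "F (i + j)" ..
  interpret p2: module_pair R "F j" "F (i + j)" ..
  have eq: "N (i + j) +>\<^bsub>F (i + j)\<^esub> conc i a' b' = N (i + j) +>\<^bsub>F (i + j)\<^esub> conc i a b"
    if a': "a' \<in> N i +>\<^bsub>F i\<^esub> a" and b': "b' \<in> N j +>\<^bsub>F j\<^esub> b" for a' b'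
  proof -
    have A: "a' \<in> carrier (F i)" "a' \<ominus>\<^bsub>F i\<^esub> a \<in> N i" using a' Fi.coset_mem_iff[OF N_submodule a] by auto
    have B: "b' \<in> carrier (F j)" "b' \<ominus>\<^bsub>F j\<^esub> b \<in> N j" using b' Fj.coset_mem_iff[OF N_submodule b] by auto
    have c: "conc i x y \<in> carrier (F (i + j))" if "x \<in> carrier (F i)" "y \<in> carrier (F j)" for x y
      using bilin_closed[OF conc_bilin that] .
    have "conc i a' b' \<ominus>\<^bsub>F (i + j)\<^esub> conc i a b' = conc i (a' \<ominus>\<^bsub>F i\<^esub> a) b'"
      by (rule p1.lin_minus[OF bilin_left[OF conc_bilin B(1)] A(1) a, symmetric])
    then have "N (i + j) +>\<^bsub>F (i + j)\<^esub> conc i a' b' = N (i + j) +>\<^bsub>F (i + j)\<^esub> conc i a b'"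
      using N_mult(1)[OF A(2) B(1)] Fij.coset_eq_iff[OF N_submodule c[OF A(1) B(1)] c[OF a B(1)]] by simp
    moreover have "conc i a b' \<ominus>\<^bsub>F (i + j)\<^esub> conc i a b = conc i a (b' \<ominus>\<^bsub>F j\<^esub> b)"
      by (rule p2.lin_minus[OF bilin_right[OF conc_bilin a] B(1) b, symmetric])
    then have "N (i + j) +>\<^bsub>F (i + j)\<^esub> conc i a b' = N (i + j) +>\<^bsub>F (i + j)\<^esub> conc i a b"
      using N_mult(2)[OF a B(2)] Fij.coset_eq_iff[OF N_submodule c[OF a B(1)] c[OF a b]] by simp
    ultimately show ?thesis by simp
  qed
  have "a \<in> N i +>\<^bsub>F i\<^esub> a" "b \<in> N j +>\<^bsub>F j\<^esub> b"
    using Fi.coset_mem_iff[OF N_submodule a] Fj.coset_mem_iff[OF N_submodule b] a b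
      Fi.submodule_zero_closed[OF N_submodule] Fj.submodule_zero_closed[OF N_submodule]
      Fi.minus_eq_zero_iff[OF a a] Fj.minus_eq_zero_iff[OF b b] by simp_all
  then show ?thesis unfolding tensor_mult_def using eq by blast
qed

lemma tensor_mult_bilin: "bilin R (T i) (T j) (T (i + j)) (tensor_mult R M i j)"
proof -
  have l: "lin R (F i) (T (i + j)) (\<lambda>a. N (i + j) +>\<^bsub>F (i + j)\<^esub> conc i a b)" if "b \<in> carrier (F j)" for b
    by (rule lin_compose[OF bilin_left[OF conc_bilin that] lin_F_T])
  have r: "lin R (F j) (T (i + j)) (\<lambda>b. N (i + j) +>\<^bsub>F (i + j)\<^esub> conc i a b)" if "a \<in> carrier (F i)" for a
    by (rule lin_compose[OF bilin_right[OF conc_bilin that] lin_F_T])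
  have cT: "x \<in> carrier (T n) \<longleftrightarrow> (\<exists>a\<in>carrier (F n). x = N n +>\<^bsub>F n\<^esub> a)" for x n
    by (auto simp: tensor_power_def carrier_quot)
  have ad: "(N n +>\<^bsub>F n\<^esub> a) \<oplus>\<^bsub>T n\<^esub> (N n +>\<^bsub>F n\<^esub> b) = N n +>\<^bsub>F n\<^esub> (a \<oplus>\<^bsub>F n\<^esub> b)"
    if "a \<in> carrier (F n)" "b \<in> carrier (F n)" for a b n
    using lin_add[OF lin_F_T that] by simp
  have sm: "c \<odot>\<^bsub>T n\<^esub> (N n +>\<^bsub>F n\<^esub> a) = N n +>\<^bsub>F n\<^esub> (c \<odot>\<^bsub>F n\<^esub> a)"
    if "c \<in> carrier R" "a \<in> carrier (F n)" for a c n
    using lin_smult[OF lin_F_T that] by simp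
  interpret Fi: module R "F i" by (rule F_module)
  interpret Fj: module R "F j" by (rule F_module)
  have fa: "a \<oplus>\<^bsub>F i\<^esub> a' \<in> carrier (F i)" if "a \<in> carrier (F i)" "a' \<in> carrier (F i)" for a a'
    using that by (rule Fi.M.a_closed)
  have fb: "a \<oplus>\<^bsub>F j\<^esub> a' \<in> carrier (F j)" if "a \<in> carrier (F j)" "a' \<in> carrier (F j)" for a a'
    using that by (rule Fj.M.a_closed)
  show ?thesis
  proof (rule bilinI; unfold cT; (elim bexE)?)
    show "\<exists>c\<in>carrier (F (i + j)). tensor_mult R M i j a b = N (i + j) +>\<^bsub>F (i + j)\<^esub> c"
      if "x \<in> carrier (F i)" "a = N i +>\<^bsub>F i\<^esub> x" "y \<in> carrier (F j)" "b = N j +>\<^bsub>F j\<^esub> y" for a b x y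
      using that tensor_mult_coset bilin_closed[OF conc_bilin] by blast
  next
    fix a a' b x x' y assume h: "x \<in> carrier (F i)" "a = N i +>\<^bsub>F i\<^esub> x" "x' \<in> carrier (F i)" "a' = N i +>\<^bsub>F i\<^esub> x'"
      "y \<in> carrier (F j)" "b = N j +>\<^bsub>F j\<^esub> y"
    then show "tensor_mult R M i j (a \<oplus>\<^bsub>T i\<^esub> a') b
        = tensor_mult R M i j a b \<oplus>\<^bsub>T (i + j)\<^esub> tensor_mult R M i j a' b"
      using lin_add[OF l[OF h(5)] h(1,3)] by (simp add: ad tensor_mult_coset fa)
  next
    fix a b b' x y y' assume h: "x \<in> carrier (F i)" "a = N i +>\<^bsub>F i\<^esub> x" "y \<in> carrier (F j)" "b = N j +>\<^bsub>F j\<^esub> y"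
      "y' \<in> carrier (F j)" "b' = N j +>\<^bsub>F j\<^esub> y'"
    then show "tensor_mult R M i j a (b \<oplus>\<^bsub>T j\<^esub> b')
        = tensor_mult R M i j a b \<oplus>\<^bsub>T (i + j)\<^esub> tensor_mult R M i j a b'"
      using lin_add[OF r[OF h(1)] h(3,5)] by (simp add: ad tensor_mult_coset fb)
  next
    fix c a b x y assume h: "c \<in> carrier R" "x \<in> carrier (F i)" "a = N i +>\<^bsub>F i\<^esub> x" "y \<in> carrier (F j)" "b = N j +>\<^bsub>F j\<^esub> y"
    show "tensor_mult R M i j (c \<odot>\<^bsub>T i\<^esub> a) b = c \<odot>\<^bsub>T (i + j)\<^esub> tensor_mult R M i j a b"
      using h lin_smult[OF l[OF h(4)] h(1,2)] Fi.smult_closed[OF h(1,2)] by (simp add: sm tensor_mult_coset)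
    show "tensor_mult R M i j a (c \<odot>\<^bsub>T j\<^esub> b) = c \<odot>\<^bsub>T (i + j)\<^esub> tensor_mult R M i j a b"
      using h lin_smult[OF r[OF h(2)] h(1,4)] Fj.smult_closed[OF h(1,4)] by (simp add: sm tensor_mult_coset)
  qed
qed

lemma tensor_mult_pure:
  assumes "us \<in> tensor_words M i" "vs \<in> tensor_words M j"
  shows "tensor_mult R M i j (pt us) (pt vs) = pt (us @ vs)"
  using assms tensor_mult_coset[OF unit_vec_F unit_vec_F, of us i vs j]
  by (simp add: pure_tensor_eq[of us i] pure_tensor_eq[of vs j] pure_tensor_eq[of "us @ vs" "i + j"]
      tensor_words_iff conc_unit_vec)

end

section \<open>Product, monomials and universal property of the tensor algebra\<close>

context module
begin

lemma TA_simps: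
  "f \<in> carrier TA \<longleftrightarrow> (\<forall>i. f i \<in> carrier (T i)) \<and> finite {i. f i \<noteq> \<zero>\<^bsub>T i\<^esub>}"
  "f \<otimes>\<^bsub>TA\<^esub> g = (\<lambda>n. \<Oplus>\<^bsub>T n\<^esub>i\<in>{..n}. tensor_mult R M i (n - i) (f i) (g (n - i)))"
  "\<zero>\<^bsub>TA\<^esub> = (\<lambda>i. \<zero>\<^bsub>T i\<^esub>)"
  "f \<oplus>\<^bsub>TA\<^esub> g = (\<lambda>i. f i \<oplus>\<^bsub>T i\<^esub> g i)"
  "a \<odot>\<^bsub>TA\<^esub> f = (\<lambda>i. a \<odot>\<^bsub>T i\<^esub> f i)"
  by (auto simp: tensor_algebra_def)

lemma TA_module: "module R TA"
proof -
  interpret T: module R "T n" for n by (rule T_module)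
  have add: "f \<oplus>\<^bsub>TA\<^esub> g \<in> carrier TA" if "f \<in> carrier TA" "g \<in> carrier TA" for f g
  proof -
    have "finite {i. f i \<oplus>\<^bsub>T i\<^esub> g i \<noteq> \<zero>\<^bsub>T i\<^esub>}"
      by (rule finite_subset[of _ "{i. f i \<noteq> \<zero>\<^bsub>T i\<^esub>} \<union> {i. g i \<noteq> \<zero>\<^bsub>T i\<^esub>}"])
        (use that in \<open>auto simp: TA_simps\<close>)
    then show ?thesis using that by (simp add: TA_simps)
  qed
  have smult: "a \<odot>\<^bsub>TA\<^esub> f \<in> carrier TA" if "a \<in> carrier R" "f \<in> carrier TA" for a f
  proof -
    have "finite {i. a \<odot>\<^bsub>T i\<^esub> f i \<noteq> \<zero>\<^bsub>T i\<^esub>}"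
      by (rule finite_subset[of _ "{i. f i \<noteq> \<zero>\<^bsub>T i\<^esub>}"]) (use that in \<open>auto simp: TA_simps\<close>)
    then show ?thesis using that by (simp add: TA_simps)
  qed
  have inv: "\<exists>g\<in>carrier TA. g \<oplus>\<^bsub>TA\<^esub> f = \<zero>\<^bsub>TA\<^esub>" if f: "f \<in> carrier TA" for f
  proof (rule bexI[of _ "(\<ominus> \<one>) \<odot>\<^bsub>TA\<^esub> f"])
    show "(\<ominus> \<one>) \<odot>\<^bsub>TA\<^esub> f \<in> carrier TA" using smult f by simp
    show "(\<ominus> \<one>) \<odot>\<^bsub>TA\<^esub> f \<oplus>\<^bsub>TA\<^esub> f = \<zero>\<^bsub>TA\<^esub>"
      using f by (simp add: TA_simps T.smult_l_minus T.M.l_neg)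
  qed
  show ?thesis
  proof (rule moduleI[OF is_cring])
    show "abelian_group TA"
      by (rule abelian_groupI) (use add inv in \<open>simp_all add: TA_simps T.M.a_ac\<close>)
  qed (use smult in \<open>simp_all add: TA_simps T.smult_l_distr T.smult_r_distr T.smult_assoc1\<close>)
qed

lemma tensor_mult_zero:
  "y \<in> carrier (T j) \<Longrightarrow> tensor_mult R M i j \<zero>\<^bsub>T i\<^esub> y = \<zero>\<^bsub>T (i + j)\<^esub>"
  "x \<in> carrier (T i) \<Longrightarrow> tensor_mult R M i j x \<zero>\<^bsub>T j\<^esub> = \<zero>\<^bsub>T (i + j)\<^esub>"
proof -
  interpret p: module_pair R "T i" "T (i + j)" by (intro module_pair.intro T_module)
  interpret q: module_pair R "T j" "T (i + j)" by (intro module_pair.intro T_module)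
  show "y \<in> carrier (T j) \<Longrightarrow> tensor_mult R M i j \<zero>\<^bsub>T i\<^esub> y = \<zero>\<^bsub>T (i + j)\<^esub>"
    by (rule p.lin_zero[OF bilin_left[OF tensor_mult_bilin]])
  show "x \<in> carrier (T i) \<Longrightarrow> tensor_mult R M i j x \<zero>\<^bsub>T j\<^esub> = \<zero>\<^bsub>T (i + j)\<^esub>"
    by (rule q.lin_zero[OF bilin_right[OF tensor_mult_bilin]])
qed

lemma TA_mult_term:
  assumes "f \<in> carrier TA" "g \<in> carrier TA" "i \<le> n"
  shows "tensor_mult R M i (n - i) (f i) (g (n - i)) \<in> carrier (T n)"
  using bilin_closed[OF tensor_mult_bilin, of "f i" i "g (n - i)" "n - i"] assms by (simp add: TA_simps(1))

lemma TA_algebra: "nonassoc_algebra R TA"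
proof -
  interpret TA: module R TA by (rule TA_module)
  interpret T: module R "T n" for n by (rule T_module)
  have "bilin R TA TA TA (\<lambda>f g. f \<otimes>\<^bsub>TA\<^esub> g)"
  proof (rule bilinI)
    fix f g assume f: "f \<in> carrier TA" and g: "g \<in> carrier TA"
    note t = TA_mult_term[OF f g]
    \<comment> \<open>Strict bounds for the supports of \<open>f\<close> and \<open>g\<close>. In
      degree at least \<open>p + q\<close> no splitting stays below both bounds, so the product has
      finite support.\<close>
    obtain p q where p: "\<And>i. f i \<noteq> \<zero>\<^bsub>T i\<^esub> \<Longrightarrow> i < p" and q: "\<And>i. g i \<noteq> \<zero>\<^bsub>T i\<^esub> \<Longrightarrow> i < q"
      using f g unfolding TA_simps(1) finite_nat_set_iff_bounded by auto
    have "(f \<otimes>\<^bsub>TA\<^esub> g) n = \<zero>\<^bsub>T n\<^esub>" if n: "n \<ge> p + q" for n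
    proof -
      have "tensor_mult R M i (n - i) (f i) (g (n - i)) = \<zero>\<^bsub>T n\<^esub>" if i: "i \<in> {..n}" for i
      proof -
        have "f i = \<zero>\<^bsub>T i\<^esub> \<or> g (n - i) = \<zero>\<^bsub>T (n - i)\<^esub>" using p[of i] q[of "n - i"] n i by fastforce
        then show ?thesis
          using tensor_mult_zero(1)[of "g (n - i)" "n - i" i] tensor_mult_zero(2)[of "f i" i "n - i"] f g i
          by (auto simp: TA_simps(1))
      qed
      then show ?thesis unfolding TA_simps(2) by (subst T.M.finsum_cong'[OF refl]) auto
    qed
    then have "{n. (f \<otimes>\<^bsub>TA\<^esub> g) n \<noteq> \<zero>\<^bsub>T n\<^esub>} \<subseteq> {..<p + q}" by (auto simp: not_less[symmetric])
    then have "finite {n. (f \<otimes>\<^bsub>TA\<^esub> g) n \<noteq> \<zero>\<^bsub>T n\<^esub>}" by (rule finite_subset) simp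
    moreover have "(f \<otimes>\<^bsub>TA\<^esub> g) n \<in> carrier (T n)" for n
      unfolding TA_simps(2) using t by (intro T.M.finsum_closed) auto
    ultimately show "f \<otimes>\<^bsub>TA\<^esub> g \<in> carrier TA" unfolding TA_simps(1) by blast
  next
    fix f f' g assume h: "f \<in> carrier TA" "f' \<in> carrier TA" "g \<in> carrier TA"
    show "(f \<oplus>\<^bsub>TA\<^esub> f') \<otimes>\<^bsub>TA\<^esub> g = f \<otimes>\<^bsub>TA\<^esub> g \<oplus>\<^bsub>TA\<^esub> f' \<otimes>\<^bsub>TA\<^esub> g"
    proof
      fix n
      have "((f \<oplus>\<^bsub>TA\<^esub> f') \<otimes>\<^bsub>TA\<^esub> g) n = (\<Oplus>\<^bsub>T n\<^esub>i\<in>{..n}. tensor_mult R M i (n - i) (f i) (g (n - i))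
          \<oplus>\<^bsub>T n\<^esub> tensor_mult R M i (n - i) (f' i) (g (n - i)))"
        unfolding TA_simps(2)
      proof (rule T.M.finsum_cong'[OF refl])
        fix i assume i: "i \<in> {..n}"
        have "lin R (T i) (T (i + (n - i))) (\<lambda>x. tensor_mult R M i (n - i) x (g (n - i)))"
          using h by (intro bilin_left[OF tensor_mult_bilin]) (simp add: TA_simps(1))
        from lin_add[OF this, of "f i" "f' i"]
        show "tensor_mult R M i (n - i) ((f \<oplus>\<^bsub>TA\<^esub> f') i) (g (n - i)) = tensor_mult R M i (n - i) (f i) (g (n - i))
          \<oplus>\<^bsub>T n\<^esub> tensor_mult R M i (n - i) (f' i) (g (n - i))"
          using h i by (simp add: TA_simps(1,4))
      qed (use h TA_mult_term in auto)
      also have "\<dots> = (f \<otimes>\<^bsub>TA\<^esub> g \<oplus>\<^bsub>TA\<^esub> f' \<otimes>\<^bsub>TA\<^esub> g) n"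
        unfolding TA_simps(2,4) using h TA_mult_term by (intro T.M.finsum_addf) auto
      finally show "((f \<oplus>\<^bsub>TA\<^esub> f') \<otimes>\<^bsub>TA\<^esub> g) n = (f \<otimes>\<^bsub>TA\<^esub> g \<oplus>\<^bsub>TA\<^esub> f' \<otimes>\<^bsub>TA\<^esub> g) n" .
    qed
  next
    fix g f f' assume h: "g \<in> carrier TA" "f \<in> carrier TA" "f' \<in> carrier TA"
    show "g \<otimes>\<^bsub>TA\<^esub> (f \<oplus>\<^bsub>TA\<^esub> f') = g \<otimes>\<^bsub>TA\<^esub> f \<oplus>\<^bsub>TA\<^esub> g \<otimes>\<^bsub>TA\<^esub> f'"
    proof
      fix n
      have "(g \<otimes>\<^bsub>TA\<^esub> (f \<oplus>\<^bsub>TA\<^esub> f')) n = (\<Oplus>\<^bsub>T n\<^esub>i\<in>{..n}. tensor_mult R M i (n - i) (g i) (f (n - i))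
          \<oplus>\<^bsub>T n\<^esub> tensor_mult R M i (n - i) (g i) (f' (n - i)))"
        unfolding TA_simps(2)
      proof (rule T.M.finsum_cong'[OF refl])
        fix i assume i: "i \<in> {..n}"
        have "lin R (T (n - i)) (T (i + (n - i))) (tensor_mult R M i (n - i) (g i))"
          using h by (intro bilin_right[OF tensor_mult_bilin]) (simp add: TA_simps(1))
        from lin_add[OF this, of "f (n - i)" "f' (n - i)"]
        show "tensor_mult R M i (n - i) (g i) ((f \<oplus>\<^bsub>TA\<^esub> f') (n - i)) = tensor_mult R M i (n - i) (g i) (f (n - i))
          \<oplus>\<^bsub>T n\<^esub> tensor_mult R M i (n - i) (g i) (f' (n - i))"
          using h i by (simp add: TA_simps(1,4))
      qed (use h TA_mult_term in auto)
      also have "\<dots> = (g \<otimes>\<^bsub>TA\<^esub> f \<oplus>\<^bsub>TA\<^esub> g \<otimes>\<^bsub>TA\<^esub> f') n"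
        unfolding TA_simps(2,4) using h TA_mult_term by (intro T.M.finsum_addf) auto
      finally show "(g \<otimes>\<^bsub>TA\<^esub> (f \<oplus>\<^bsub>TA\<^esub> f')) n = (g \<otimes>\<^bsub>TA\<^esub> f \<oplus>\<^bsub>TA\<^esub> g \<otimes>\<^bsub>TA\<^esub> f') n" .
    qed
  next
    fix a f g assume h: "a \<in> carrier R" "f \<in> carrier TA" "g \<in> carrier TA"
    have fin: "a \<odot>\<^bsub>T n\<^esub> (f \<otimes>\<^bsub>TA\<^esub> g) n
        = (\<Oplus>\<^bsub>T n\<^esub>i\<in>{..n}. a \<odot>\<^bsub>T n\<^esub> tensor_mult R M i (n - i) (f i) (g (n - i)))" for n
      unfolding TA_simps(2) using h TA_mult_term[OF h(2,3)] by (intro T.finsum_smult_ldistr) auto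
    show "(a \<odot>\<^bsub>TA\<^esub> f) \<otimes>\<^bsub>TA\<^esub> g = a \<odot>\<^bsub>TA\<^esub> (f \<otimes>\<^bsub>TA\<^esub> g)"
    proof
      fix n
      have "((a \<odot>\<^bsub>TA\<^esub> f) \<otimes>\<^bsub>TA\<^esub> g) n = a \<odot>\<^bsub>T n\<^esub> (f \<otimes>\<^bsub>TA\<^esub> g) n"
        unfolding fin unfolding TA_simps(2)
      proof (rule T.M.finsum_cong'[OF refl])
        fix i assume i: "i \<in> {..n}"
        have "lin R (T i) (T (i + (n - i))) (\<lambda>x. tensor_mult R M i (n - i) x (g (n - i)))"
          using h by (intro bilin_left[OF tensor_mult_bilin]) (simp add: TA_simps(1))
        from lin_smult[OF this h(1), of "f i"]
        show "tensor_mult R M i (n - i) ((a \<odot>\<^bsub>TA\<^esub> f) i) (g (n - i))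
            = a \<odot>\<^bsub>T n\<^esub> tensor_mult R M i (n - i) (f i) (g (n - i))"
          using h i by (simp add: TA_simps(1,5))
      qed (use h TA_mult_term in auto)
      then show "((a \<odot>\<^bsub>TA\<^esub> f) \<otimes>\<^bsub>TA\<^esub> g) n = (a \<odot>\<^bsub>TA\<^esub> (f \<otimes>\<^bsub>TA\<^esub> g)) n" by (simp add: TA_simps(5))
    qed
    show "f \<otimes>\<^bsub>TA\<^esub> (a \<odot>\<^bsub>TA\<^esub> g) = a \<odot>\<^bsub>TA\<^esub> (f \<otimes>\<^bsub>TA\<^esub> g)"
    proof
      fix n
      have "(f \<otimes>\<^bsub>TA\<^esub> (a \<odot>\<^bsub>TA\<^esub> g)) n = a \<odot>\<^bsub>T n\<^esub> (f \<otimes>\<^bsub>TA\<^esub> g) n"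
        unfolding fin unfolding TA_simps(2)
      proof (rule T.M.finsum_cong'[OF refl])
        fix i assume i: "i \<in> {..n}"
        have "lin R (T (n - i)) (T (i + (n - i))) (tensor_mult R M i (n - i) (f i))"
          using h by (intro bilin_right[OF tensor_mult_bilin]) (simp add: TA_simps(1))
        from lin_smult[OF this h(1), of "g (n - i)"]
        show "tensor_mult R M i (n - i) (f i) ((a \<odot>\<^bsub>TA\<^esub> g) (n - i))
            = a \<odot>\<^bsub>T n\<^esub> tensor_mult R M i (n - i) (f i) (g (n - i))"
          using h i by (simp add: TA_simps(1,5))
      qed (use h TA_mult_term in auto)
      then show "(f \<otimes>\<^bsub>TA\<^esub> (a \<odot>\<^bsub>TA\<^esub> g)) n = (a \<odot>\<^bsub>TA\<^esub> (f \<otimes>\<^bsub>TA\<^esub> g)) n" by (simp add: TA_simps(5))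
    qed
  qed
  then have "lin R TA TA (\<lambda>f. f \<otimes>\<^bsub>TA\<^esub> g)" "lin R TA TA (\<lambda>f. g \<otimes>\<^bsub>TA\<^esub> f)" if "g \<in> carrier TA" for g
    using that by (auto simp: bilin_def)
  then show ?thesis
    by unfold_locales (simp_all add: lin_def Pi_iff)
qed

lemma lin_tensor_incl: "lin R (T n) TA (tensor_incl R M n)"
proof (rule linI)
  interpret T: module R "T n" for n by (rule T_module)
  fix x assume x: "x \<in> carrier (T n)"
  have "finite {i. tensor_incl R M n x i \<noteq> \<zero>\<^bsub>T i\<^esub>}"
    by (rule finite_subset[of _ "{n}"]) (auto simp: tensor_incl_def)
  then show "tensor_incl R M n x \<in> carrier TA" using x by (auto simp: TA_simps tensor_incl_def)
  show "tensor_incl R M n (x \<oplus>\<^bsub>T n\<^esub> y) = tensor_incl R M n x \<oplus>\<^bsub>TA\<^esub> tensor_incl R M n y"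
    if "y \<in> carrier (T n)" for y
    using x that by (simp add: TA_simps tensor_incl_def fun_eq_iff)
  show "tensor_incl R M n (a \<odot>\<^bsub>T n\<^esub> x) = a \<odot>\<^bsub>TA\<^esub> tensor_incl R M n x" if "a \<in> carrier R" for a
    using x that by (simp add: TA_simps tensor_incl_def fun_eq_iff)
qed

lemma tensor_incl_mult:
  assumes x: "x \<in> carrier (T i)" and y: "y \<in> carrier (T j)"
  shows "tensor_incl R M i x \<otimes>\<^bsub>TA\<^esub> tensor_incl R M j y = tensor_incl R M (i + j) (tensor_mult R M i j x y)"
proof
  interpret T: module R "T n" for n by (rule T_module)
  fix n
  have c: "tensor_mult R M i j x y \<in> carrier (T (i + j))" using bilin_closed[OF tensor_mult_bilin x y] .
  \<comment> \<open>Only \<open>k = i\<close> can contribute, and only if \<open>n = i + j\<close>.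
    Writing the value through \<open>tensor_incl\<close> at \<open>n\<close> makes it zero in all
    other degrees.\<close>
  have z: "tensor_mult R M k (n - k) (tensor_incl R M i x k) (tensor_incl R M j y (n - k))
      = (if i = k then tensor_incl R M (i + j) (tensor_mult R M i j x y) n else \<zero>\<^bsub>T n\<^esub>)" if "k \<in> {..n}" for k
  proof (cases "k = i \<and> n - k = j")
    case True
    then show ?thesis using that by (auto simp: tensor_incl_def)
  next
    case False
    have xc: "tensor_incl R M i x k \<in> carrier (T k)" and yc: "tensor_incl R M j y (n - k) \<in> carrier (T (n - k))"
      using x y by (auto simp: tensor_incl_def)
    have n: "k + (n - k) = n" using that by simp
    have "tensor_mult R M k (n - k) (tensor_incl R M i x k) (tensor_incl R M j y (n - k)) = \<zero>\<^bsub>T n\<^esub>"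
    proof (cases "k = i")
      case True
      then have "tensor_incl R M j y (n - k) = \<zero>\<^bsub>T (n - k)\<^esub>" using False by (simp add: tensor_incl_def)
      then show ?thesis using tensor_mult_zero(2)[OF xc, of "n - k"] n by simp
    next
      case False
      then have "tensor_incl R M i x k = \<zero>\<^bsub>T k\<^esub>" by (simp add: tensor_incl_def)
      then show ?thesis using tensor_mult_zero(1)[OF yc, of k] n by simp
    qed
    moreover have "i = k \<Longrightarrow> n \<noteq> i + j" using False that by auto
    ultimately show ?thesis by (auto simp: tensor_incl_def)
  qed
  have "(tensor_incl R M i x \<otimes>\<^bsub>TA\<^esub> tensor_incl R M j y) n
     = (\<Oplus>\<^bsub>T n\<^esub>k\<in>{..n}. if i = k then tensor_incl R M (i + j) (tensor_mult R M i j x y) n else \<zero>\<^bsub>T n\<^esub>)"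
    unfolding TA_simps(2) using c by (intro T.M.finsum_cong'[OF refl _ z]) (auto simp: tensor_incl_def)
  also have "\<dots> = tensor_incl R M (i + j) (tensor_mult R M i j x y) n"
  proof (cases "i \<le> n")
    case True
    then show ?thesis using c
      by (intro T.M.finsum_singleton[of i "{..n}" "\<lambda>_. tensor_incl R M (i + j) (tensor_mult R M i j x y) n"])
        (auto simp: tensor_incl_def)
  next
    case False
    then have "(\<Oplus>\<^bsub>T n\<^esub>k\<in>{..n}. if i = k then tensor_incl R M (i + j) (tensor_mult R M i j x y) n else \<zero>\<^bsub>T n\<^esub>)
       = (\<Oplus>\<^bsub>T n\<^esub>k\<in>{..n}. \<zero>\<^bsub>T n\<^esub>)"
      by (intro T.M.finsum_cong') auto
    then show ?thesis using False by (simp add: tensor_incl_def)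
  qed
  finally show "(tensor_incl R M i x \<otimes>\<^bsub>TA\<^esub> tensor_incl R M j y) n
      = tensor_incl R M (i + j) (tensor_mult R M i j x y) n" .
qed

text \<open>The monomials of the tensor algebra. They span it and multiply by concatenation, so
  later statements are checked on them instead of on sequences of components.\<close>

definition tensor_word :: "'c list \<Rightarrow> nat \<Rightarrow> ('c list \<Rightarrow> 'a) set"
  where "tensor_word xs = tensor_incl R M (length xs) (pt xs)"

lemma tensor_word_closed: "set xs \<subseteq> carrier M \<Longrightarrow> tensor_word xs \<in> carrier TA"
  unfolding tensor_word_def
  by (rule lin_closed[OF lin_tensor_incl]) (simp add: pure_tensor_closed tensor_words_iff)

lemma tensor_word_mult:
  assumes "set us \<subseteq> carrier M" "set vs \<subseteq> carrier M"
  shows "tensor_word us \<otimes>\<^bsub>TA\<^esub> tensor_word vs = tensor_word (us @ vs)"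
proof -
  have "us \<in> tensor_words M (length us)" "vs \<in> tensor_words M (length vs)"
    using assms by (auto simp: tensor_words_iff)
  then show ?thesis unfolding tensor_word_def
    by (simp add: tensor_incl_mult pure_tensor_closed tensor_mult_pure)
qed

text \<open>The homogeneous tensors have to lie in \<open>S\<close> only in degrees where
  \<open>f\<close> is nonzero; this keeps the filtration argument within bounded degree.\<close>

lemma tensor_algebra_induct:
  assumes S: "submodule S R TA" and f: "f \<in> carrier TA"
    and gen: "\<And>n x. \<lbrakk>f n \<noteq> \<zero>\<^bsub>T n\<^esub>; x \<in> carrier (T n)\<rbrakk> \<Longrightarrow> tensor_incl R M n x \<in> S"
  shows "f \<in> S"
proof -
  interpret TA: module R TA by (rule TA_module)
  interpret T: module R "T n" for n by (rule T_module)
  \<comment> \<open>\<open>A\<close> contains the support of \<open>g\<close> and must stay inside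
    that of \<open>f\<close>, since \<open>gen\<close> speaks only about those degrees.\<close>
  have "g \<in> S" if "finite A" "{i. g i \<noteq> \<zero>\<^bsub>T i\<^esub>} \<subseteq> A" "A \<subseteq> {i. f i \<noteq> \<zero>\<^bsub>T i\<^esub>}" "g \<in> carrier TA" for A g
    using that
  proof (induction A arbitrary: g rule: finite_induct)
    case empty
    then have "g = \<zero>\<^bsub>TA\<^esub>" by (auto simp: TA_simps)
    then show ?case using TA.submodule_zero_closed[OF S] by simp
  next
    case (insert a A)
    let ?g = "\<lambda>i. if i = a then \<zero>\<^bsub>T i\<^esub> else g i"
    have gc: "\<And>i. g i \<in> carrier (T i)" using insert.prems by (simp add: TA_simps)
    have sub: "{i. ?g i \<noteq> \<zero>\<^bsub>T i\<^esub>} \<subseteq> A" using insert.prems by auto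
    then have c: "?g \<in> carrier TA" using gc finite_subset[OF sub insert.hyps(1)] by (simp add: TA_simps)
    have g: "?g \<in> S" using insert.prems sub c by (intro insert.IH) auto
    have "tensor_incl R M a (g a) \<in> S" using insert.prems gc by (intro gen) auto
    from TA.submodule_add_closed[OF S g this] have "?g \<oplus>\<^bsub>TA\<^esub> tensor_incl R M a (g a) \<in> S" .
    moreover have "?g \<oplus>\<^bsub>TA\<^esub> tensor_incl R M a (g a) = g"
      using gc by (simp add: TA_simps tensor_incl_def fun_eq_iff)
    ultimately show ?case by simp
  qed
  from this[OF _ subset_refl subset_refl f] show ?thesis using f by (simp add: TA_simps)
qed

lemma tensor_word_span: "module_span R TA (tensor_word ` lists (carrier M)) = carrier TA"
proof
  interpret TA: module R TA by (rule TA_module)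
  let ?S = "module_span R TA (tensor_word ` lists (carrier M))"
  have sub: "tensor_word ` lists (carrier M) \<subseteq> carrier TA" using tensor_word_closed by auto
  then show "?S \<subseteq> carrier TA" by (rule TA.module_span_carrier)
  note sm = TA.module_span_submodule[OF sub]
  show "carrier TA \<subseteq> ?S"
  proof
    fix f assume f: "f \<in> carrier TA"
    show "f \<in> ?S"
    proof (rule tensor_algebra_induct[OF sm f])
      fix n x assume x: "x \<in> carrier (T n)"
      interpret p: module_pair R "T n" TA by (intro module_pair.intro T_module TA_module)
      show "tensor_incl R M n x \<in> ?S"
      proof (rule p.lin_span_subset[OF lin_tensor_incl sm])
        show "x \<in> module_span R (T n) (pt ` tensor_words M n)" using x pure_tensor_span by simp
        fix y assume "y \<in> pt ` tensor_words M n"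
        then obtain xs where xs: "length xs = n" "set xs \<subseteq> carrier M" "y = pt xs" by (auto simp: tensor_words_iff)
        then show "y \<in> carrier (T n)" by (auto intro!: pure_tensor_closed simp: tensor_words_iff)
        have "tensor_incl R M n y = tensor_word xs" using xs by (simp add: tensor_word_def)
        then show "tensor_incl R M n y \<in> ?S"
          using TA.module_span_superset[of "tensor_word ` lists (carrier M)"] xs(2) by (auto simp: in_lists_conv_set)
      qed
    qed
  qed
qed

text \<open>A single function on words of all lengths, linear in each slot, induces a map on every
  tensor power; the values of these maps on the components are summed over the support.\<close>

lemma tensor_algebra_lift:
  assumes P: "module R P" and f: "\<And>xs. set xs \<subseteq> carrier M \<Longrightarrow> f xs \<in> carrier P"
    and slot: "\<And>us vs. \<lbrakk>set us \<subseteq> carrier M; set vs \<subseteq> carrier M\<rbrakk> \<Longrightarrow> lin R M P (\<lambda>x. f (us @ x # vs))"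
  obtains g where "lin R TA P g" "\<And>xs. set xs \<subseteq> carrier M \<Longrightarrow> g (tensor_word xs) = f xs"
proof -
  interpret P: module R P by fact
  interpret TA: module R TA by (rule TA_module)
  interpret T: module R "T n" for n by (rule T_module)
  interpret p: module_pair R "T n" P for n ..
  have "\<exists>h. lin R (T n) P h \<and> (\<forall>xs\<in>tensor_words M n. h (pt xs) = f xs)" for n
    by (rule tensor_power_lift[OF P]) (use f slot in \<open>auto simp: tensor_words_iff\<close>)
  then obtain h where h: "\<And>n. lin R (T n) P (h n)"
    and hf: "\<And>n xs. xs \<in> tensor_words M n \<Longrightarrow> h n (pt xs) = f xs" by metis
  let ?g = "\<lambda>t. \<Oplus>\<^bsub>P\<^esub>i\<in>{i. t i \<noteq> \<zero>\<^bsub>T i\<^esub>}. h i (t i)"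
  have cl: "h i (t i) \<in> carrier P" if "t \<in> carrier TA" for t i
    using that by (intro lin_closed[OF h]) (simp add: TA_simps)
  have sup: "?g t = (\<Oplus>\<^bsub>P\<^esub>i\<in>B. h i (t i))" if "t \<in> carrier TA" "finite B" "{i. t i \<noteq> \<zero>\<^bsub>T i\<^esub>} \<subseteq> B" for t B
    by (rule P.M.add.finprod_mono_neutral_cong_left) (use that cl p.lin_zero[OF h] in auto)
  show ?thesis
  proof
    show "lin R TA P ?g"
    proof (rule linI)
      show "?g t \<in> carrier P" if "t \<in> carrier TA" for t using cl that by (intro P.M.finsum_closed) auto
    next
      fix s t assume st: "s \<in> carrier TA" "t \<in> carrier TA"
      let ?B = "{i. s i \<noteq> \<zero>\<^bsub>T i\<^esub>} \<union> {i. t i \<noteq> \<zero>\<^bsub>T i\<^esub>}"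
      have B: "finite ?B" using st by (auto simp: TA_simps(1))
      have stc: "s i \<in> carrier (T i)" "t i \<in> carrier (T i)" for i using st by (auto simp: TA_simps(1))
      have "?g (s \<oplus>\<^bsub>TA\<^esub> t) = (\<Oplus>\<^bsub>P\<^esub>i\<in>?B. h i ((s \<oplus>\<^bsub>TA\<^esub> t) i))"
        by (rule sup[OF TA.M.a_closed[OF st] B]) (auto simp: TA_simps)
      also have "\<dots> = (\<Oplus>\<^bsub>P\<^esub>i\<in>?B. h i (s i) \<oplus>\<^bsub>P\<^esub> h i (t i))"
        using stc cl st by (intro P.M.finsum_cong') (auto simp: TA_simps(4) lin_add[OF h])
      also have "\<dots> = (\<Oplus>\<^bsub>P\<^esub>i\<in>?B. h i (s i)) \<oplus>\<^bsub>P\<^esub> (\<Oplus>\<^bsub>P\<^esub>i\<in>?B. h i (t i))"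
        using cl st by (intro P.M.finsum_addf) auto
      also have "\<dots> = ?g s \<oplus>\<^bsub>P\<^esub> ?g t" using sup[OF st(1) B] sup[OF st(2) B] by simp
      finally show "?g (s \<oplus>\<^bsub>TA\<^esub> t) = ?g s \<oplus>\<^bsub>P\<^esub> ?g t" .
    next
      fix a t assume a: "a \<in> carrier R" and t: "t \<in> carrier TA"
      let ?B = "{i. t i \<noteq> \<zero>\<^bsub>T i\<^esub>}"
      have B: "finite ?B" using t by (auto simp: TA_simps(1))
      have tc: "t i \<in> carrier (T i)" for i using t by (auto simp: TA_simps(1))
      have "?g (a \<odot>\<^bsub>TA\<^esub> t) = (\<Oplus>\<^bsub>P\<^esub>i\<in>?B. h i ((a \<odot>\<^bsub>TA\<^esub> t) i))"
        by (rule sup[OF TA.smult_closed[OF a t] B])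
          (simp add: TA_simps(5) subset_iff, metis T.smult_r_null a)
      also have "\<dots> = (\<Oplus>\<^bsub>P\<^esub>i\<in>?B. a \<odot>\<^bsub>P\<^esub> h i (t i))"
        using tc cl t a by (intro P.M.finsum_cong') (auto simp: TA_simps(5) lin_smult[OF h])
      also have "\<dots> = a \<odot>\<^bsub>P\<^esub> ?g t"
        using cl t a B by (intro P.finsum_smult_ldistr[symmetric]) auto
      finally show "?g (a \<odot>\<^bsub>TA\<^esub> t) = a \<odot>\<^bsub>P\<^esub> ?g t" .
    qed
    fix xs assume xs: "set xs \<subseteq> carrier M"
    have "?g (tensor_word xs) = (\<Oplus>\<^bsub>P\<^esub>i\<in>{length xs}. h i (tensor_word xs i))"
      by (rule sup[OF tensor_word_closed[OF xs]]) (auto simp: tensor_word_def tensor_incl_def)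
    also have "\<dots> = h (length xs) (pt xs)"
      using cl[OF tensor_word_closed[OF xs], of "length xs"] by (simp add: tensor_word_def tensor_incl_def)
    also have "\<dots> = f xs" using xs by (intro hf) (auto simp: tensor_words_iff)
    finally show "?g (tensor_word xs) = f xs" .
  qed
qed

end

lemma free_module_mono: "X \<subseteq> Y \<Longrightarrow> c \<in> carrier (free_module R X) \<Longrightarrow> c \<in> carrier (free_module R Y)"
  by (auto simp: free_module_def)

lemma (in module) lin_ext_cong:
  assumes "c \<in> carrier (free_module R X)" "\<And>x. x \<in> X \<Longrightarrow> e x = e' x" "\<And>x. x \<in> X \<Longrightarrow> e' x \<in> carrier M"
  shows "lin_ext R M e c = lin_ext R M e' c"
proof -
  note C = free_moduleD[OF assms(1)]
  have "\<And>i. c i \<noteq> \<zero> \<Longrightarrow> i \<in> X" using C(4) by auto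
  then show ?thesis unfolding lin_ext_def using C(1) assms(2,3) by (intro M.finsum_cong') auto
qed

section \<open>The enveloping algebra\<close>

context lie_algebra
begin

abbreviation "J \<equiv> uea_ideal R L"
abbreviation "U \<equiv> uea R L"
abbreviation "m \<equiv> uea_proj R L"

abbreviation uea_relator :: "'c \<Rightarrow> 'c \<Rightarrow> nat \<Rightarrow> ('c list \<Rightarrow> 'a) set"
  where "uea_relator x y \<equiv> (tensor_word [x, y] \<ominus>\<^bsub>TA\<^esub> tensor_word [y, x]) \<ominus>\<^bsub>TA\<^esub> tensor_word [x \<otimes>\<^bsub>L\<^esub> y]"

lemma uea_relator_closed:
  assumes "x \<in> carrier L" "y \<in> carrier L" shows "uea_relator x y \<in> carrier TA"
proof -
  interpret TA: module R TA by (rule TA_module)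
  show ?thesis using assms by (intro TA.M.minus_closed tensor_word_closed) (auto simp: prod_closed)
qed

lemma uea_ideal_eq:
  "J = gen_algebra_ideal R TA {uea_relator x y | x y. x \<in> carrier L \<and> y \<in> carrier L}"
proof -
  have 1: "tensor_incl R L 1 (pt [x]) = tensor_word [x]" for x by (simp add: tensor_word_def)
  have "{(tensor_word [x] \<otimes>\<^bsub>TA\<^esub> tensor_word [y] \<ominus>\<^bsub>TA\<^esub> tensor_word [y] \<otimes>\<^bsub>TA\<^esub> tensor_word [x]) \<ominus>\<^bsub>TA\<^esub>
      tensor_word [x \<otimes>\<^bsub>L\<^esub> y] | x y. x \<in> carrier L \<and> y \<in> carrier L}
    = {uea_relator x y | x y. x \<in> carrier L \<and> y \<in> carrier L}"
    using tensor_word_mult[of "[_]" "[_]"] by (intro Collect_cong iff_exI) auto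
  then show ?thesis unfolding uea_ideal_def Let_def 1 by simp
qed

lemma uea_ideal_ideal: "algebra_ideal R TA J"
  and uea_relator_in_ideal: "\<lbrakk>x \<in> carrier L; y \<in> carrier L\<rbrakk> \<Longrightarrow> uea_relator x y \<in> J"
proof -
  interpret TA: nonassoc_algebra R TA by (rule TA_algebra)
  have "{uea_relator x y | x y. x \<in> carrier L \<and> y \<in> carrier L} \<subseteq> carrier TA"
    using uea_relator_closed by auto
  from TA.gen_algebra_ideal[OF this] show "algebra_ideal R TA J"
    "\<lbrakk>x \<in> carrier L; y \<in> carrier L\<rbrakk> \<Longrightarrow> uea_relator x y \<in> J"
    unfolding uea_ideal_eq by auto
qed

lemma uea_ideal_least:
  assumes "algebra_ideal R TA I" "\<And>x y. \<lbrakk>x \<in> carrier L; y \<in> carrier L\<rbrakk> \<Longrightarrow> uea_relator x y \<in> I"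
  shows "J \<subseteq> I"
  unfolding uea_ideal_eq gen_algebra_ideal_def using assms by auto

lemma J_submodule: "submodule J R TA"
  using uea_ideal_ideal by (simp add: algebra_ideal_def)

text \<open>A relator multiplied by words on both sides becomes the rule for exchanging two adjacent
  letters anywhere in a word.\<close>

lemma uea_relator_in_context:
  assumes x: "x \<in> carrier L" and y: "y \<in> carrier L" and us: "set us \<subseteq> carrier L" and vs: "set vs \<subseteq> carrier L"
  shows "(tensor_word (us @ x # y # vs) \<ominus>\<^bsub>TA\<^esub> tensor_word (us @ y # x # vs)) \<ominus>\<^bsub>TA\<^esub>
    tensor_word (us @ (x \<otimes>\<^bsub>L\<^esub> y) # vs) \<in> J"
proof -
  interpret TA: nonassoc_algebra R TA by (rule TA_algebra)
  interpret p: module_pair R TA TA ..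
  note u = tensor_word_closed[OF us] and v = tensor_word_closed[OF vs]
  note l = bilin_right[OF TA.bilin_prod u] and r = bilin_left[OF TA.bilin_prod v]
  have w: "tensor_word [x, y] \<in> carrier TA" "tensor_word [y, x] \<in> carrier TA" "tensor_word [x \<otimes>\<^bsub>L\<^esub> y] \<in> carrier TA"
    using x y by (auto intro!: tensor_word_closed simp: prod_closed)
  have "(tensor_word us \<otimes>\<^bsub>TA\<^esub> uea_relator x y) \<otimes>\<^bsub>TA\<^esub> tensor_word vs \<in> J"
    using uea_ideal_ideal u v uea_relator_in_ideal[OF x y] by (simp add: algebra_ideal_def)
  also have "tensor_word us \<otimes>\<^bsub>TA\<^esub> uea_relator x y
      = (tensor_word (us @ [x, y]) \<ominus>\<^bsub>TA\<^esub> tensor_word (us @ [y, x])) \<ominus>\<^bsub>TA\<^esub> tensor_word (us @ [x \<otimes>\<^bsub>L\<^esub> y])"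
    using w x y us by (simp add: p.lin_minus[OF l] tensor_word_mult prod_closed)
  also have "\<dots> \<otimes>\<^bsub>TA\<^esub> tensor_word vs
     = (tensor_word (us @ x # y # vs) \<ominus>\<^bsub>TA\<^esub> tensor_word (us @ y # x # vs)) \<ominus>\<^bsub>TA\<^esub> tensor_word (us @ (x \<otimes>\<^bsub>L\<^esub> y) # vs)"
  proof -
    have "tensor_word (us @ [x, y]) \<in> carrier TA" "tensor_word (us @ [y, x]) \<in> carrier TA"
      "tensor_word (us @ [x \<otimes>\<^bsub>L\<^esub> y]) \<in> carrier TA"
      using x y us by (auto intro!: tensor_word_closed simp: prod_closed)
    then show ?thesis using x y us vs by (simp add: p.lin_minus[OF r] tensor_word_mult prod_closed)
  qed
  finally show ?thesis .
qed

lemma U_module: "module R U"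
  unfolding uea_def by (rule module.module_quot[OF TA_module J_submodule])

lemma m_eq: "m = (\<lambda>t. J +>\<^bsub>TA\<^esub> t)"
  by (auto simp: uea_proj_def)

lemma lin_m: "lin R TA U m"
  unfolding m_eq uea_def by (rule module.lin_coset[OF TA_module J_submodule])

lemma m_eq_zero_iff: "t \<in> carrier TA \<Longrightarrow> m t = \<zero>\<^bsub>U\<^esub> \<longleftrightarrow> t \<in> J"
  unfolding m_eq uea_def by (rule module.coset_eq_zero_iff[OF TA_module J_submodule])

lemma m_word_closed: "set xs \<subseteq> carrier L \<Longrightarrow> m (tensor_word xs) \<in> carrier U"
  by (intro lin_closed[OF lin_m] tensor_word_closed)

subsection \<open>The filtration\<close>

definition tensors_upto :: "int \<Rightarrow> (nat \<Rightarrow> ('c list \<Rightarrow> 'a) set) set"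
  where "tensors_upto n = {t \<in> carrier TA. \<forall>j. int j > n \<longrightarrow> t j = \<zero>\<^bsub>T j\<^esub>}"

abbreviation "UF \<equiv> uea_filtration R L"

lemma UF_eq: "UF n = m ` tensors_upto n"
  by (auto simp: uea_filtration_def tensors_upto_def)

lemma tensors_upto_submodule: "submodule (tensors_upto n) R TA"
proof -
  interpret TA: module R TA by (rule TA_module)
  interpret T: module R "T j" for j by (rule T_module)
  show ?thesis
  proof (rule TA.submodule_if_closed)
    fix s t assume "s \<in> tensors_upto n" "t \<in> tensors_upto n"
    then show "s \<oplus>\<^bsub>TA\<^esub> t \<in> tensors_upto n"
      using TA.M.a_closed[of s t] by (simp add: tensors_upto_def TA_simps(4))
  next
    fix a t assume "a \<in> carrier R" "t \<in> tensors_upto n"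
    then show "a \<odot>\<^bsub>TA\<^esub> t \<in> tensors_upto n"
      using TA.smult_closed[of a t] by (simp add: tensors_upto_def TA_simps(5))
  next
    show "\<zero>\<^bsub>TA\<^esub> \<in> tensors_upto n"
      using TA.M.zero_closed by (simp add: tensors_upto_def TA_simps(3))
  qed (auto simp: tensors_upto_def)
qed

lemma UF_submodule: "submodule (UF n) R U"
proof -
  interpret p: module_pair R TA U by (intro module_pair.intro TA_module U_module)
  show ?thesis unfolding UF_eq by (rule p.submodule_image[OF lin_m tensors_upto_submodule])
qed

lemma UF_mono: "k \<le> n \<Longrightarrow> UF k \<subseteq> UF n"
  unfolding UF_eq tensors_upto_def by auto

lemma tensor_incl_upto: "x \<in> carrier (T k) \<Longrightarrow> int k \<le> n \<Longrightarrow> tensor_incl R L k x \<in> tensors_upto n"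
  using lin_closed[OF lin_tensor_incl] by (auto simp: tensors_upto_def tensor_incl_def)

lemma m_word_in_UF:
  "set xs \<subseteq> carrier L \<Longrightarrow> int (length xs) \<le> n \<Longrightarrow> m (tensor_word xs) \<in> UF n"
  unfolding UF_eq tensor_word_def
  by (intro imageI tensor_incl_upto pure_tensor_closed) (auto simp: tensor_words_iff)

text \<open>Congruence modulo the next lower filtration step. The degree is read off from
  \<open>xs\<close> alone, which is why transitivity asks for equal lengths.\<close>

definition same_symbol :: "'c list \<Rightarrow> 'c list \<Rightarrow> bool"
  where "same_symbol xs ys \<longleftrightarrow> set xs \<subseteq> carrier L \<and> set ys \<subseteq> carrier L \<and>
    m (tensor_word xs) \<ominus>\<^bsub>U\<^esub> m (tensor_word ys) \<in> UF (int (length xs) - 1)"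

lemma same_symbol_refl: "set xs \<subseteq> carrier L \<Longrightarrow> same_symbol xs xs"
proof -
  interpret U: module R U by (rule U_module)
  show "set xs \<subseteq> carrier L \<Longrightarrow> same_symbol xs xs"
    using m_word_closed[of xs] U.submodule_zero_closed[OF UF_submodule]
    by (simp add: same_symbol_def U.minus_eq_zero_iff[THEN iffD2])
qed

lemma same_symbol_trans:
  assumes "same_symbol xs ys" "same_symbol ys zs" "length ys = length xs"
  shows "same_symbol xs zs"
proof -
  interpret U: module R U by (rule U_module)
  have c: "m (tensor_word xs) \<in> carrier U" "m (tensor_word ys) \<in> carrier U" "m (tensor_word zs) \<in> carrier U"
    using assms by (auto simp: same_symbol_def intro: m_word_closed)
  have "(m (tensor_word xs) \<ominus>\<^bsub>U\<^esub> m (tensor_word ys)) \<oplus>\<^bsub>U\<^esub> (m (tensor_word ys) \<ominus>\<^bsub>U\<^esub> m (tensor_word zs))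
      \<in> UF (int (length xs) - 1)"
    using assms by (intro U.submodule_add_closed[OF UF_submodule]) (auto simp: same_symbol_def)
  then show ?thesis using assms c by (simp add: same_symbol_def U.minus_add_cancel)
qed

text \<open>The two words differ in the enveloping algebra by a word with the bracket in place of
  the two letters, and this word is one letter shorter.\<close>

lemma same_symbol_swap:
  assumes x: "x \<in> carrier L" and y: "y \<in> carrier L" and us: "set us \<subseteq> carrier L" and vs: "set vs \<subseteq> carrier L"
  shows "same_symbol (us @ x # y # vs) (us @ y # x # vs)"
proof -
  interpret TA: module R TA by (rule TA_module)
  interpret U: module R U by (rule U_module)
  interpret p: module_pair R TA U ..
  have c: "tensor_word (us @ x # y # vs) \<in> carrier TA" "tensor_word (us @ y # x # vs) \<in> carrier TA"
    "tensor_word (us @ (x \<otimes>\<^bsub>L\<^esub> y) # vs) \<in> carrier TA"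
    using x y us vs by (auto intro!: tensor_word_closed simp: prod_closed)
  have "m ((tensor_word (us @ x # y # vs) \<ominus>\<^bsub>TA\<^esub> tensor_word (us @ y # x # vs)) \<ominus>\<^bsub>TA\<^esub>
    tensor_word (us @ (x \<otimes>\<^bsub>L\<^esub> y) # vs)) = \<zero>\<^bsub>U\<^esub>"
    using uea_relator_in_context[OF assms] c by (subst m_eq_zero_iff) auto
  then have "m (tensor_word (us @ x # y # vs)) \<ominus>\<^bsub>U\<^esub> m (tensor_word (us @ y # x # vs))
      = m (tensor_word (us @ (x \<otimes>\<^bsub>L\<^esub> y) # vs))"
    using c lin_closed[OF lin_m] by (simp add: p.lin_minus[OF lin_m] U.minus_eq_zero_iff)
  also have "\<dots> \<in> UF (int (length (us @ x # y # vs)) - 1)"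
    using x y us vs by (intro m_word_in_UF) (auto simp: prod_closed)
  finally show ?thesis using assms by (simp add: same_symbol_def)
qed

lemma same_symbol_move:
  assumes "x \<in> carrier L" "set us \<subseteq> carrier L" "set vs \<subseteq> carrier L" "set ws \<subseteq> carrier L"
  shows "same_symbol (us @ x # vs @ ws) (us @ vs @ x # ws)"
  using assms
proof (induction vs arbitrary: us)
  case Nil
  then show ?case by (simp add: same_symbol_refl)
next
  case (Cons v vs)
  have "same_symbol (us @ x # v # (vs @ ws)) (us @ v # x # (vs @ ws))"
    using Cons.prems by (intro same_symbol_swap) auto
  moreover have "same_symbol ((us @ [v]) @ x # vs @ ws) ((us @ [v]) @ vs @ x # ws)"
    using Cons.prems by (intro Cons.IH) auto
  ultimately show ?case by (auto intro: same_symbol_trans)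
qed

text \<open>The tail is rearranged first, by the induction hypothesis with \<open>x\<close> absorbed
  into the prefix \<open>us\<close>; then \<open>x\<close> travels to the place it has in
  \<open>ys\<close>.\<close>

lemma same_symbol_mset:
  assumes "mset xs = mset ys" "set us \<subseteq> carrier L" "set xs \<subseteq> carrier L"
  shows "same_symbol (us @ xs) (us @ ys)"
  using assms
proof (induction xs arbitrary: us ys)
  case Nil
  then show ?case by (auto intro: same_symbol_refl)
next
  case (Cons x xs)
  have "x \<in> set ys" using Cons.prems(1) by (metis list.set_intros(1) set_mset_mset)
  then obtain ys1 ys2 where ys: "ys = ys1 @ x # ys2" by (meson split_list)
  have ms: "mset xs = mset (ys1 @ ys2)" using Cons.prems(1) ys by simp
  then have set: "set xs = set (ys1 @ ys2)" by (metis set_mset_mset)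
  have "same_symbol ((us @ [x]) @ xs) ((us @ [x]) @ ys1 @ ys2)"
    using Cons.prems by (intro Cons.IH ms) auto
  moreover have "same_symbol (us @ x # ys1 @ ys2) (us @ ys1 @ x # ys2)"
    using Cons.prems set by (intro same_symbol_move) auto
  moreover have "length xs = length (ys1 @ ys2)" using ms by (metis size_mset)
  ultimately show ?case unfolding ys by (intro same_symbol_trans[of "us @ x # xs" "us @ x # ys1 @ ys2" "us @ ys1 @ x # ys2"]) auto
qed

subsection \<open>The symbol map\<close>

abbreviation "Um \<equiv> uea_filtration_module R L"
abbreviation "gr \<equiv> uea_graded R L"

lemma Um_simps: "carrier (Um n) = UF n" "x \<oplus>\<^bsub>Um n\<^esub> y = x \<oplus>\<^bsub>U\<^esub> y" "a \<odot>\<^bsub>Um n\<^esub> x = a \<odot>\<^bsub>U\<^esub> x"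
    "\<zero>\<^bsub>Um n\<^esub> = \<zero>\<^bsub>U\<^esub>"
  by (auto simp: uea_filtration_module_def)

lemma Um_module: "module R (Um n)"
  unfolding uea_filtration_module_def by (rule submodule.submodule_is_module[OF UF_submodule U_module])

lemma UF_submodule_Um: assumes "k \<le> n" shows "submodule (UF k) R (Um n)"
proof -
  interpret Um: module R "Um n" by (rule Um_module)
  interpret U: module R U by (rule U_module)
  show ?thesis
    by (rule Um.submodule_if_closed) (use UF_mono[OF assms] U.submodule_add_closed[OF UF_submodule]
      U.submodule_smult_closed[OF UF_submodule] U.submodule_zero_closed[OF UF_submodule] in \<open>auto simp: Um_simps\<close>)
qed

lemma gr_module: "module R (gr n)"
  unfolding uea_graded_def by (rule module.module_quot[OF Um_module UF_submodule_Um]) simp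

definition symbol :: "nat \<Rightarrow> ('c list \<Rightarrow> 'a) set \<Rightarrow> (nat \<Rightarrow> ('c list \<Rightarrow> 'a) set) set set"
  where "symbol n t = UF (int n - 1) +>\<^bsub>Um (int n)\<^esub> m (tensor_incl R L n t)"

lemma pbw_map_eq: "pbw_map R L n = qlift (symbol n)"
  by (rule ext) (simp add: pbw_map_def qlift_def symbol_def)

lemma m_incl_closed: "t \<in> carrier (T n) \<Longrightarrow> m (tensor_incl R L n t) \<in> UF (int n)"
  unfolding UF_eq by (intro imageI tensor_incl_upto) auto

lemma lin_symbol: "lin R (T n) (gr n) (symbol n)"
proof -
  have "lin R (T n) (Um (int n)) (\<lambda>t. m (tensor_incl R L n t))"
    using lin_compose[OF lin_tensor_incl[of n] lin_m] m_incl_closed unfolding lin_def by (simp add: Um_simps Pi_iff)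
  moreover have "lin R (Um (int n)) (gr n) (\<lambda>u. UF (int n - 1) +>\<^bsub>Um (int n)\<^esub> u)"
    unfolding uea_graded_def by (rule module.lin_coset[OF Um_module UF_submodule_Um]) simp
  ultimately show ?thesis unfolding symbol_def by (rule lin_compose)
qed

lemma symbol_eq_zero_iff:
  assumes "t \<in> carrier (T n)"
  shows "symbol n t = \<zero>\<^bsub>gr n\<^esub> \<longleftrightarrow> m (tensor_incl R L n t) \<in> UF (int n - 1)"
  unfolding symbol_def uea_graded_def
  by (rule module.coset_eq_zero_iff[OF Um_module UF_submodule_Um]) (use m_incl_closed assms in \<open>auto simp: Um_simps\<close>)

text \<open>A tensor of degree at most \<open>n\<close> differs from its component of degree
  \<open>n\<close> by a tensor of degree at most \<open>n - 1\<close>, which the quotient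
  kills.\<close>

lemma symbol_surj:
  assumes "y \<in> carrier (gr n)" obtains t where "t \<in> carrier (T n)" "symbol n t = y"
proof -
  interpret TA: module R TA by (rule TA_module)
  interpret U: module R U by (rule U_module)
  interpret Um: module R "Um (int n)" by (rule Um_module)
  interpret p: module_pair R TA U ..
  obtain t where t: "t \<in> tensors_upto (int n)" and y: "y = UF (int n - 1) +>\<^bsub>Um (int n)\<^esub> m t"
    using assms unfolding uea_graded_def carrier_quot Um_simps UF_eq by auto
  have tc: "t \<in> carrier TA" "t n \<in> carrier (T n)" using t by (auto simp: tensors_upto_def TA_simps)
  let ?i = "tensor_incl R L n (t n)"
  have ic: "?i \<in> carrier TA" using lin_closed[OF lin_tensor_incl tc(2)] .
  interpret T: module R "T j" for j by (rule T_module)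
  let ?s = "\<lambda>i. if i = n then \<zero>\<^bsub>T i\<^esub> else t i"
  have "finite {i. ?s i \<noteq> \<zero>\<^bsub>T i\<^esub>}"
    by (rule finite_subset[of _ "{i. t i \<noteq> \<zero>\<^bsub>T i\<^esub>}"]) (use tc in \<open>auto simp: TA_simps\<close>)
  then have sc: "?s \<in> carrier TA" using tc by (simp add: TA_simps)
  have "?i = (\<lambda>i. if i = n then t n else \<zero>\<^bsub>T i\<^esub>)" by (simp add: tensor_incl_def)
  then have si: "?s \<oplus>\<^bsub>TA\<^esub> ?i = t" using tc by (simp add: TA_simps fun_eq_iff)
  have "?s \<in> tensors_upto (int n - 1)" using sc t by (auto simp: tensors_upto_def)
  then have s: "m ?s \<in> UF (int n - 1)" unfolding UF_eq by blast
  have "m t = m ?s \<oplus>\<^bsub>Um (int n)\<^esub> m ?i" unfolding Um_simps using lin_add[OF lin_m sc ic] si by simp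
  moreover have mi: "m ?i \<in> carrier (Um (int n))" using m_incl_closed[OF tc(2)] by (simp add: Um_simps)
  ultimately have "m t \<in> UF (int n - 1) +>\<^bsub>Um (int n)\<^esub> m ?i"
    using s unfolding a_r_coset_def r_coset_def by auto
  moreover have mt: "m t \<in> carrier (Um (int n))" unfolding Um_simps UF_eq using t by blast
  ultimately have "UF (int n - 1) +>\<^bsub>Um (int n)\<^esub> m t = symbol n (t n)"
    unfolding symbol_def
    using Um.coset_mem_iff[OF UF_submodule_Um mi] Um.coset_eq_iff[OF UF_submodule_Um mt mi] by simp
  then show ?thesis using that[OF tc(2)] y by simp
qed

abbreviation "sym_sub n \<equiv> module_span R (T n) (sym_relators R L n)"

lemma sym_relators_closed: "sym_relators R L n \<subseteq> carrier (T n)"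
proof -
  interpret T: module R "T n" for n by (rule T_module)
  show ?thesis unfolding sym_relators_def
    by (auto intro!: T.M.minus_closed pure_tensor_closed simp: tensor_words_iff)
qed

lemma sym_sub_submodule: "submodule (sym_sub n) R (T n)"
  by (rule module.module_span_submodule[OF T_module sym_relators_closed])

lemma mset_eq_sym_sub:
  assumes xs: "xs \<in> tensor_words L n" and ys: "mset ys = mset xs"
  shows "pt xs \<ominus>\<^bsub>T n\<^esub> pt ys \<in> sym_sub n"
proof -
  interpret T: module R "T n" by (rule T_module)
  obtain \<sigma> where s: "\<sigma> permutes {..<length xs}" "permute_list \<sigma> xs = ys"
    using mset_eq_permutation[OF ys] by blast
  then have "pt xs \<ominus>\<^bsub>T n\<^esub> pt ys \<in> sym_relators R L n"
    using xs unfolding sym_relators_def by (auto simp: tensor_words_iff)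
  then show ?thesis using T.module_span_superset by blast
qed

text \<open>Makes the map well defined on the symmetric power: permuting a word changes its image
  only by lower filtration, by \<open>same_symbol_mset\<close>.\<close>

lemma symbol_sym_sub:
  assumes "t \<in> sym_sub n" shows "symbol n t = \<zero>\<^bsub>gr n\<^esub>"
proof -
  interpret T: module R "T n" by (rule T_module)
  interpret gr: module R "gr n" by (rule gr_module)
  interpret TA: module R TA by (rule TA_module)
  interpret U: module R U by (rule U_module)
  interpret p: module_pair R "T n" "gr n" ..
  interpret q: module_pair R "T n" U ..
  have "symbol n t \<in> {\<zero>\<^bsub>gr n\<^esub>}"
  proof (rule p.lin_span_subset[OF lin_symbol gr.submodule_singleton_zero _ _ assms])
    fix x assume x: "x \<in> sym_relators R L n"
    then show xc: "x \<in> carrier (T n)" using sym_relators_closed by auto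
    from x obtain xs \<sigma> where x: "x = pt xs \<ominus>\<^bsub>T n\<^esub> pt (permute_list \<sigma> xs)"
      "xs \<in> tensor_words L n" "\<sigma> permutes {..<n}" unfolding sym_relators_def by auto
    let ?ys = "permute_list \<sigma> xs"
    have len: "length xs = n" and xsc: "set xs \<subseteq> carrier L" using x by (auto simp: tensor_words_iff)
    have ms: "mset ?ys = mset xs" using x(3) len by (intro mset_permute_list) auto
    then have ysc: "set ?ys \<subseteq> carrier L" using xsc by (metis set_mset_mset)
    have c: "pt xs \<in> carrier (T n)" "pt ?ys \<in> carrier (T n)"
      using len xsc ysc by (auto intro!: pure_tensor_closed simp: tensor_words_iff)
    have "same_symbol ([] @ xs) ([] @ ?ys)" using ms xsc by (intro same_symbol_mset) auto
    then have "m (tensor_word xs) \<ominus>\<^bsub>U\<^esub> m (tensor_word ?ys) \<in> UF (int n - 1)"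
      using len by (simp add: same_symbol_def)
    also have "m (tensor_word xs) \<ominus>\<^bsub>U\<^esub> m (tensor_word ?ys) = m (tensor_incl R L n x)"
      using q.lin_minus[OF lin_compose[OF lin_tensor_incl lin_m] c] len x by (simp add: tensor_word_def)
    finally show "symbol n x \<in> {\<zero>\<^bsub>gr n\<^esub>}" using symbol_eq_zero_iff[OF xc] by simp
  qed
  then show ?thesis by simp
qed

section \<open>A criterion for the Poincare-Birkhoff-Witt theorem\<close>

text \<open>
  \<open>B\<close> indexes the ordered monomials in the generating set \<open>G\<close>, and \<open>w\<close> sends an index to its word
  of generators; an index set is needed because \<open>w\<close> need not be injective (over the zero ring).
\<close>

lemma pbw_criterion:
  assumes G: "G \<subseteq> carrier L" "module_span R L G = carrier L"
    and w: "\<And>b. b \<in> B \<Longrightarrow> set (w b) \<subseteq> G"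
    and sort: "\<And>xs. set xs \<subseteq> G \<Longrightarrow> \<exists>b\<in>B. mset (w b) = mset xs"
    and indep: "\<And>c b. \<lbrakk>c \<in> carrier (free_module R B); lin_ext R U (\<lambda>b. m (tensor_word (w b))) c = \<zero>\<^bsub>U\<^esub>\<rbrakk> \<Longrightarrow> c b = \<zero>"
  shows "pbw_map R L n \<in> module_iso R (sym_power R L n) (gr n)"
proof -
  interpret TA: module R TA by (rule TA_module)
  interpret U: module R U by (rule U_module)
  interpret T: module R "T j" for j by (rule T_module)
  interpret gr: module R "gr n" by (rule gr_module)
  interpret TU: module_pair R "T j" U for j ..
  interpret AU: module_pair R TA U ..
  interpret Tg: module_pair R "T n" "gr n" ..
  let ?e = "\<lambda>b. m (tensor_word (w b))"
  \<comment> \<open>The bound is an integer, so that \<open>V (- 1)\<close> is empty in accordance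
    with the filtration.\<close>
  define V where "V k = {b \<in> B. int (length (w b)) \<le> k}" for k
  have wL: "set (w b) \<subseteq> carrier L" if "b \<in> B" for b using w[OF that] G(1) by auto
  have eB: "?e \<in> B \<rightarrow> carrier U" using wL by (auto intro!: m_word_closed)
  have eV: "?e ` V k \<subseteq> carrier U" for k using eB by (auto simp: V_def)
  have Vmono: "module_span R U (?e ` V k) \<subseteq> module_span R U (?e ` V l)" if "k \<le> l" for k l
    by (rule U.module_span_mono) (use that in \<open>auto simp: V_def\<close>)
  \<comment> \<open>The shift by one lets the induction start at the zero step of the filtration;
    later only the step below \<open>n\<close> is needed.\<close>
  have filt: "UF (int k - 1) \<subseteq> module_span R U (?e ` V (int k - 1))" for k
  proof (induction k)
    case 0
    have "t = \<zero>\<^bsub>TA\<^esub>" if "t \<in> tensors_upto (int 0 - 1)" for t using that by (auto simp: tensors_upto_def TA_simps)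
    then show ?case unfolding UF_eq
      using AU.lin_zero[OF lin_m] U.submodule_zero_closed[OF U.module_span_submodule[OF eV]] by auto
  next
    case (Suc k)
    let ?S = "module_span R U (?e ` V (int k))"
    note sm = U.module_span_submodule[OF eV[of "int k"]]
    have IH: "UF (int k - 1) \<subseteq> ?S" using Suc Vmono[of "int k - 1" "int k"] by auto
    have word: "m (tensor_word xs) \<in> ?S" if xs: "set xs \<subseteq> G" "length xs \<le> k" for xs
    proof (cases "length xs = k")
      case False
      then show ?thesis using IH m_word_in_UF[of xs "int k - 1"] xs G(1) by auto
    next
      case True
      obtain b where b: "b \<in> B" "mset (w b) = mset xs" using sort[OF xs(1)] by auto
      then have "length (w b) = k" using True by (metis size_mset)
      then have "?e b \<in> ?S" using U.module_span_superset[of "?e ` V (int k)"] b by (auto simp: V_def)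
      \<comment> \<open>A word of full length is exchanged for the ordered monomial with the same
        letters; the error lies one filtration step lower and is covered by
        \<open>IH\<close>.\<close>
      moreover have "same_symbol ([] @ xs) ([] @ w b)" using b xs G(1) by (intro same_symbol_mset) auto
      then have "m (tensor_word xs) \<ominus>\<^bsub>U\<^esub> ?e b \<in> ?S" using IH True by (auto simp: same_symbol_def)
      ultimately show ?thesis
        using U.submodule_minus_iff[OF sm, of "m (tensor_word xs)" "?e b"] m_word_closed[of xs] xs G(1) by auto
    qed
    have "m t \<in> ?S" if t: "t \<in> tensors_upto (int k)" for t
    proof -
      have "t \<in> {t \<in> carrier TA. m t \<in> ?S}"
      proof (rule tensor_algebra_induct[OF AU.submodule_vimage[OF lin_m sm]])
        show "t \<in> carrier TA" using t by (simp add: tensors_upto_def)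
        fix j x assume tj: "t j \<noteq> \<zero>\<^bsub>T j\<^esub>" and x: "x \<in> carrier (T j)"
        have j: "j \<le> k" using t tj by (auto simp: tensors_upto_def not_less[symmetric])
        have "m (tensor_incl R L j x) \<in> ?S"
        proof (rule TU.lin_span_subset[OF lin_compose[OF lin_tensor_incl lin_m] sm])
          show "x \<in> module_span R (T j) {pt xs | xs. length xs = j \<and> set xs \<subseteq> G}"
            using pure_tensor_span_generators[OF G] x by simp
          fix y assume "y \<in> {pt xs | xs. length xs = j \<and> set xs \<subseteq> G}"
          then obtain xs where xs: "y = pt xs" "length xs = j" "set xs \<subseteq> G" by auto
          then show "y \<in> carrier (T j)" using G(1) by (auto intro!: pure_tensor_closed simp: tensor_words_iff)
          show "m (tensor_incl R L j y) \<in> ?S" using word[of xs] xs j by (simp add: tensor_word_def)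
        qed
        then show "tensor_incl R L j x \<in> {t \<in> carrier TA. m t \<in> ?S}"
          using lin_closed[OF lin_tensor_incl x] by simp
      qed
      then show ?thesis by simp
    qed
    then show ?case unfolding UF_eq by auto
  qed
  have inj: "t \<in> sym_sub n" if t: "t \<in> carrier (T n)" and z: "symbol n t = \<zero>\<^bsub>gr n\<^esub>" for t
  proof -
    define B' where "B' = {b \<in> B. length (w b) = n}"
    interpret S: module R "sym_power R L n"
      unfolding sym_power_def by (rule T.module_quot(1)[OF sym_sub_submodule])
    interpret TS: module_pair R "T n" "sym_power R L n" ..
    have lc: "lin R (T n) (sym_power R L n) (\<lambda>t. sym_sub n +>\<^bsub>T n\<^esub> t)"
      unfolding sym_power_def by (rule T.lin_coset[OF sym_sub_submodule])
    have eT: "(\<lambda>b. pt (w b)) \<in> B' \<rightarrow> carrier (T n)"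
      using wL by (auto intro!: pure_tensor_closed simp: tensor_words_iff B'_def)
    then have eS: "(\<lambda>b. sym_sub n +>\<^bsub>T n\<^esub> pt (w b)) \<in> B' \<rightarrow> carrier (sym_power R L n)"
      using lin_closed[OF lc] by auto
    have "sym_sub n +>\<^bsub>T n\<^esub> t \<in> module_span R (sym_power R L n) ((\<lambda>b. sym_sub n +>\<^bsub>T n\<^esub> pt (w b)) ` B')"
      (is "_ \<in> ?Z")
    proof (rule TS.lin_span_subset[OF lc S.module_span_submodule])
      show "(\<lambda>b. sym_sub n +>\<^bsub>T n\<^esub> pt (w b)) ` B' \<subseteq> carrier (sym_power R L n)" using eS by auto
      show "t \<in> module_span R (T n) {pt xs | xs. length xs = n \<and> set xs \<subseteq> G}"
        using pure_tensor_span_generators[OF G] t by simp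
      fix y assume "y \<in> {pt xs | xs. length xs = n \<and> set xs \<subseteq> G}"
      then obtain xs where xs: "y = pt xs" "length xs = n" "set xs \<subseteq> G" by auto
      then have xw: "xs \<in> tensor_words L n" using G(1) by (auto simp: tensor_words_iff)
      then show yc: "y \<in> carrier (T n)" using xs by (auto intro: pure_tensor_closed)
      obtain b where b: "b \<in> B" "mset (w b) = mset xs" using sort[OF xs(3)] by auto
      have "length (w b) = n" using b(2) xs(2) by (metis size_mset)
      then have b': "b \<in> B'" using b by (simp add: B'_def)
      then have "sym_sub n +>\<^bsub>T n\<^esub> y = sym_sub n +>\<^bsub>T n\<^esub> pt (w b)"
        using mset_eq_sym_sub[OF xw b(2)] xs(1) eT yc by (subst T.coset_eq_iff[OF sym_sub_submodule]) auto
      then show "sym_sub n +>\<^bsub>T n\<^esub> y \<in> ?Z"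
        using S.module_span_superset[of "(\<lambda>b. sym_sub n +>\<^bsub>T n\<^esub> pt (w b)) ` B'"] b' by auto
    qed
    then obtain c where c: "c \<in> carrier (free_module R B')"
      and tc: "sym_sub n +>\<^bsub>T n\<^esub> t = lin_ext R (sym_power R L n) (\<lambda>b. sym_sub n +>\<^bsub>T n\<^esub> pt (w b)) c"
      using S.span_imp_lin_ext[OF eS] by metis
    \<comment> \<open>\<open>a\<close> represents \<open>t\<close> modulo the symmetrization
      relators as a combination of ordered monomials with exactly \<open>n\<close> letters.\<close>
    define a where "a = lin_ext R (T n) (\<lambda>b. pt (w b)) c"
    have ac: "a \<in> carrier (T n)" unfolding a_def by (rule lin_closed[OF T.lin_lin_ext[OF eT] c])
    have "sym_sub n +>\<^bsub>T n\<^esub> t = sym_sub n +>\<^bsub>T n\<^esub> a"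
      unfolding a_def tc by (rule TS.lin_of_lin_ext[OF lc eT c, symmetric])
    then have d: "t \<ominus>\<^bsub>T n\<^esub> a \<in> sym_sub n" using T.coset_eq_iff[OF sym_sub_submodule t ac] by simp
    have "symbol n t \<ominus>\<^bsub>gr n\<^esub> symbol n a = \<zero>\<^bsub>gr n\<^esub>"
      using symbol_sym_sub[OF d] Tg.lin_minus[OF lin_symbol t ac] by simp
    then have "symbol n a = \<zero>\<^bsub>gr n\<^esub>"
      using z gr.minus_eq_zero_iff[OF lin_closed[OF lin_symbol t] lin_closed[OF lin_symbol ac]] by simp
    then have "m (tensor_incl R L n a) \<in> module_span R U (?e ` V (int n - 1))"
      using symbol_eq_zero_iff[OF ac] filt[of n] by auto
    moreover have "?e \<in> V (int n - 1) \<rightarrow> carrier U" using eB by (auto simp: V_def)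
    ultimately obtain d where d': "d \<in> carrier (free_module R (V (int n - 1)))"
      and ad: "m (tensor_incl R L n a) = lin_ext R U ?e d"
      using U.span_imp_lin_ext by metis
    have "m (tensor_incl R L n a) = lin_ext R U (\<lambda>b. m (tensor_incl R L n (pt (w b)))) c"
      unfolding a_def by (rule TU.lin_of_lin_ext[OF lin_compose[OF lin_tensor_incl lin_m] eT c])
    also have "\<dots> = lin_ext R U ?e c"
      using eB by (intro U.lin_ext_cong[OF c]) (auto simp: B'_def tensor_word_def)
    finally have cd: "lin_ext R U ?e c = lin_ext R U ?e d" using ad by simp
    interpret FB: module R "free_module R B" by (rule free_module_module) (rule is_cring)
    interpret FU: module_pair R "free_module R B" U ..
    \<comment> \<open>Both coefficient families are extended to all of \<open>B\<close>, so that
      independence of all ordered monomials applies to their difference.\<close>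
    have cB: "c \<in> carrier (free_module R B)" by (rule free_module_mono[OF _ c]) (auto simp: B'_def)
    have dB: "d \<in> carrier (free_module R B)" by (rule free_module_mono[OF _ d']) (auto simp: V_def)
    note l = U.lin_lin_ext[OF eB]
    have "lin_ext R U ?e (c \<ominus>\<^bsub>free_module R B\<^esub> d) = \<zero>\<^bsub>U\<^esub>"
      using cd lin_closed[OF l] cB dB by (simp add: FU.lin_minus[OF l] U.minus_eq_zero_iff)
    from indep[OF FB.M.minus_closed[OF cB dB] this]
    have "c \<ominus>\<^bsub>free_module R B\<^esub> d = \<zero>\<^bsub>free_module R B\<^esub>" by (auto simp: free_module_simps)
    then have eq: "c = d" using FB.minus_eq_zero_iff[OF cB dB] by simp
    \<comment> \<open>Indices of \<open>c\<close> have exactly \<open>n\<close> letters, those of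
      \<open>d\<close> fewer. Being equal, the two families vanish everywhere.\<close>
    have "c b = \<zero>" for b
      using free_moduleD(2)[OF c, of b] free_moduleD(2)[OF d', of b] eq by (cases "b \<in> B'") (auto simp: V_def B'_def)
    then have "a = \<zero>\<^bsub>T n\<^esub>" unfolding a_def lin_ext_def by simp
    then show ?thesis using d t by (simp add: T.minus_zero)
  qed
  show ?thesis
    unfolding pbw_map_eq sym_power_def
    by (rule Tg.qlift_module_iso[OF lin_symbol sym_sub_submodule symbol_sym_sub inj])
      (auto elim: symbol_surj)
qed

end

section \<open>Commutators and the universal property of the enveloping algebra\<close>

lemma (in module_pair) lin_diff:
  assumes f: "lin R M N f" and g: "lin R M N g"
  shows "lin R M N (\<lambda>x. f x \<ominus>\<^bsub>N\<^esub> g x)"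
proof (rule linI)
  note fc = lin_closed[OF f] and gc = lin_closed[OF g]
  show "f x \<ominus>\<^bsub>N\<^esub> g x \<in> carrier N" if "x \<in> carrier M" for x using fc gc that by simp
  show "f (x \<oplus>\<^bsub>M\<^esub> y) \<ominus>\<^bsub>N\<^esub> g (x \<oplus>\<^bsub>M\<^esub> y) = (f x \<ominus>\<^bsub>N\<^esub> g x) \<oplus>\<^bsub>N\<^esub> (f y \<ominus>\<^bsub>N\<^esub> g y)"
    if "x \<in> carrier M" "y \<in> carrier M" for x y
    using fc gc that by (simp add: lin_add[OF f] lin_add[OF g] a_minus_def N.M.minus_add N.M.a_ac)
  show "f (a \<odot>\<^bsub>M\<^esub> x) \<ominus>\<^bsub>N\<^esub> g (a \<odot>\<^bsub>M\<^esub> x) = a \<odot>\<^bsub>N\<^esub> (f x \<ominus>\<^bsub>N\<^esub> g x)"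
    if "a \<in> carrier R" "x \<in> carrier M" for a x
    using fc gc that by (simp add: lin_smult[OF f] lin_smult[OF g] a_minus_def N.smult_r_distr N.smult_r_minus)
qed

lemma (in nonassoc_algebra) bilin_commutator: "bilin R A A A (\<lambda>x y. x \<otimes>\<^bsub>A\<^esub> y \<ominus>\<^bsub>A\<^esub> y \<otimes>\<^bsub>A\<^esub> x)"
proof -
  interpret p: module_pair R A A ..
  show ?thesis unfolding bilin_def
    by (auto intro!: p.lin_diff bilin_left[OF bilin_prod] bilin_right[OF bilin_prod])
qed

lemma (in ring) commutator_jacobi:
  assumes "x \<in> carrier R" "y \<in> carrier R" "z \<in> carrier R"
  shows "(x \<otimes> (y \<otimes> z \<ominus> z \<otimes> y) \<ominus> (y \<otimes> z \<ominus> z \<otimes> y) \<otimes> x) \<oplus>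
    (y \<otimes> (z \<otimes> x \<ominus> x \<otimes> z) \<ominus> (z \<otimes> x \<ominus> x \<otimes> z) \<otimes> y) \<oplus>
    (z \<otimes> (x \<otimes> y \<ominus> y \<otimes> x) \<ominus> (x \<otimes> y \<ominus> y \<otimes> x) \<otimes> z) = \<zero>"
  using assms by algebra

context lie_algebra
begin

lemma bracket_antisym:
  assumes x: "x \<in> carrier L" and y: "y \<in> carrier L"
  shows "x \<otimes>\<^bsub>L\<^esub> y = \<ominus>\<^bsub>L\<^esub> (y \<otimes>\<^bsub>L\<^esub> x)"
proof -
  have "(x \<oplus>\<^bsub>L\<^esub> y) \<otimes>\<^bsub>L\<^esub> (x \<oplus>\<^bsub>L\<^esub> y) = x \<otimes>\<^bsub>L\<^esub> (x \<oplus>\<^bsub>L\<^esub> y) \<oplus>\<^bsub>L\<^esub> y \<otimes>\<^bsub>L\<^esub> (x \<oplus>\<^bsub>L\<^esub> y)"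
    using x y by (intro prod_add_left) auto
  also have "\<dots> = x \<otimes>\<^bsub>L\<^esub> y \<oplus>\<^bsub>L\<^esub> y \<otimes>\<^bsub>L\<^esub> x"
    using x y by (simp add: prod_add_right prod_closed bracket_self)
  finally have "(x \<oplus>\<^bsub>L\<^esub> y) \<otimes>\<^bsub>L\<^esub> (x \<oplus>\<^bsub>L\<^esub> y) = x \<otimes>\<^bsub>L\<^esub> y \<oplus>\<^bsub>L\<^esub> y \<otimes>\<^bsub>L\<^esub> x" .
  then have "x \<otimes>\<^bsub>L\<^esub> y \<oplus>\<^bsub>L\<^esub> y \<otimes>\<^bsub>L\<^esub> x = \<zero>\<^bsub>L\<^esub>" using bracket_self x y by simp
  then show ?thesis using M.minus_equality x y prod_closed by metis
qed

text \<open>The Jacobi identity as a rewriting rule: it dissolves a bracket in the left factor into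
  two nested brackets whose left factors are its constituents.\<close>

lemma bracket_derivation:
  assumes x: "x \<in> carrier L" and y: "y \<in> carrier L" and z: "z \<in> carrier L"
  shows "(x \<otimes>\<^bsub>L\<^esub> y) \<otimes>\<^bsub>L\<^esub> z = x \<otimes>\<^bsub>L\<^esub> (y \<otimes>\<^bsub>L\<^esub> z) \<ominus>\<^bsub>L\<^esub> y \<otimes>\<^bsub>L\<^esub> (x \<otimes>\<^bsub>L\<^esub> z)"
proof -
  interpret p: module_pair R L L ..
  have c: "(x \<otimes>\<^bsub>L\<^esub> y) \<otimes>\<^bsub>L\<^esub> z \<in> carrier L" "x \<otimes>\<^bsub>L\<^esub> (y \<otimes>\<^bsub>L\<^esub> z) \<in> carrier L" "y \<otimes>\<^bsub>L\<^esub> (x \<otimes>\<^bsub>L\<^esub> z) \<in> carrier L"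
    using x y z by (auto simp: prod_closed)
  have "y \<otimes>\<^bsub>L\<^esub> (z \<otimes>\<^bsub>L\<^esub> x) = \<ominus>\<^bsub>L\<^esub> (y \<otimes>\<^bsub>L\<^esub> (x \<otimes>\<^bsub>L\<^esub> z))"
    using bracket_antisym[OF z x] p.lin_uminus[OF bilin_right[OF bilin_prod y], of "x \<otimes>\<^bsub>L\<^esub> z"] x z
    by (simp add: prod_closed)
  moreover have "z \<otimes>\<^bsub>L\<^esub> (x \<otimes>\<^bsub>L\<^esub> y) = \<ominus>\<^bsub>L\<^esub> ((x \<otimes>\<^bsub>L\<^esub> y) \<otimes>\<^bsub>L\<^esub> z)"
    by (rule bracket_antisym) (use x y z in \<open>auto simp: prod_closed\<close>)
  ultimately have "(x \<otimes>\<^bsub>L\<^esub> (y \<otimes>\<^bsub>L\<^esub> z) \<ominus>\<^bsub>L\<^esub> y \<otimes>\<^bsub>L\<^esub> (x \<otimes>\<^bsub>L\<^esub> z)) \<ominus>\<^bsub>L\<^esub> (x \<otimes>\<^bsub>L\<^esub> y) \<otimes>\<^bsub>L\<^esub> z = \<zero>\<^bsub>L\<^esub>"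
    using jacobi[OF x y z] by (simp add: a_minus_def)
  then show ?thesis using minus_eq_zero_iff c by simp
qed

text \<open>Universal property of the enveloping algebra, with the values recorded on words. The map
  \<open>h\<close> on the tensor algebra is multiplicative, so its kernel is a two-sided ideal; it
  contains the relators because \<open>p\<close> turns brackets into commutators.\<close>

lemma uea_lift:
  assumes P: "nonassoc_algebra R P" and ring: "ring P" and p: "lin R L P p"
    and br: "\<And>x y. \<lbrakk>x \<in> carrier L; y \<in> carrier L\<rbrakk> \<Longrightarrow>
      p (x \<otimes>\<^bsub>L\<^esub> y) = p x \<otimes>\<^bsub>P\<^esub> p y \<ominus>\<^bsub>P\<^esub> p y \<otimes>\<^bsub>P\<^esub> p x"
  obtains g where "lin R U P g"
    "\<And>xs. set xs \<subseteq> carrier L \<Longrightarrow> g (m (tensor_word xs)) = foldr (\<lambda>x f. p x \<otimes>\<^bsub>P\<^esub> f) xs \<one>\<^bsub>P\<^esub>"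
proof -
  interpret P: nonassoc_algebra R P by fact
  interpret Pr: ring P by fact
  interpret TA: nonassoc_algebra R TA by (rule TA_algebra)
  interpret TP: module_pair R TA P ..
  let ?f = "\<lambda>xs. foldr (\<lambda>x f. p x \<otimes>\<^bsub>P\<^esub> f) xs \<one>\<^bsub>P\<^esub>"
  note pc = lin_closed[OF p]
  have fc: "?f xs \<in> carrier P" if "set xs \<subseteq> carrier L" for xs
    using that by (induction xs) (auto simp: pc)
  have slot: "lin R L P (\<lambda>x. ?f (us @ x # vs))" if "set us \<subseteq> carrier L" "set vs \<subseteq> carrier L" for us vs
    using that(1)
  proof (induction us)
    case Nil
    show ?case using lin_compose[OF p bilin_left[OF P.bilin_prod fc[OF that(2)]]] by simp
  next
    case (Cons u us)
    then show ?case using lin_compose[OF Cons.IH bilin_right[OF P.bilin_prod, of "p u"]] pc by simp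
  qed
  obtain h where h: "lin R TA P h" and hw: "\<And>xs. set xs \<subseteq> carrier L \<Longrightarrow> h (tensor_word xs) = ?f xs"
    using tensor_algebra_lift[OF P.module_axioms fc slot] by blast
  have app: "?f (us @ vs) = ?f us \<otimes>\<^bsub>P\<^esub> ?f vs" if "set us \<subseteq> carrier L" "set vs \<subseteq> carrier L" for us vs
    using that by (induction us) (auto simp: fc pc Pr.m_assoc)
  have sub: "tensor_word ` lists (carrier L) \<subseteq> carrier TA" using tensor_word_closed by auto
  \<comment> \<open>Both sides are bilinear in \<open>s\<close> and \<open>t\<close>, so it suffices
    to compare them on words, where the product is concatenation.\<close>
  have mult: "h (s \<otimes>\<^bsub>TA\<^esub> t) = h s \<otimes>\<^bsub>P\<^esub> h t" if "s \<in> carrier TA" "t \<in> carrier TA" for s t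
  proof (rule bilin_eq_on_span[OF TA.module_axioms TA.module_axioms P.module_axioms
        lin_bilin_compose[OF TA.bilin_prod h] bilin_compose[OF P.bilin_prod h h] sub sub])
    show "s \<in> module_span R TA (tensor_word ` lists (carrier L))"
      "t \<in> module_span R TA (tensor_word ` lists (carrier L))" using that tensor_word_span by auto
    fix x y assume "x \<in> tensor_word ` lists (carrier L)" "y \<in> tensor_word ` lists (carrier L)"
    then obtain us vs where "x = tensor_word us" "y = tensor_word vs" "set us \<subseteq> carrier L" "set vs \<subseteq> carrier L"
      by auto
    then show "h (x \<otimes>\<^bsub>TA\<^esub> y) = h x \<otimes>\<^bsub>P\<^esub> h y" by (simp add: tensor_word_mult hw app del: foldr_append)
  qed
  note hc = lin_closed[OF h]
  have "algebra_ideal R TA {t \<in> carrier TA. h t = \<zero>\<^bsub>P\<^esub>}"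
    unfolding algebra_ideal_def using TP.submodule_kernel[OF h] hc by (auto simp: mult TA.prod_closed)
  moreover have "uea_relator x y \<in> {t \<in> carrier TA. h t = \<zero>\<^bsub>P\<^esub>}" if xy: "x \<in> carrier L" "y \<in> carrier L" for x y
  proof -
    have w: "tensor_word [x, y] \<in> carrier TA" "tensor_word [y, x] \<in> carrier TA" "tensor_word [x \<otimes>\<^bsub>L\<^esub> y] \<in> carrier TA"
      using xy by (auto intro!: tensor_word_closed simp: prod_closed)
    have "h (uea_relator x y) = (?f [x, y] \<ominus>\<^bsub>P\<^esub> ?f [y, x]) \<ominus>\<^bsub>P\<^esub> ?f [x \<otimes>\<^bsub>L\<^esub> y]"
      using w xy by (simp add: TP.lin_minus[OF h] hw prod_closed)
    also have "\<dots> = \<zero>\<^bsub>P\<^esub>" using xy pc by (simp add: br P.minus_eq_zero_iff)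
    finally show ?thesis using uea_relator_closed[OF xy] by simp
  qed
  ultimately have ker: "h t = \<zero>\<^bsub>P\<^esub>" if "t \<in> J" for t using uea_ideal_least that by blast
  show ?thesis
  proof
    show "lin R U P (qlift h)" unfolding uea_def by (rule TP.lin_qlift[OF h J_submodule ker])
    show "qlift h (m (tensor_word xs)) = ?f xs" if "set xs \<subseteq> carrier L" for xs
      unfolding m_eq using TP.qlift_coset[OF h J_submodule ker tensor_word_closed[OF that]] hw[OF that] by simp
  qed
qed

end

section \<open>Lyndon trees span the free Lie algebra\<close>

locale free_lie_ordered = ordered_cring R r
  for R :: "('k, 'r) ring_scheme" (structure) and r :: "('v \<times> 'v) set" +
  fixes \<Lambda> :: "'v set"
begin

abbreviation "FA \<equiv> free_nonassoc R \<Lambda>"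
abbreviation "FL \<equiv> free_lie R \<Lambda>"
abbreviation "I \<equiv> gen_algebra_ideal R FA (lie_relators FA)"

sublocale A: nonassoc_algebra R FA
  by (rule nonassoc_algebra_free_nonassoc) (rule is_cring)

sublocale L: lie_algebra R FL
  by (rule lie_algebra_free_lie) (rule is_cring)

abbreviation "NC \<equiv> nc_series R :: ('k, 'v list \<Rightarrow> 'k) module"

text \<open>The two records differ only in the product, which these notions do not read; facts about
  free modules thus transfer.\<close>

lemma FA_simps:
  "carrier FA = carrier (free_module R {t. gens t \<subseteq> \<Lambda>})"
  "lin R FA P = lin R (free_module R {t. gens t \<subseteq> \<Lambda>}) P"
  "module_span R FA = module_span R (free_module R {t. gens t \<subseteq> \<Lambda>})"
  by (auto simp: free_nonassoc_def lin_def module_span_def submodule_def subgroup_def submodule_axioms_def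
      m_inv_def fun_eq_iff)

lemma FA_span: "module_span R FA (unit_vec R ` {t. gens t \<subseteq> \<Lambda>}) = carrier FA"
  unfolding FA_simps by (rule free_module_span)

lemma unit_vec_FA: "gens t \<subseteq> \<Lambda> \<Longrightarrow> unit_vec R t \<in> carrier FA"
  unfolding FA_simps by (rule unit_vec_closed[OF is_cring]) simp

lemma unit_vec_Node: "unit_vec R (Node s t) = unit_vec R s \<otimes>\<^bsub>FA\<^esub> unit_vec R t"
  by (auto simp: free_nonassoc_def unit_vec_def fun_eq_iff split: magma.splits)

lemma I_ideal: "algebra_ideal R FA I"
  by (rule A.gen_algebra_ideal) (auto simp: lie_relators_def A.prod_closed)

lemma I_submodule: "submodule I R FA"
  using I_ideal by (simp add: algebra_ideal_def)

definition tree_class :: "'v magma \<Rightarrow> ('v magma \<Rightarrow> 'k) set"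
  where "tree_class t = I +>\<^bsub>FA\<^esub> unit_vec R t"

lemma lin_FA_FL: "lin R FA FL (\<lambda>x. I +>\<^bsub>FA\<^esub> x)"
  unfolding free_lie_def by (rule A.lin_coset[OF I_submodule])

lemma FL_mult:
  "\<lbrakk>x \<in> carrier FA; y \<in> carrier FA\<rbrakk> \<Longrightarrow> (I +>\<^bsub>FA\<^esub> x) \<otimes>\<^bsub>FL\<^esub> (I +>\<^bsub>FA\<^esub> y) = I +>\<^bsub>FA\<^esub> (x \<otimes>\<^bsub>FA\<^esub> y)"
  unfolding free_lie_def by (rule A.quot_mult[OF I_ideal])

lemma carrier_FL: "carrier FL = (\<lambda>x. I +>\<^bsub>FA\<^esub> x) ` carrier FA"
  unfolding free_lie_def by (rule carrier_quot)

lemma tree_class_closed: "gens t \<subseteq> \<Lambda> \<Longrightarrow> tree_class t \<in> carrier FL"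
  unfolding tree_class_def carrier_FL by (intro imageI unit_vec_FA)

lemma tree_class_Node:
  "\<lbrakk>gens s \<subseteq> \<Lambda>; gens t \<subseteq> \<Lambda>\<rbrakk> \<Longrightarrow> tree_class (Node s t) = tree_class s \<otimes>\<^bsub>FL\<^esub> tree_class t"
  by (simp add: tree_class_def unit_vec_Node FL_mult unit_vec_FA)

lemma tree_class_image: "X \<subseteq> {t. gens t \<subseteq> \<Lambda>} \<Longrightarrow> tree_class ` X \<subseteq> carrier FL"
  using tree_class_closed by auto

text \<open>The letter set \<open>Q\<close> is carried along because termination counts words over
  it. The length is exact, so that bracketing with a further tree again has a known length.\<close>

definition lyndon_below :: "'v set \<Rightarrow> nat \<Rightarrow> 'v list \<Rightarrow> 'v magma set"
  where "lyndon_below Q n v = {u. lyndon u \<and> gens u \<subseteq> Q \<and> length (foliage u) = n \<and> foliage u \<prec> v}"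

text \<open>
  The bracket of two Lyndon trees \<open>s \<prec> t\<close> is a combination of Lyndon trees below \<open>t\<close>: if the tree
  \<open>Node s t\<close> is not itself Lyndon, expand \<open>s\<close> by the Jacobi identity.  This terminates because
  either the total length drops or the larger of the two words does.
\<close>

lemma lyndon_bracket:
  assumes Q: "finite Q" "Q \<subseteq> \<Lambda>" and s: "lyndon s" "gens s \<subseteq> Q" and t: "lyndon t" "gens t \<subseteq> Q"
    and st: "foliage s \<prec> foliage t"
  shows "tree_class s \<otimes>\<^bsub>FL\<^esub> tree_class t \<in> module_span R FL
    (tree_class ` lyndon_below Q (length (foliage s) + length (foliage t)) (foliage t))"
proof -
  \<comment> \<open>Lexicographic descent alone need not stop, as in \<open>b\<close>,
    \<open>ab\<close>, \<open>aab\<close> and so on. With the length bounded by \<open>n\<close> and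
    letters from \<open>Q\<close> there are finitely many words below \<open>v\<close>, and their
    number serves as a measure.\<close>
  define M where "M n v = {w. set w \<subseteq> Q \<and> length w \<le> n \<and> w \<prec> v}" for n v
  have Mfin: "finite (M n v)" for n v
    by (rule finite_subset[OF _ finite_lists_length_le[OF Q(1), of n]]) (auto simp: M_def)
  have Mless: "card (M n u) < card (M n v)" if "u \<prec> v" "set u \<subseteq> Q" "length u \<le> n" for n u v
  proof (rule psubset_card_mono[OF Mfin])
    \<comment> \<open>The word \<open>u\<close> itself is counted for \<open>v\<close> but not for
      \<open>u\<close>.\<close>
    have "u \<in> M n v" "u \<notin> M n u" using that lex_irrefl by (auto simp: M_def)
    moreover have "M n u \<subseteq> M n v" using that(1) lex_trans by (auto simp: M_def)
    ultimately show "M n u \<subset> M n v" by blast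
  qed
  let ?rel = "measures [\<lambda>(s, t). length (foliage s) + length (foliage t),
      \<lambda>(s, t). card (M (length (foliage s) + length (foliage t)) (foliage t))]"
  let ?S = "\<lambda>n v. module_span R FL (tree_class ` lyndon_below Q n v)"
  have sub: "tree_class ` lyndon_below Q n v \<subseteq> carrier FL" for n v
    using Q by (intro tree_class_image) (auto simp: lyndon_below_def)
  note sm = L.module_span_submodule[OF sub]
  interpret LL: module_pair R FL FL ..
  have "lyndon s \<and> gens s \<subseteq> Q \<and> lyndon t \<and> gens t \<subseteq> Q \<and> foliage s \<prec> foliage t \<longrightarrow>
      tree_class s \<otimes>\<^bsub>FL\<^esub> tree_class t \<in> ?S (length (foliage s) + length (foliage t)) (foliage t)"
  proof (induction "(s, t)" arbitrary: s t rule: wf_induct_rule[OF wf_measures[of "[\<lambda>(s, t). length (foliage s) + length (foliage t),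
      \<lambda>(s, t). card (M (length (foliage s) + length (foliage t)) (foliage t))]"]])
    case (1 s t)
    show ?case
    proof
      assume h: "lyndon s \<and> gens s \<subseteq> Q \<and> lyndon t \<and> gens t \<subseteq> Q \<and> foliage s \<prec> foliage t"
      let ?n = "length (foliage s) + length (foliage t)"
      show "tree_class s \<otimes>\<^bsub>FL\<^esub> tree_class t \<in> ?S ?n (foliage t)"
      proof (cases "lyndon (Node s t)")
        case True
        have "foliage s @ foliage t \<prec> foliage t"
          using lyndon_suffix[OF True, of "foliage s" "foliage t"] by simp
        then have "Node s t \<in> lyndon_below Q ?n (foliage t)" using True h by (simp add: lyndon_below_def)
        then have "tree_class (Node s t) \<in> ?S ?n (foliage t)"
          using L.module_span_superset[of "tree_class ` lyndon_below Q ?n (foliage t)"] by auto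
        moreover have "gens s \<subseteq> \<Lambda>" "gens t \<subseteq> \<Lambda>" using h Q by auto
        ultimately show ?thesis by (simp add: tree_class_Node)
      next
        case False
        \<comment> \<open>The other clauses of \<open>lyndon\<close> hold by assumption, so the last
          one fails; totality turns this into a strict inequality.\<close>
        then obtain s1 s2 where s12: "s = Node s1 s2" "foliage s2 \<prec> foliage t"
          using h lex_total by fastforce
        have ls: "lyndon s1" "lyndon s2" "gens s1 \<subseteq> Q" "gens s2 \<subseteq> Q" "foliage s1 \<prec> foliage s2"
          using h s12 by auto
        then have s1t: "foliage s1 \<prec> foliage t" using s12 lex_trans by blast
        have c: "tree_class s1 \<in> carrier FL" "tree_class s2 \<in> carrier FL" "tree_class t \<in> carrier FL"
          using ls h Q by (auto intro!: tree_class_closed)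
        \<comment> \<open>At unchanged total length, the larger of two trees that both lie below
          \<open>t\<close> gives a smaller second measure. Antisymmetry puts the trees in order, and
          equal trees have bracket zero.\<close>
        have same: "tree_class a \<otimes>\<^bsub>FL\<^esub> tree_class b \<in> ?S ?n (foliage t)"
          if a: "lyndon a" "gens a \<subseteq> Q" "foliage a \<prec> foliage t" and b: "lyndon b" "gens b \<subseteq> Q" "foliage b \<prec> foliage t"
            and len: "length (foliage a) + length (foliage b) = ?n" for a b
        proof -
          have ac: "tree_class a \<in> carrier FL" "tree_class b \<in> carrier FL"
            using a b Q by (auto intro!: tree_class_closed)
          have less: "tree_class a \<otimes>\<^bsub>FL\<^esub> tree_class b \<in> ?S ?n (foliage t)"
            if a: "lyndon a" "gens a \<subseteq> Q" and b: "lyndon b" "gens b \<subseteq> Q" "foliage b \<prec> foliage t"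
              and ab: "foliage a \<prec> foliage b"
              and len: "length (foliage a) + length (foliage b) = ?n" for a b
          proof -
            have "((a, b), (s, t)) \<in> ?rel" using len Mless[of "foliage b" "foliage t" ?n] b by simp
            then have "tree_class a \<otimes>\<^bsub>FL\<^esub> tree_class b \<in> ?S ?n (foliage b)"
              using 1[of a b] a b ab len by simp
            moreover have "?S ?n (foliage b) \<subseteq> ?S ?n (foliage t)"
              using b lex_trans by (intro L.module_span_mono image_mono) (auto simp: lyndon_below_def)
            ultimately show ?thesis by auto
          qed
          consider "foliage a \<prec> foliage b" | "a = b" | "foliage b \<prec> foliage a"
            using lex_total foliage_inj a b by blast
          then show ?thesis
          proof cases
            case 1
            then show ?thesis using less a b len by simp
          next
            case 2
            then show ?thesis using ac L.bracket_self L.submodule_zero_closed[OF sm] by simp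
          next
            case 3
            then have "tree_class b \<otimes>\<^bsub>FL\<^esub> tree_class a \<in> ?S ?n (foliage t)"
              using less[of b a] a b len by (simp add: add.commute)
            then show ?thesis using L.bracket_antisym[OF ac] L.submodule_uminus_closed[OF sm] by simp
          qed
        qed
        \<comment> \<open>The inner bracket has smaller total length, so it expands into Lyndon
          trees below \<open>t\<close>. Bracketing each of them with \<open>a\<close>, also below
          \<open>t\<close>, restores the length, and \<open>same\<close> applies.\<close>
        have iter: "tree_class a \<otimes>\<^bsub>FL\<^esub> (tree_class b \<otimes>\<^bsub>FL\<^esub> tree_class t) \<in> ?S ?n (foliage t)"
          if a: "lyndon a" "gens a \<subseteq> Q" "foliage a \<prec> foliage t" and b: "lyndon b" "gens b \<subseteq> Q" "foliage b \<prec> foliage t"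
            and len: "length (foliage a) + length (foliage b) = length (foliage s)" for a b
        proof (rule LL.lin_span_subset[OF bilin_right[OF L.bilin_prod] sm])
          let ?k = "length (foliage b) + length (foliage t)"
          show "tree_class a \<in> carrier FL" using a Q by (auto intro!: tree_class_closed)
          have "length (foliage a) > 0" by simp
          then have "length (foliage b) < length (foliage s)" using len by linarith
          then have "((b, t), (s, t)) \<in> ?rel" by simp
          then show "tree_class b \<otimes>\<^bsub>FL\<^esub> tree_class t \<in> ?S ?k (foliage t)" using 1[of b t] b h by simp
          fix x assume "x \<in> tree_class ` lyndon_below Q ?k (foliage t)"
          then obtain u where u: "x = tree_class u" "lyndon u" "gens u \<subseteq> Q" "length (foliage u) = ?k"
            "foliage u \<prec> foliage t" by (auto simp: lyndon_below_def)
          then show "x \<in> carrier FL" using Q by (auto intro!: tree_class_closed)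
          show "tree_class a \<otimes>\<^bsub>FL\<^esub> x \<in> ?S ?n (foliage t)" using same[of a u] a u len by simp
        qed
        have "tree_class s = tree_class s1 \<otimes>\<^bsub>FL\<^esub> tree_class s2"
          using tree_class_Node[of s1 s2] s12 ls(3,4) Q(2) by (simp add: subset_trans[of _ Q])
        then show ?thesis
          using L.bracket_derivation[OF c] L.submodule_minus_closed[OF sm iter[of s1 s2] iter[of s2 s1]]
            ls s12 s1t by simp
      qed
    qed
  qed
  then show ?thesis using s t st by simp
qed

abbreviation "LT \<equiv> {t. lyndon t \<and> gens t \<subseteq> \<Lambda>}"

lemma tree_class_LT: "tree_class ` LT \<subseteq> carrier FL"
  by (rule tree_class_image) auto

lemma lyndon_bracket_span:
  assumes "s \<in> LT" "t \<in> LT"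
  shows "tree_class s \<otimes>\<^bsub>FL\<^esub> tree_class t \<in> module_span R FL (tree_class ` LT)"
proof -
  note sm = L.module_span_submodule[OF tree_class_LT]
  have c: "tree_class s \<in> carrier FL" "tree_class t \<in> carrier FL" using assms tree_class_closed by auto
  have less: "tree_class s \<otimes>\<^bsub>FL\<^esub> tree_class t \<in> module_span R FL (tree_class ` LT)"
    if st: "s \<in> LT" "t \<in> LT" "foliage s \<prec> foliage t" for s t
  proof -
    \<comment> \<open>\<open>\<Lambda>\<close> may be infinite, but rewriting introduces no new
      letters, so those of the two trees suffice.\<close>
    let ?Q = "gens s \<union> gens t"
    have "finite ?Q" using finite_set[of "foliage s"] finite_set[of "foliage t"] by simp
    then have "tree_class s \<otimes>\<^bsub>FL\<^esub> tree_class t \<in> module_span R FL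
        (tree_class ` lyndon_below ?Q (length (foliage s) + length (foliage t)) (foliage t))"
      using st by (intro lyndon_bracket) auto
    moreover have "tree_class ` lyndon_below ?Q n v \<subseteq> tree_class ` LT" for n v
      using st by (intro image_mono) (auto simp: lyndon_below_def)
    ultimately show ?thesis by (rule subsetD[OF L.module_span_mono, rotated])
  qed
  consider "foliage s \<prec> foliage t" | "s = t" | "foliage t \<prec> foliage s"
    using lex_total foliage_inj assms by blast
  then show ?thesis
  proof cases
    case 1
    then show ?thesis using less assms by simp
  next
    case 2
    then show ?thesis using c L.bracket_self L.submodule_zero_closed[OF sm] by simp
  next
    case 3
    then show ?thesis
      using less[OF assms(2,1)] L.bracket_antisym[OF c] L.submodule_uminus_closed[OF sm] by simp
  qed
qed

lemma lyndon_span: "module_span R FL (tree_class ` LT) = carrier FL"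
proof
  interpret AL: module_pair R FA FL ..
  note sm = L.module_span_submodule[OF tree_class_LT]
  show "module_span R FL (tree_class ` LT) \<subseteq> carrier FL"
    by (rule L.module_span_carrier[OF tree_class_LT])
  have tree: "tree_class t \<in> module_span R FL (tree_class ` LT)" if "gens t \<subseteq> \<Lambda>" for t
    using that
  proof (induction t)
    case (Gen v)
    then have "Gen v \<in> LT" by simp
    then show ?case using L.module_span_superset[of "tree_class ` LT"] by blast
  next
    case (Node s t)
    have "tree_class s \<otimes>\<^bsub>FL\<^esub> tree_class t \<in> module_span R FL (tree_class ` LT)"
      by (rule bilin_span_subset[OF L.module_axioms L.module_axioms L.module_axioms L.bilin_prod sm
            tree_class_LT tree_class_LT])
        (use Node lyndon_bracket_span in auto)
    then show ?case using Node.prems by (simp add: tree_class_Node)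
  qed
  have "I +>\<^bsub>FA\<^esub> x \<in> module_span R FL (tree_class ` LT)" if "x \<in> carrier FA" for x
    by (rule AL.lin_span_subset[OF lin_FA_FL sm, of "unit_vec R ` {t. gens t \<subseteq> \<Lambda>}"])
      (use that tree in \<open>auto simp: FA_span unit_vec_FA tree_class_def\<close>)
  then show "carrier FL \<subseteq> module_span R FL (tree_class ` LT)" unfolding carrier_FL by auto
qed

section \<open>The Poincare-Birkhoff-Witt theorem for free Lie algebras\<close>

text \<open>Extended linearly, \<open>commutator_tree\<close> sends products of trees to
  commutators. Its kernel is therefore an ideal, and it contains all squares and Jacobi expressions
  since commutators in an associative ring satisfy the Lie axioms.\<close>

lemma free_lie_nc_map:
  obtains p where "lin R FL NC p" "\<And>t. gens t \<subseteq> \<Lambda> \<Longrightarrow> p (tree_class t) = commutator_tree R t"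
    "\<And>x y. \<lbrakk>x \<in> carrier FL; y \<in> carrier FL\<rbrakk> \<Longrightarrow>
       p (x \<otimes>\<^bsub>FL\<^esub> y) = p x \<otimes>\<^bsub>NC\<^esub> p y \<ominus>\<^bsub>NC\<^esub> p y \<otimes>\<^bsub>NC\<^esub> p x"
proof -
  interpret N: nonassoc_algebra R NC by (rule nc_series_algebra)
  interpret Nr: ring NC by (rule nc_series_ring)
  interpret AN: module_pair R FA NC ..
  let ?h = "lin_ext R NC (commutator_tree R)"
  have e: "commutator_tree R \<in> {t. gens t \<subseteq> \<Lambda>} \<rightarrow> carrier NC" by (simp add: commutator_tree_closed)
  have h: "lin R FA NC ?h" unfolding FA_simps by (rule N.lin_lin_ext[OF e])
  note hc = lin_closed[OF h]
  have hu: "?h (unit_vec R t) = commutator_tree R t" if "gens t \<subseteq> \<Lambda>" for t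
    by (rule N.lin_ext_unit_vec[OF e]) (use that in simp)
  have u: "unit_vec R ` {t. gens t \<subseteq> \<Lambda>} \<subseteq> carrier FA" using unit_vec_FA by auto
  have hm: "?h (x \<otimes>\<^bsub>FA\<^esub> y) = ?h x \<otimes>\<^bsub>NC\<^esub> ?h y \<ominus>\<^bsub>NC\<^esub> ?h y \<otimes>\<^bsub>NC\<^esub> ?h x"
    if "x \<in> carrier FA" "y \<in> carrier FA" for x y
  proof (rule bilin_eq_on_span[OF A.module_axioms A.module_axioms N.module_axioms
        lin_bilin_compose[OF A.bilin_prod h] bilin_compose[OF N.bilin_commutator h h] u u])
    show "x \<in> module_span R FA (unit_vec R ` {t. gens t \<subseteq> \<Lambda>})"
      "y \<in> module_span R FA (unit_vec R ` {t. gens t \<subseteq> \<Lambda>})" using that by (simp_all add: FA_span)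
    fix a b assume "a \<in> unit_vec R ` {t. gens t \<subseteq> \<Lambda>}" "b \<in> unit_vec R ` {t. gens t \<subseteq> \<Lambda>}"
    then obtain s t where "a = unit_vec R s" "b = unit_vec R t" "gens s \<subseteq> \<Lambda>" "gens t \<subseteq> \<Lambda>" by auto
    then show "?h (a \<otimes>\<^bsub>FA\<^esub> b) = ?h a \<otimes>\<^bsub>NC\<^esub> ?h b \<ominus>\<^bsub>NC\<^esub> ?h b \<otimes>\<^bsub>NC\<^esub> ?h a"
      by (simp add: hu flip: unit_vec_Node)
  qed
  have "algebra_ideal R FA {x \<in> carrier FA. ?h x = \<zero>\<^bsub>NC\<^esub>}"
    unfolding algebra_ideal_def using AN.submodule_kernel[OF h] hc
    by (auto simp: hm A.prod_closed N.minus_eq_zero_iff)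
  moreover have "lie_relators FA \<subseteq> {x \<in> carrier FA. ?h x = \<zero>\<^bsub>NC\<^esub>}"
    unfolding lie_relators_def using hc
    by (auto simp: hm A.prod_closed lin_add[OF h] N.minus_eq_zero_iff Nr.commutator_jacobi)
  ultimately have ker: "?h x = \<zero>\<^bsub>NC\<^esub>" if "x \<in> I" for x
    using that unfolding gen_algebra_ideal_def by blast
  note q = AN.qlift_coset[OF h I_submodule ker]
  show ?thesis
  proof
    show "lin R FL NC (qlift ?h)" unfolding free_lie_def by (rule AN.lin_qlift[OF h I_submodule ker])
    show "qlift ?h (tree_class t) = commutator_tree R t" if "gens t \<subseteq> \<Lambda>" for t
      unfolding tree_class_def using q unit_vec_FA hu that by simp
    show "qlift ?h (x \<otimes>\<^bsub>FL\<^esub> y) = qlift ?h x \<otimes>\<^bsub>NC\<^esub> qlift ?h y \<ominus>\<^bsub>NC\<^esub> qlift ?h y \<otimes>\<^bsub>NC\<^esub> qlift ?h x"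
      if "x \<in> carrier FL" "y \<in> carrier FL" for x y
      using that unfolding carrier_FL by (auto simp: FL_mult q A.prod_closed hm)
  qed
qed

lemma lyndon_list_sort:
  assumes "\<forall>t\<in>set ts. lyndon t"
  shows "\<exists>us. mset us = mset ts \<and> lyndon_list us"
  using assms
proof (induction ts)
  case Nil
  then show ?case by (simp add: lyndon_list_def)
next
  case (Cons t ts)
  let ?P = "\<lambda>s t. foliage t \<preceq> foliage s"
  have ins: "\<exists>zs. mset zs = add_mset t (mset us) \<and> sorted_wrt ?P zs" if "sorted_wrt ?P us" for us
    using that
  proof (induction us)
    case (Cons u us)
    show ?case
    proof (cases "?P t u")
      case True
      then have "\<forall>x\<in>set (u # us). ?P t x" using Cons.prems lex_trans by fastforce
      then show ?thesis using Cons.prems by (intro exI[of _ "t # u # us"]) auto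
    next
      \<comment> \<open>Totality puts \<open>t\<close> strictly below \<open>u\<close> in this case,
        so \<open>u\<close> may stay in front of the list into which \<open>t\<close> is
        inserted.\<close>
      case False
      obtain zs where zs: "mset zs = add_mset t (mset us)" "sorted_wrt ?P zs" using Cons by auto
      have "set zs = insert t (set us)" using zs(1) by (metis set_mset_add_mset_insert set_mset_mset)
      then have "\<forall>x\<in>set zs. ?P u x" using False lex_total Cons.prems by auto
      then show ?thesis using zs by (intro exI[of _ "u # zs"]) auto
    qed
  qed simp
  obtain us where us: "mset us = mset ts" "lyndon_list us" using Cons by auto
  obtain zs where zs: "mset zs = add_mset t (mset us)" "sorted_wrt ?P zs"
    using ins us(2) by (auto simp: lyndon_list_def)
  have m: "mset zs = mset (t # ts)" using zs us by simp
  then have "set zs = set (t # ts)" by (metis set_mset_mset)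
  then have "lyndon_list zs" using zs(2) Cons.prems by (simp add: lyndon_list_def)
  then show ?case using m by blast
qed

lemma pbw_free_lie: "pbw_map R FL n \<in> module_iso R (sym_power R FL n) (uea_graded R FL n)"
proof -
  interpret N: nonassoc_algebra R NC by (rule nc_series_algebra)
  interpret Nr: ring NC by (rule nc_series_ring)
  interpret U: module R L.U by (rule L.U_module)
  interpret UN: module_pair R L.U NC ..
  obtain p where p: "lin R FL NC p" and pt: "\<And>t. gens t \<subseteq> \<Lambda> \<Longrightarrow> p (tree_class t) = commutator_tree R t"
    and pm: "\<And>x y. \<lbrakk>x \<in> carrier FL; y \<in> carrier FL\<rbrakk> \<Longrightarrow>
       p (x \<otimes>\<^bsub>FL\<^esub> y) = p x \<otimes>\<^bsub>NC\<^esub> p y \<ominus>\<^bsub>NC\<^esub> p y \<otimes>\<^bsub>NC\<^esub> p x"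
    using free_lie_nc_map by blast
  obtain g where g: "lin R L.U NC g"
    and gw: "\<And>xs. set xs \<subseteq> carrier FL \<Longrightarrow> g (L.m (L.tensor_word xs)) = foldr (\<lambda>x f. p x \<otimes>\<^bsub>NC\<^esub> f) xs \<one>\<^bsub>NC\<^esub>"
    using L.uea_lift[OF N.nonassoc_algebra_axioms Nr.ring_axioms p pm] by blast
  let ?B = "{ts. lyndon_list ts \<and> set ts \<subseteq> LT}"
  have B: "set (map tree_class ts) \<subseteq> carrier FL" if "ts \<in> ?B" for ts
    using that tree_class_LT by auto
  have gp: "g (L.m (L.tensor_word (map tree_class ts))) = commutator_prod R ts" if "ts \<in> ?B" for ts
  proof -
    have "\<forall>t\<in>set ts. gens t \<subseteq> \<Lambda>" using that by auto
    then have "foldr (\<lambda>x f. p x \<otimes>\<^bsub>NC\<^esub> f) (map tree_class ts) \<one>\<^bsub>NC\<^esub> = commutator_prod R ts"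
      unfolding commutator_prod_def by (induction ts) (auto simp: pt)
    then show ?thesis using gw[OF B[OF that]] by simp
  qed
  show ?thesis
  proof (rule L.pbw_criterion[OF tree_class_LT lyndon_span, of ?B "map tree_class"])
    show "set (map tree_class ts) \<subseteq> tree_class ` LT" if "ts \<in> ?B" for ts using that by auto
  next
    fix xs assume "set xs \<subseteq> tree_class ` LT"
    then have "\<forall>x\<in>set xs. \<exists>t. t \<in> LT \<and> x = tree_class t" by auto
    \<comment> \<open>Different trees might have the same class, so a tree is chosen for each class
      and the chosen trees are sorted instead of the classes.\<close>
    then obtain f where f: "\<And>x. x \<in> set xs \<Longrightarrow> f x \<in> LT \<and> x = tree_class (f x)" by metis
    obtain us where us: "mset us = mset (map f xs)" "lyndon_list us"
      using lyndon_list_sort[of "map f xs"] f by auto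
    have "set us = f ` set xs" using us(1) by (metis set_mset_mset set_map)
    then have "us \<in> ?B" using us f by auto
    moreover have "map tree_class (map f xs) = xs" using f by (simp add: map_idI)
    then have "mset (map tree_class us) = mset xs" using us(1) by (metis mset_map)
    ultimately show "\<exists>ts\<in>?B. mset (map tree_class ts) = mset xs" by blast
  next
    fix c ts assume c: "c \<in> carrier (free_module R ?B)"
      and z: "lin_ext R L.U (\<lambda>ts. L.m (L.tensor_word (map tree_class ts))) c = \<zero>\<^bsub>L.U\<^esub>"
    have e: "(\<lambda>ts. L.m (L.tensor_word (map tree_class ts))) \<in> ?B \<rightarrow> carrier L.U"
      using B by (intro funcsetI L.m_word_closed)
    have cc: "c \<in> carrier (free_module R {ts. lyndon_list ts})" by (rule free_module_mono[OF _ c]) auto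
    \<comment> \<open>Applying \<open>g\<close> carries the relation in the enveloping algebra to
      one between products of commutators, where leading words settle it.\<close>
    have "\<zero>\<^bsub>NC\<^esub> = lin_ext R NC (\<lambda>ts. g (L.m (L.tensor_word (map tree_class ts)))) c"
      using UN.lin_of_lin_ext[OF g e c] z UN.lin_zero[OF g] by simp
    also have "\<dots> = lin_ext R NC (commutator_prod R) c"
      by (rule N.lin_ext_cong[OF c gp]) (use leads_commutator_prod in \<open>auto simp: lyndon_list_def leads_def\<close>)
    finally show "c ts = \<zero>" using commutator_prod_independent[OF cc] by simp
  qed
qed

end

text \<open>A well-ordering of the type of generators with the diagonal removed.\<close>

lemma ex_strict_total_order: "\<exists>r :: ('v \<times> 'v) set. strict_total_order r"
proof -
  obtain r :: "('v \<times> 'v) set" where "well_order_on UNIV r" using well_order_on by blast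
  then have r: "trans r" "antisym r" "total r"
    by (auto simp: well_order_on_def linear_order_on_def partial_order_on_def preorder_on_def)
  have "strict_total_order (r - Id)"
    by (rule strict_total_order.intro) (use r in \<open>auto simp: irrefl_def trans_diff_Id total_on_def\<close>)
  then show ?thesis by blast
qed

theorem proposition3p3:
  fixes R :: "('k, 'r) ring_scheme" and \<Lambda> :: "'v set"
  assumes "cring R"
  shows "\<forall>n. pbw_map R (free_lie R \<Lambda>) n
               \<in> module_iso R (sym_power R (free_lie R \<Lambda>) n) (uea_graded R (free_lie R \<Lambda>) n)"
proof
  fix n
  interpret cring R by fact
  obtain r :: "('v \<times> 'v) set" where "strict_total_order r" using ex_strict_total_order by blast
  then interpret strict_total_order r .
  interpret free_lie_ordered R r \<Lambda> ..
  show "pbw_map R (free_lie R \<Lambda>) n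
      \<in> module_iso R (sym_power R (free_lie R \<Lambda>) n) (uea_graded R (free_lie R \<Lambda>) n)"
    by (rule pbw_free_lie)
qed

end
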